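(* Let $t$ be a fixed positive integer and let $\mathfrak{H}$ be the class of all finite groups in which every Sylow subgroup is $\mathrm{K}$-$\mathbb{P}_{t}$-subnormal. Let $G$ be a finite group. Then the following assertions hold. (1) $\mathfrak{N}\subseteq\mathfrak{H}$ and every group in $\mathfrak{H}$ is Ore dispersive. (2) If $G\in\mathfrak{H}$ and $N\unlhd G$, then $G/N\in\mathfrak{H}$. (3) If $N_{1}\unlhd G$, $N_{2}\unlhd G$, $G/N_{1}\in\mathfrak{H}$ and $G/N_{2}\in\mathfrak{H}$, then $G/(N_{1}\cap N_{2})\in\mathfrak{H}$. (4) A direct product of groups from $\mathfrak{H}$ lies in $\mathfrak{H}$. (5) If $G\in\mathfrak{H}$ and $U$ is a subgroup of $G$, then $U\in\mathfrak{H}$. (6) If $G/\Phi(G)\in\mathfrak{H}$, then $G\in\mathfrak{H}$. (7) The class $\mathfrak{H}$ is a hereditary saturated formation.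
   Context: All groups are finite, and $t$ is a fixed natural number ($t\ge 1$). A subgroup $H$ of a group $G$ is called $\mathrm{K}$-$\mathbb{P}_{t}$-subnormal in $G$ if there exists a chain of subgroups $H=H_{0}\leq H_{1}\leq\cdots\leq H_{n-1}\leq H_{n}=G$ such that for every $i=1,\ldots,n$ either $H_{i-1}\unlhd H_{i}$, or $|H_{i}:H_{i-1}|$ is a prime $p$ such that $p-1$ is not divisible by the $(t+1)$th power of any prime. "Every Sylow subgroup of $G$ is $\mathrm{K}$-$\mathbb{P}_{t}$-subnormal" means that for every prime $p$ every Sylow $p$-subgroup of $G$ is $\mathrm{K}$-$\mathbb{P}_{t}$-subnormal in $G$. $\mathfrak{N}$ is the class of all nilpotent groups, and $\Phi(G)$ is the Frattini subgroup of $G$. A group $G$ of order $p_1^{\alpha_1}p_2^{\alpha_2}\cdots p_n^{\alpha_n}$ ($p_i$ prime) is called Ore dispersive if $p_1>p_2>\cdots>p_n$ and $G$ has a normal subgroup of order $p_1^{\alpha_1}\cdots p_i^{\alpha_i}$ for every $i=1,\ldots,n$. A class of groups $\mathfrak{F}$ is a formation if (a) every quotient group of a group in $\mathfrak{F}$ lies in $\mathfrak{F}$, and (b) $G/N_1,G/N_2\in\mathfrak{F}$ with $N_1,N_2\unlhd G$ implies $G/(N_1\cap N_2)\in\mathfrak{F}$. A formation $\mathfrak{F}$ is hereditary if it contains all subgroups of each of its groups, and saturated if $G/\Phi(G)\in\mathfrak{F}$ implies $G\in\mathfrak{F}$. *)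

theory Defs
  imports
    "HOL-Algebra.Algebra"
    "HOL-Computational_Algebra.Primes"
begin

text \<open>
  With \<^theory>\<open>HOL-Algebra.Algebra\<close> in scope the bare name for primality may refer to the notion
  relative to a monoid, hence the qualified \<open>Factorial_Ring.prime\<close> throughout.
\<close>

section \<open>\<open>K\<close>-\<open>P\<^sub>t\<close>-subnormal subgroups\<close>

definition KP_step :: "nat \<Rightarrow> ('a, 'b) monoid_scheme \<Rightarrow> 'a set \<Rightarrow> 'a set \<Rightarrow> bool" where
  "KP_step t G A B \<longleftrightarrow>
     A \<lhd> G\<lparr>carrier := B\<rparr> \<or>
     (\<exists>p::nat. Factorial_Ring.prime p \<and>
        card (rcosets\<^bsub>G\<lparr>carrier := B\<rparr>\<^esub> A) = p \<and>
        \<not> (\<exists>q::nat. Factorial_Ring.prime q \<and> q ^ (t + 1) dvd p - 1))"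

definition KP_subnormal :: "nat \<Rightarrow> 'a set \<Rightarrow> ('a, 'b) monoid_scheme \<Rightarrow> bool" where
  "KP_subnormal t H G \<longleftrightarrow>
     (\<exists>(n::nat) C. C 0 = H \<and> C n = carrier G \<and>
        (\<forall>i\<le>n. subgroup (C i) G) \<and>
        (\<forall>i\<in>{1..n}. C (i - 1) \<subseteq> C i \<and> KP_step t G (C (i - 1)) (C i)))"

text \<open>
  For a prime not dividing the order of \<open>G\<close> the Sylow subgroup is trivial.
\<close>

definition sylow_subgroup :: "nat \<Rightarrow> 'a set \<Rightarrow> ('a, 'b) monoid_scheme \<Rightarrow> bool" where
  "sylow_subgroup p P G \<longleftrightarrow> subgroup P G \<and> card P = p ^ multiplicity p (order G)"

definition sylow_KP_group :: "nat \<Rightarrow> ('a, 'b) monoid_scheme \<Rightarrow> bool" where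
  "sylow_KP_group t G \<longleftrightarrow>
     group G \<and> finite (carrier G) \<and>
     (\<forall>(p::nat) P. Factorial_Ring.prime p \<longrightarrow> sylow_subgroup p P G \<longrightarrow> KP_subnormal t P G)"


section \<open>Nilpotency, Ore dispersivity, Frattini subgroup\<close>

primrec lower_central :: "('a, 'b) monoid_scheme \<Rightarrow> nat \<Rightarrow> 'a set" where
  "lower_central G 0 = carrier G"
| "lower_central G (Suc n) =
     generate G (\<Union>x\<in>lower_central G n. \<Union>y\<in>carrier G.
                   {x \<otimes>\<^bsub>G\<^esub> y \<otimes>\<^bsub>G\<^esub> inv\<^bsub>G\<^esub> x \<otimes>\<^bsub>G\<^esub> inv\<^bsub>G\<^esub> y})"

definition nilpotent_group :: "('a, 'b) monoid_scheme \<Rightarrow> bool" where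
  "nilpotent_group G \<longleftrightarrow> group G \<and> (\<exists>n. lower_central G n = {\<one>\<^bsub>G\<^esub>})"

definition ore_dispersive :: "('a, 'b) monoid_scheme \<Rightarrow> bool" where
  "ore_dispersive G \<longleftrightarrow>
     (\<exists>(n::nat) (p::nat \<Rightarrow> nat) (\<alpha>::nat \<Rightarrow> nat).
        (\<forall>i\<in>{1..n}. Factorial_Ring.prime (p i) \<and> \<alpha> i \<ge> 1) \<and>
        (\<forall>i\<in>{1..n}. \<forall>j\<in>{1..n}. i < j \<longrightarrow> p i > p j) \<and>
        order G = (\<Prod>i=1..n. p i ^ \<alpha> i) \<and>
        (\<forall>i\<in>{1..n}. \<exists>N. N \<lhd> G \<and> card N = (\<Prod>j=1..i. p j ^ \<alpha> j)))"

definition maximal_subgroup :: "'a set \<Rightarrow> ('a, 'b) monoid_scheme \<Rightarrow> bool" where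
  "maximal_subgroup M G \<longleftrightarrow>
     subgroup M G \<and> M \<noteq> carrier G \<and>
     (\<forall>H. subgroup H G \<longrightarrow> M \<subseteq> H \<longrightarrow> H = M \<or> H = carrier G)"

text \<open>
  The intersection with the carrier only matters for the trivial group, which has no maximal
  subgroups.
\<close>

definition frattini :: "('a, 'b) monoid_scheme \<Rightarrow> 'a set" where
  "frattini G = carrier G \<inter> \<Inter> {M. maximal_subgroup M G}"


section \<open>Classes of finite groups\<close>

text \<open>
  A class of finite groups must be closed under operations, such as quotients, that change the type
  of the elements. It is therefore represented by those of its members whose elements are natural
  numbers; every finite group is isomorphic to one of these (lemma \<open>finite_group_nat_copy\<close>).
  A finite group over an arbitrary type is in the class if it is isomorphic to one of the members.
\<close>

lemma finite_group_nat_copy: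
  fixes G :: "('a, 'b) monoid_scheme"
  assumes "group G" and "finite (carrier G)"
  shows "\<exists>K :: nat monoid. group K \<and> finite (carrier K) \<and> G \<cong> K"
proof -
  obtain f :: "'a \<Rightarrow> nat" where inj: "inj_on f (carrier G)"
    using assms(2) finite_imp_inj_to_nat_seg by metis
  define K where "K = image_group f G"
  have iso: "f \<in> iso G K"
    unfolding K_def using assms(1) inj by (intro inj_imp_image_group_iso)
  have "group K"
    unfolding K_def using assms(1) inj by (intro group.inj_imp_image_group_is_group)
  moreover have "finite (carrier K)"
    using assms(2) by (simp add: K_def image_group_def)
  ultimately show ?thesis using iso unfolding is_iso_def by blast
qed

definition group_class :: "nat monoid set \<Rightarrow> bool" where
  "group_class F \<longleftrightarrow>
     (\<forall>G\<in>F. group G \<and> finite (carrier G)) \<and>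
     (\<forall>G\<in>F. \<forall>K :: nat monoid. group K \<longrightarrow> G \<cong> K \<longrightarrow> K \<in> F)"

definition in_class :: "('a, 'b) monoid_scheme \<Rightarrow> nat monoid set \<Rightarrow> bool" where
  "in_class G F \<longleftrightarrow> group G \<and> (\<exists>K\<in>F. G \<cong> K)"

definition formation :: "nat monoid set \<Rightarrow> bool" where
  "formation F \<longleftrightarrow> group_class F \<and>
     (\<forall>G\<in>F. \<forall>N. N \<lhd> G \<longrightarrow> in_class (G Mod N) F) \<and>
     (\<forall>(G :: nat monoid) N\<^sub>1 N\<^sub>2. group G \<longrightarrow> finite (carrier G) \<longrightarrow> N\<^sub>1 \<lhd> G \<longrightarrow> N\<^sub>2 \<lhd> G \<longrightarrow>
        in_class (G Mod N\<^sub>1) F \<longrightarrow> in_class (G Mod N\<^sub>2) F \<longrightarrow> in_class (G Mod (N\<^sub>1 \<inter> N\<^sub>2)) F)"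

definition hereditary :: "nat monoid set \<Rightarrow> bool" where
  "hereditary F \<longleftrightarrow> (\<forall>G\<in>F. \<forall>U. subgroup U G \<longrightarrow> in_class (G\<lparr>carrier := U\<rparr>) F)"

definition saturated :: "nat monoid set \<Rightarrow> bool" where
  "saturated F \<longleftrightarrow>
     (\<forall>G :: nat monoid. group G \<longrightarrow> finite (carrier G) \<longrightarrow>
        in_class (G Mod frattini G) F \<longrightarrow> in_class G F)"

definition hereditary_saturated_formation :: "nat monoid set \<Rightarrow> bool" where
  "hereditary_saturated_formation F \<longleftrightarrow> formation F \<and> hereditary F \<and> saturated F"

definition sylow_KP_class :: "nat \<Rightarrow> nat monoid set" where
  "sylow_KP_class t = {G. sylow_KP_group t G}"

end

theory Submission
  imports Defs "HOL-Number_Theory.Residues" "HOL-Computational_Algebra.Polynomial"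
begin

text \<open>
  The proof has three layers.

  The largest prime \<open>p\<close> dividing the order of a group \<open>G\<close> in the class has a normal
  Sylow subgroup \<open>P\<close>. Normality climbs along the given chain: a normal step preserves it
  because \<open>P\<close> is then characteristic in the smaller group, and across a step of prime
  index \<open>q < p\<close> the group \<open>P\<close> fixes all \<open>q\<close> cosets (\<open>KP_chain_sylow_normalised\<close>). Images
  of chains under epimorphisms are chains, so the class is closed under quotients, and
  an induction gives the Ore tower and solubility.

  Solubility makes the class hereditary. For a subgroup \<open>A\<close> of prime index \<open>p\<close> in a
  soluble group \<open>B\<close>, the centraliser \<open>C\<close> of a suitable factor of order \<open>p\<close> contains all
  commutators and all \<open>(p - 1)\<close>th powers of \<open>B\<close>, and \<open>C \<inter> A\<close> is normal in \<open>B\<close>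
  (\<open>prime_index_structure\<close>). Therefore the intersection of a step with any subgroup is
  either again of index \<open>p\<close> or normal (\<open>KP_link_inter\<close>). Direct products are treated by
  pulling back chains along the projections, and \<open>G / (N\<^sub>1 \<inter> N\<^sub>2)\<close>
  embeds in the product of \<open>G / N\<^sub>1\<close> and \<open>G / N\<^sub>2\<close>.

  For saturation, let \<open>G\<close> be a counterexample of least order whose quotient by a normal
  subgroup \<open>F\<close> of Frattini elements is in the class. All proper quotients are then in
  the class, so no two nontrivial normal subgroups meet trivially. By the Frattini
  argument the Sylow subgroup \<open>P\<close> for the largest prime \<open>p\<close> is normal. Put
  \<open>D = P \<inter> F\<close>. Only elements of \<open>P\<close> act trivially on \<open>P / D\<close>, since otherwise a
  further application of the Frattini argument would produce a nontrivial normal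
  subgroup that avoids \<open>P\<close> (\<open>frattini_quotient_centraliser\<close>). For a Sylow \<open>q\<close>-subgroup
  \<open>Q\<close> with \<open>q \<noteq> p\<close>, the chain that exists modulo \<open>D\<close> from \<open>Q D\<close> to \<open>Q P\<close> shows
  that the commutators and \<open>(p - 1)\<close>th powers in \<open>Q\<close> act trivially on \<open>P / D\<close>
  (\<open>chain_centralises\<close>); if steps of index \<open>p\<close> are not admissible, all of \<open>Q\<close> does.
  Hence \<open>Q\<close> is abelian of exponent dividing \<open>p - 1\<close>, and trivial in the second case. In
  the first case every chief factor of \<open>P Q\<close> below \<open>P\<close> has order \<open>p\<close> because the
  polynomial \<open>X^(p - 1) - 1\<close> splits into linear factors modulo \<open>p\<close> (\<open>eigenvector\<close>). This
  yields a chain from \<open>Q\<close> to \<open>Q P\<close> whose steps have index \<open>p\<close>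
  (\<open>KP_chain_abelian_complement\<close>).

  The inductions over quotients run over groups whose elements are natural numbers,
  where every quotient has a copy (\<open>nat_quotient\<close>); the results are then transferred
  along isomorphisms.
\<close>

hide_const (open) Divisibility.prime Polynomial.order
hide_fact (open) Polynomial.order_def

section \<open>Finite groups and their epimorphic images\<close>

lemma card_eq_fibres:
  assumes "finite S" and "\<And>y. y \<in> f ` S \<Longrightarrow> card {x \<in> S. f x = y} = k"
  shows "card S = k * card (f ` S)"
proof -
  have "card S = (\<Sum>x\<in>S. 1)" by simp
  also have "\<dots> = (\<Sum>y\<in>f ` S. \<Sum>x\<in>{x \<in> S. f x = y}. 1)"
    using assms(1) by (rule sum.image_gen)
  also have "\<dots> = (\<Sum>y\<in>f ` S. k)" using assms(2) by (intro sum.cong) auto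
  finally show ?thesis by simp
qed

lemma (in group) inv_mult_cancel:
  assumes "x \<in> carrier G" "y \<in> carrier G"
  shows "inv x \<otimes> (x \<otimes> y) = y" "x \<otimes> (inv x \<otimes> y) = y"
  using assms by (simp_all add: m_assoc[symmetric])

lemma (in group) subgroup_update_iff:
  assumes "subgroup B G"
  shows "subgroup A (G\<lparr>carrier := B\<rparr>) \<longleftrightarrow> subgroup A G \<and> A \<subseteq> B"
proof
  assume A: "subgroup A (G\<lparr>carrier := B\<rparr>)"
  show "subgroup A G \<and> A \<subseteq> B"
    using incl_subgroup[OF assms A] subgroup.subset[OF A] by simp
next
  assume "subgroup A G \<and> A \<subseteq> B"
  then show "subgroup A (G\<lparr>carrier := B\<rparr>)" using assms by (simp add: subgroup_incl)
qed

lemma order_carrier_update [simp]: "order (G\<lparr>carrier := B\<rparr>) = card B"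
  by (simp add: order_def)

lemma (in group) card_subgroup_dvd:
  assumes "subgroup A G" "subgroup B G" "A \<subseteq> B" "finite (carrier G)"
  shows "card A dvd card B"
proof -
  have "group (G\<lparr>carrier := B\<rparr>)" using assms(2) by (rule subgroup_imp_group)
  then have "card (rcosets\<^bsub>G\<lparr>carrier := B\<rparr>\<^esub> A) * card A = order (G\<lparr>carrier := B\<rparr>)"
    using assms by (intro group.lagrange) (auto simp: subgroup_update_iff)
  then show ?thesis by (metis dvd_triv_right order_carrier_update)
qed

lemma (in group) subgroup_finite:
  assumes "subgroup A G" "finite (carrier G)" shows "finite A"
  using finite_subset[OF subgroup.subset[OF assms(1)] assms(2)] .

lemma (in group) subgroup_card_pos:
  assumes "subgroup A G" "finite (carrier G)" shows "card A > 0"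
  using subgroup_finite[OF assms] subgroup.one_closed[OF assms(1)] by (auto simp: card_gt_0_iff)

lemma (in group) subgroup_card_dvd_order:
  assumes "subgroup A G" shows "card A dvd order G"
  using lagrange[OF assms] by (metis dvd_triv_right)

lemma (in group) rcosetsE:
  assumes "C \<in> rcosets A" obtains g where "g \<in> carrier G" "C = A #> g"
  using assms by (auto simp: RCOSETS_def)

lemma (in group) card_coset:
  assumes "A \<subseteq> carrier G" "x \<in> carrier G" shows "card (A #> x) = card A"
  using assms card_rcosets_equal[OF rcosetsI] by metis

text \<open>
  Since \<open>G = A U\<close>, the map that sends an element \<open>u\<close> of \<open>U\<close> to the coset \<open>A u\<close> is onto,
  and its fibres are the cosets of \<open>A \<inter> U\<close> in \<open>U\<close>.
\<close>

lemma (in group) card_transitive_supplement: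
  assumes U: "subgroup U G" and A: "subgroup A G" and fin: "finite (carrier G)"
    and cover: "\<And>g. g \<in> carrier G \<Longrightarrow> \<exists>a\<in>A. \<exists>u\<in>U. g = a \<otimes> u"
  shows "card U * card A = order G * card (A \<inter> U)"
proof -
  have Uc: "U \<subseteq> carrier G" and Ac: "A \<subseteq> carrier G" using U A subgroup.subset by auto
  have img: "(\<lambda>u. A #> u) ` U = rcosets A"
  proof
    show "(\<lambda>u. A #> u) ` U \<subseteq> rcosets A" using Uc Ac by (auto intro: rcosetsI)
    show "rcosets A \<subseteq> (\<lambda>u. A #> u) ` U"
    proof
      fix C assume "C \<in> rcosets A"
      then obtain g where g: "g \<in> carrier G" "C = A #> g" by (auto simp: RCOSETS_def)
      then obtain a u where au: "a \<in> A" "u \<in> U" "g = a \<otimes> u" using cover by blast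
      have "C = (A #> a) #> u" using g au Ac Uc by (simp add: coset_mult_assoc subset_iff)
      also have "A #> a = A" using au A Ac by (intro coset_join2) auto
      finally have "C = A #> u" .
      then show "C \<in> (\<lambda>u. A #> u) ` U" using au by blast
    qed
  qed
  have "card U = card (A \<inter> U) * card ((\<lambda>u. A #> u) ` U)"
  proof (rule card_eq_fibres)
    show "finite U" using Uc fin finite_subset by blast
    fix C assume "C \<in> (\<lambda>u. A #> u) ` U"
    then obtain u where u: "u \<in> U" "C = A #> u" by blast
    have "{x \<in> U. A #> x = C} = (A \<inter> U) #> u"
    proof
      show "(A \<inter> U) #> u \<subseteq> {x \<in> U. A #> x = C}"
      proof
        fix x assume "x \<in> (A \<inter> U) #> u"
        then obtain a where a: "a \<in> A" "a \<in> U" "x = a \<otimes> u" by (auto simp: r_coset_def)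
        then have "A #> x = (A #> a) #> u" using Ac Uc u by (simp add: coset_mult_assoc subset_iff)
        also have "A #> a = A" using a A Ac by (intro coset_join2) auto
        finally show "x \<in> {x \<in> U. A #> x = C}" using a u U by (simp add: subgroup.m_closed)
      qed
      show "{x \<in> U. A #> x = C} \<subseteq> (A \<inter> U) #> u"
      proof
        fix x assume "x \<in> {x \<in> U. A #> x = C}"
        then have x: "x \<in> U" "A #> x = A #> u" using u by auto
        then have "x \<in> A #> u" using Uc A by (metis rcos_self subsetD)
        then obtain a where a: "a \<in> A" "x = a \<otimes> u" by (auto simp: r_coset_def)
        have "a = x \<otimes> inv u" using a Ac Uc u x by (metis inv_solve_right subsetD)
        then have "a \<in> U" using U x u by (simp add: subgroup.m_closed subgroup.m_inv_closed)
        then show "x \<in> (A \<inter> U) #> u" using a by (auto simp: r_coset_def)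
      qed
    qed
    moreover have "card ((A \<inter> U) #> u) = card (A \<inter> U)"
      using Ac Uc u by (intro card_coset) auto
    ultimately show "card {x \<in> U. A #> x = C} = card (A \<inter> U)" by simp
  qed
  then have "card U * card A = card (A \<inter> U) * (card (rcosets A) * card A)" by (simp add: img)
  also have "card (rcosets A) * card A = order G" using A by (rule lagrange)
  finally show ?thesis by (simp add: mult.commute)
qed

lemma (in group_hom) card_hom_image:
  assumes A: "subgroup A G" and fin: "finite (carrier G)"
  shows "card A = card (kernel G H h \<inter> A) * card (h ` A)"
proof (rule card_eq_fibres)
  have Ac: "A \<subseteq> carrier G" using A subgroup.subset by auto
  show "finite A" using A fin G.subgroup_finite by blast
  fix y assume "y \<in> h ` A"
  then obtain a where a: "a \<in> A" "y = h a" by blast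
  have "{x \<in> A. h x = y} = (kernel G H h \<inter> A) #> a"
  proof
    show "(kernel G H h \<inter> A) #> a \<subseteq> {x \<in> A. h x = y}"
    proof
      fix x assume "x \<in> (kernel G H h \<inter> A) #> a"
      then obtain k where k: "k \<in> kernel G H h" "k \<in> A" "x = k \<otimes> a"
        by (auto simp: r_coset_def)
      then show "x \<in> {x \<in> A. h x = y}"
        using a Ac A by (auto simp: kernel_def subgroup.m_closed subset_iff)
    qed
    show "{x \<in> A. h x = y} \<subseteq> (kernel G H h \<inter> A) #> a"
    proof
      fix x assume "x \<in> {x \<in> A. h x = y}"
      then have x: "x \<in> A" "h x = h a" using a by auto
      have xa: "x \<in> carrier G" "a \<in> carrier G" using x a Ac by auto
      then have "x \<otimes> inv a \<in> kernel G H h \<inter> A"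
        using x a A by (auto simp: kernel_def subgroup.m_closed subgroup.m_inv_closed)
      moreover have "x = (x \<otimes> inv a) \<otimes> a" using xa by (simp add: G.m_assoc)
      ultimately show "x \<in> (kernel G H h \<inter> A) #> a" unfolding r_coset_def by blast
    qed
  qed
  moreover have "card ((kernel G H h \<inter> A) #> a) = card (kernel G H h \<inter> A)"
    using Ac a by (intro G.card_coset) auto
  ultimately show "card {x \<in> A. h x = y} = card (kernel G H h \<inter> A)" by simp
qed

text \<open>
  Quotients are handled through epimorphisms instead of factor groups: the kernel
  determines everything that matters, while the type of the elements of the image
  remains free.
\<close>

locale finite_epi = group_hom +
  assumes finG: "finite (carrier G)" and surj: "h ` carrier G = carrier H"
begin

abbreviation ker where "ker \<equiv> kernel G H h"
abbreviation preim where "preim B \<equiv> {x \<in> carrier G. h x \<in> B}"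

lemma finH: "finite (carrier H)" unfolding surj[symmetric] using finG by (rule finite_imageI)

lemma preim_subgroup:
  assumes "subgroup B H" shows "subgroup (preim B) G"
proof
  show "preim B \<subseteq> carrier G" by auto
  show "x \<otimes> y \<in> preim B" if "x \<in> preim B" "y \<in> preim B" for x y
    using that assms by (simp add: subgroup.m_closed)
  show "\<one> \<in> preim B" using assms by (simp add: subgroup.one_closed)
  show "inv x \<in> preim B" if "x \<in> preim B" for x
    using that assms by (simp add: subgroup.m_inv_closed)
qed

lemma image_preim:
  assumes "B \<subseteq> carrier H" shows "h ` preim B = B"
proof
  show "h ` preim B \<subseteq> B" by blast
  show "B \<subseteq> h ` preim B"
  proof
    fix y assume y: "y \<in> B"
    then obtain x where "x \<in> carrier G" "y = h x" using assms surj by blast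
    then show "y \<in> h ` preim B" using y by blast
  qed
qed

lemma ker_in_preim:
  assumes "subgroup B H" shows "ker \<subseteq> preim B"
proof
  fix x assume "x \<in> ker"
  then have "x \<in> carrier G" "h x = \<one>\<^bsub>H\<^esub>" by (simp_all add: kernel_def)
  then show "x \<in> preim B" using subgroup.one_closed[OF assms] by simp
qed

lemma card_preim:
  assumes "subgroup B H" shows "card (preim B) = card ker * card B"
proof -
  have "card (preim B) = card (ker \<inter> preim B) * card (h ` preim B)"
    using preim_subgroup[OF assms] finG by (rule card_hom_image)
  moreover have "ker \<inter> preim B = ker" using ker_in_preim[OF assms] by blast
  moreover have "h ` preim B = B" using subgroup.subset[OF assms] by (rule image_preim)
  ultimately show ?thesis by simp
qed

lemma order_epi: "order G = card ker * order H"
proof -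
  have "preim (carrier H) = carrier G" using hom_closed by blast
  then show ?thesis using card_preim[OF H.subgroup_self] unfolding order_def by (rule subst)
qed

lemma preim_normal:
  assumes "N \<lhd> H" shows "preim N \<lhd> G"
proof (rule G.normal_invI)
  show "subgroup (preim N) G" using assms by (intro preim_subgroup normal_imp_subgroup)
  fix x n assume "x \<in> carrier G" "n \<in> preim N"
  then show "x \<otimes> n \<otimes> inv x \<in> preim N" using normal.inv_op_closed2[OF assms, of "h x" "h n"] by simp
qed

lemma image_subgroup:
  assumes "subgroup A G" shows "subgroup (h ` A) H"
  using assms by (rule subgroup_img_is_subgroup)

lemma image_normal:
  assumes "N \<lhd> G" shows "h ` N \<lhd> H"
proof (rule H.normal_invI)
  show "subgroup (h ` N) H" using assms by (intro image_subgroup normal_imp_subgroup)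
  fix x n assume x: "x \<in> carrier H" and "n \<in> h ` N"
  then obtain m where m: "m \<in> N" "n = h m" by blast
  obtain g where g: "g \<in> carrier G" "x = h g" using x surj by blast
  have mc: "m \<in> carrier G" using m assms normal_imp_subgroup subgroup.mem_carrier by metis
  have "g \<otimes> m \<otimes> inv g \<in> N" using assms g m by (intro normal.inv_op_closed2)
  moreover have "h (g \<otimes> m \<otimes> inv g) = x \<otimes>\<^bsub>H\<^esub> n \<otimes>\<^bsub>H\<^esub> inv\<^bsub>H\<^esub> x" using g m mc by simp
  ultimately show "x \<otimes>\<^bsub>H\<^esub> n \<otimes>\<^bsub>H\<^esub> inv\<^bsub>H\<^esub> x \<in> h ` N" by (metis imageI)
qed

lemma preim_image:
  assumes "subgroup A G" "ker \<subseteq> A" shows "preim (h ` A) = A"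
proof
  show "A \<subseteq> preim (h ` A)" using subgroup.subset[OF assms(1)] by blast
  show "preim (h ` A) \<subseteq> A"
  proof
    fix x assume "x \<in> preim (h ` A)"
    then obtain a where a: "x \<in> carrier G" "a \<in> A" "h x = h a" by auto
    have ac: "a \<in> carrier G" using a assms subgroup.mem_carrier by metis
    have "x \<otimes> inv a \<in> ker" using a ac by (simp add: kernel_def)
    then have "x \<otimes> inv a \<otimes> a \<in> A" using assms a by (meson subgroup.m_closed subsetD)
    then show "x \<in> A" using a ac by (simp add: G.m_assoc)
  qed
qed

lemma preim_image_member:
  assumes "subgroup A G" "x \<in> preim (h ` A)"
  obtains k a where "k \<in> ker" "a \<in> A" "x = a \<otimes> k"
proof -
  obtain a where a: "x \<in> carrier G" "a \<in> A" "h x = h a" using assms(2) by auto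
  have ac: "a \<in> carrier G" using a assms subgroup.mem_carrier by metis
  have "inv a \<otimes> x \<in> ker" using a ac by (simp add: kernel_def)
  moreover have "x = a \<otimes> (inv a \<otimes> x)" using a ac by (simp add: G.m_assoc[symmetric])
  ultimately show thesis using that a by blast
qed

end

lemma finite_epiI:
  assumes "group G" "group H" "h \<in> hom G H" "finite (carrier G)" "h ` carrier G = carrier H"
  shows "finite_epi G H h"
  using assms by (simp add: finite_epi_def finite_epi_axioms_def group_hom_def group_hom_axioms_def)

lemma finite_epi_quotient:
  assumes "N \<lhd> G" "finite (carrier G)"
  shows "finite_epi G (G Mod N) (\<lambda>x. N #>\<^bsub>G\<^esub> x)" and "kernel G (G Mod N) (\<lambda>x. N #>\<^bsub>G\<^esub> x) = N"
proof -
  interpret normal N G by fact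
  show "finite_epi G (G Mod N) (\<lambda>x. N #>\<^bsub>G\<^esub> x)"
    by (rule finite_epiI[OF is_group factorgroup_is_group r_coset_hom_Mod assms(2)])
       (simp add: carrier_FactGroup)
  show "kernel G (G Mod N) (\<lambda>x. N #>\<^bsub>G\<^esub> x) = N"
  proof
    show "kernel G (G Mod N) (\<lambda>x. N #>\<^bsub>G\<^esub> x) \<subseteq> N"
    proof
      fix x assume "x \<in> kernel G (G Mod N) (\<lambda>x. N #>\<^bsub>G\<^esub> x)"
      then have "x \<in> carrier G" "N #>\<^bsub>G\<^esub> x = N" by (simp_all add: kernel_def)
      then show "x \<in> N" using rcos_self[OF _ is_subgroup, of x] by simp
    qed
    show "N \<subseteq> kernel G (G Mod N) (\<lambda>x. N #>\<^bsub>G\<^esub> x)"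
    proof
      fix x assume "x \<in> N"
      then show "x \<in> kernel G (G Mod N) (\<lambda>x. N #>\<^bsub>G\<^esub> x)"
        using coset_join2[OF _ is_subgroup, of x] by (simp add: kernel_def)
    qed
  qed
qed

lemma finite_epi_comp:
  assumes "finite_epi G H f" "finite_epi H K g" shows "finite_epi G K (g \<circ> f)"
proof -
  interpret a: finite_epi G H f by fact
  interpret b: finite_epi H K g by fact
  show ?thesis
  proof (rule finite_epiI)
    show "g \<circ> f \<in> hom G K" using a.homh b.homh by (rule Group.hom_compose)
    show "(g \<circ> f) ` carrier G = carrier K" unfolding image_comp[symmetric] a.surj b.surj ..
  qed (auto simp: a.finG)
qed

lemma finite_epi_iso:
  assumes "f \<in> iso G K" "group G" "group K" "finite (carrier G)"
  shows "finite_epi G K f" "kernel G K f = {\<one>\<^bsub>G\<^esub>}"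
proof -
  show "finite_epi G K f" using assms by (intro finite_epiI) (auto simp: iso_iff)
  interpret group_hom G K f using assms by (simp add: group_hom_def group_hom_axioms_def Group.iso_iff)
  have "inj_on f (carrier G)" using assms(1) by (simp add: Group.iso_iff)
  then show "kernel G K f = {\<one>\<^bsub>G\<^esub>}" unfolding inj_iff_trivial_ker .
qed

text \<open>
  Every quotient has a copy over the natural numbers. An induction on the order that
  runs over groups of natural numbers can therefore pass to quotients without leaving
  its type.
\<close>

lemma nat_quotient:
  assumes "N \<lhd> G" "finite (carrier G)"
  obtains K :: "nat monoid" and f where "finite_epi G K f" "kernel G K f = N"
proof -
  interpret q: finite_epi G "G Mod N" "\<lambda>x. N #>\<^bsub>G\<^esub> x" by (rule finite_epi_quotient[OF assms])
  have kerq: "kernel G (G Mod N) (\<lambda>x. N #>\<^bsub>G\<^esub> x) = N" by (rule finite_epi_quotient[OF assms])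
  obtain K :: "nat monoid" and i where K: "group K" "i \<in> iso (G Mod N) K"
    using finite_group_nat_copy[OF q.H.is_group q.finH] by (auto simp: is_iso_def)
  interpret i: finite_epi "G Mod N" K i by (rule finite_epi_iso) (use K q.finH in auto)
  have ki: "kernel (G Mod N) K i = {\<one>\<^bsub>G Mod N\<^esub>}" by (rule finite_epi_iso) (use K q.finH in auto)
  let ?f = "i \<circ> (\<lambda>x. N #>\<^bsub>G\<^esub> x)"
  have "finite_epi G K ?f" using q.finite_epi_axioms i.finite_epi_axioms by (rule finite_epi_comp)
  moreover have "kernel G K ?f = N"
  proof -
    have "i (N #>\<^bsub>G\<^esub> x) = \<one>\<^bsub>K\<^esub> \<longleftrightarrow> N #>\<^bsub>G\<^esub> x = N" if "x \<in> carrier G" for x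
      using ki q.hom_closed[OF that] i.hom_one by (auto simp: kernel_def)
    then have "kernel G K ?f = kernel G (G Mod N) (\<lambda>x. N #>\<^bsub>G\<^esub> x)"
      by (auto simp: kernel_def)
    then show ?thesis using kerq by simp
  qed
  ultimately show thesis by (rule that)
qed

lemma nat_copy:
  assumes "group G" "finite (carrier G)"
  obtains K :: "nat monoid" and f where "finite_epi G K f" "kernel G K f = {\<one>\<^bsub>G\<^esub>}"
  using nat_quotient[OF group.one_is_normal[OF assms(1)] assms(2)] by blast

lemma finite_epi_inverse:
  assumes "finite_epi G K f" "kernel G K f = {\<one>\<^bsub>G\<^esub>}"
  obtains g where "finite_epi K G g" "kernel K G g = {\<one>\<^bsub>K\<^esub>}" "\<And>x. x \<in> carrier G \<Longrightarrow> g (f x) = x"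
proof -
  interpret finite_epi G K f by fact
  have inj: "inj_on f (carrier G)" using assms(2) by (simp add: inj_iff_trivial_ker)
  then have "f \<in> iso G K" using homh surj by (simp add: Group.iso_iff)
  then have i: "inv_into (carrier G) f \<in> iso K G" by (rule G.iso_set_sym)
  show thesis
    by (rule that[OF finite_epi_iso[OF i]]) (auto simp: finH inj)
qed

lemma finite_epi_factor:
  assumes "finite_epi G H f" "finite_epi G K g" "kernel G H f \<subseteq> kernel G K g"
  obtains e where "finite_epi H K e" "\<And>x. x \<in> carrier G \<Longrightarrow> e (f x) = g x"
proof -
  interpret f: finite_epi G H f by fact
  interpret g: finite_epi G K g by fact
  define e where "e y = g (inv_into (carrier G) f y)" for y
  have e: "e (f x) = g x" if x: "x \<in> carrier G" for x
  proof -
    define x' where "x' = inv_into (carrier G) f (f x)"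
    have x': "x' \<in> carrier G" "f x' = f x"
      unfolding x'_def using x by (auto intro: inv_into_into f_inv_into_f)
    then have "x' \<otimes>\<^bsub>G\<^esub> inv\<^bsub>G\<^esub> x \<in> kernel G H f" using x by (simp add: kernel_def)
    then have "x' \<otimes>\<^bsub>G\<^esub> inv\<^bsub>G\<^esub> x \<in> kernel G K g" using assms(3) by blast
    then have "g x' \<otimes>\<^bsub>K\<^esub> inv\<^bsub>K\<^esub> g x = \<one>\<^bsub>K\<^esub>" using x x' by (simp add: kernel_def)
    then have "g x' = g x" using x x' g.H.inv_equality[of "g x'" "inv\<^bsub>K\<^esub> g x"] by simp
    then show ?thesis by (simp add: e_def x'_def)
  qed
  have "finite_epi H K e"
  proof (rule finite_epiI)
    show "e \<in> hom H K"
    proof (rule homI)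
      fix x y assume "x \<in> carrier H" "y \<in> carrier H"
      then obtain a b where ab: "a \<in> carrier G" "b \<in> carrier G" "x = f a" "y = f b"
        using f.surj by blast
      then show "e (x \<otimes>\<^bsub>H\<^esub> y) = e x \<otimes>\<^bsub>K\<^esub> e y"
        using e[of "a \<otimes>\<^bsub>G\<^esub> b"] by (simp add: e)
    next
      fix x assume "x \<in> carrier H"
      then show "e x \<in> carrier K" using f.surj e g.hom_closed by (metis imageE)
    qed
    show "e ` carrier H = carrier K"
      unfolding f.surj[symmetric] g.surj[symmetric] image_image using e by (auto intro: image_cong)
  qed (auto simp: f.finH)
  then show thesis using e by (rule that)
qed

section \<open>Actions of groups of prime power order\<close>

text \<open>
  Orbits have \<open>p\<close>-power size, so an orbit that is not a single fixed point contributes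
  nothing modulo \<open>p\<close>.
\<close>

lemma p_group_action_fixed_points:
  fixes R (structure)
  assumes "group R" "prime p" "card (carrier R) = p ^ k" "finite S"
    and closed: "\<And>g x. g \<in> carrier R \<Longrightarrow> x \<in> S \<Longrightarrow> act g x \<in> S"
    and act_one: "\<And>x. x \<in> S \<Longrightarrow> act \<one> x = x"
    and act_mult: "\<And>g h x. g \<in> carrier R \<Longrightarrow> h \<in> carrier R \<Longrightarrow> x \<in> S \<Longrightarrow> act (g \<otimes> h) x = act g (act h x)"
  shows "[card S = card {x \<in> S. \<forall>g\<in>carrier R. act g x = x}] (mod p)"
proof -
  interpret R: group R by fact
  define \<phi> where "\<phi> g = restrict (act g) S" for g
  have bij: "\<phi> g \<in> Bij S" if g: "g \<in> carrier R" for g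
  proof -
    have "bij_betw (act g) S S"
    proof (rule bij_betw_byWitness[where f' = "act (inv g)"])
      show "\<forall>x\<in>S. act (inv g) (act g x) = x" "\<forall>x\<in>S. act g (act (inv g) x) = x"
        using g by (simp_all add: act_mult[symmetric] act_one)
      show "act g ` S \<subseteq> S" "act (inv g) ` S \<subseteq> S" using g closed R.inv_closed[OF g] by blast+
    qed
    then show ?thesis by (simp add: \<phi>_def Bij_def)
  qed
  interpret group_action R S \<phi>
  proof (intro group_action.intro group_hom.intro group_hom_axioms.intro homI)
    show "group R" "group (BijGroup S)" by (fact | rule group_BijGroup)+
    show "\<phi> g \<in> carrier (BijGroup S)" if "g \<in> carrier R" for g
      using bij[OF that] by (simp add: BijGroup_def)
    show "\<phi> (g \<otimes> h) = \<phi> g \<otimes>\<^bsub>BijGroup S\<^esub> \<phi> h" if "g \<in> carrier R" "h \<in> carrier R" for g h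
      using bij[OF that(1)] bij[OF that(2)] that closed
      by (simp add: BijGroup_def \<phi>_def compose_def act_mult fun_eq_iff)
  qed
  define F where "F = {x \<in> S. \<forall>g\<in>carrier R. act g x = x}"
  define Orb where "Orb = orbits R S \<phi>"
  have orbit_eq: "orbit R \<phi> x = {act g x | g. g \<in> carrier R}" if "x \<in> S" for x
    using that by (simp add: orbit_def \<phi>_def)
  have orbit_cong: "[card orb = card (orb \<inter> F)] (mod p)" if orbit: "orb \<in> Orb" for orb
  proof -
    obtain x where x: "x \<in> S" "orb = orbit R \<phi> x"
      using orbit unfolding Orb_def orbits_def by blast
    have orb: "orb = {act g x | g. g \<in> carrier R}" using x orbit_eq by simp
    have xorb: "x \<in> orb" unfolding orb using act_one[OF x(1)] by force
    have "card orb dvd p ^ k"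
      using orbit_stabilizer_theorem[OF x(1)] assms(3) x(2) by (metis dvd_triv_left order_def)
    then obtain i where i: "card orb = p ^ i" using assms(2) by (metis divides_primepow_nat)
    show ?thesis
    proof (cases "i = 0")
      case True
      then have "card orb = 1" using i by simp
      then have sing: "orb = {x}" using xorb by (metis card_1_singletonE singletonD)
      then have "\<forall>g\<in>carrier R. act g x = x" using orb by blast
      then have "orb \<inter> F = orb" using sing x by (auto simp: F_def)
      then show ?thesis by simp
    next
      case False
      have "orb \<inter> F = {}"
      proof (rule ccontr)
        assume "orb \<inter> F \<noteq> {}"
        then obtain y where y: "y \<in> orb" "y \<in> F" by blast
        then obtain g where g: "g \<in> carrier R" "y = act g x" using orb by blast
        have "act (inv g) y = x"
          using g x by (simp add: act_mult[symmetric] act_one)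
        then have "y = x" using y g by (auto simp: F_def)
        then have "orb = {x}" using y xorb unfolding orb F_def by blast
        then have "p ^ i = 1" using i by simp
        then show False using False assms(2) by (simp add: prime_gt_1_nat less_imp_neq)
      qed
      moreover have "p dvd card orb" using False i by simp
      ultimately show ?thesis by (simp add: cong_def)
    qed
  qed
  have fin: "finite orb" if "orb \<in> Orb" for orb
    using that assms(4) orbits_coverture unfolding Orb_def by (metis Sup_upper finite_subset)
  have cS: "card S = (\<Sum>orb\<in>Orb. card orb)"
    using disjoint_sum[OF assms(4), of "\<lambda>_. 1::nat"] by (simp add: Orb_def)
  have FS: "F \<subseteq> S" by (auto simp: F_def)
  have "card F = (\<Sum>x\<in>S. if x \<in> F then 1 else 0)"
    using FS assms(4) by (simp add: sum.If_cases Int_absorb1)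
  also have "\<dots> = (\<Sum>orb\<in>Orb. \<Sum>x\<in>orb. if x \<in> F then 1 else 0)"
    using disjoint_sum[OF assms(4), of "\<lambda>x. if x \<in> F then 1 else 0::nat"] by (simp add: Orb_def)
  also have "\<dots> = (\<Sum>orb\<in>Orb. card (orb \<inter> F))"
    using fin by (intro sum.cong) (auto simp: sum.If_cases Int_def)
  finally have cF: "card F = (\<Sum>orb\<in>Orb. card (orb \<inter> F))" .
  have "[card S = card F] (mod p)" unfolding cS cF using orbit_cong by (rule cong_sum)
  then show ?thesis by (simp add: F_def)
qed

text \<open>
  The subgroup \<open>R\<close> acts on the right cosets of \<open>A\<close> by right multiplication with
  inverses.
\<close>

lemma (in group) p_subgroup_fixed_cosets:
  assumes R: "subgroup R G" "card R = p ^ k" "prime p" and A: "subgroup A G"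
    and fin: "finite (carrier G)"
  shows "[card (rcosets A) = card {C \<in> rcosets A. \<forall>r\<in>R. C #> inv r = C}] (mod p)"
proof -
  have Rc: "r \<in> carrier G" if "r \<in> R" for r using that R(1) subgroup.mem_carrier by metis
  have Cc: "C \<subseteq> carrier G" if "C \<in> rcosets A" for C
    using that rcosets_part_G[OF A] by blast
  have cl: "C #> inv r \<in> rcosets A" if C: "C \<in> rcosets A" and r: "r \<in> R" for C r
  proof -
    obtain g where "g \<in> carrier G" "C = A #> g" using C by (rule rcosetsE)
    then have "C #> inv r = A #> (g \<otimes> inv r)"
      using r Rc subgroup.subset[OF A] by (simp add: coset_mult_assoc)
    then show ?thesis using \<open>g \<in> carrier G\<close> r Rc subgroup.subset[OF A] by (simp add: rcosetsI)
  qed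
  have "[card (rcosets A) = card {C \<in> rcosets A. \<forall>r\<in>carrier (G\<lparr>carrier := R\<rparr>). C #> inv r = C}] (mod p)"
  proof (rule p_group_action_fixed_points)
    show "group (G\<lparr>carrier := R\<rparr>)" using R(1) by (rule subgroup_imp_group)
    show "finite (rcosets A)"
      using fin rcosets_subset_PowG[OF A] finite_subset by blast
    show "C #> inv \<one>\<^bsub>G\<lparr>carrier := R\<rparr>\<^esub> = C" if "C \<in> rcosets A" for C
      using Cc[OF that] by simp
    show "C #> inv (g \<otimes>\<^bsub>G\<lparr>carrier := R\<rparr>\<^esub> h) = C #> inv h #> inv g"
      if "g \<in> carrier (G\<lparr>carrier := R\<rparr>)" "h \<in> carrier (G\<lparr>carrier := R\<rparr>)" "C \<in> rcosets A" for g h C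
      using that Rc Cc[OF that(3)] by (simp add: inv_mult_group coset_mult_assoc)
  qed (use R cl in auto)
  then show ?thesis by simp
qed

lemma (in group) fixed_coset_conj:
  assumes R: "subgroup R G" and A: "subgroup A G" and g: "g \<in> carrier G"
    and fixed: "\<forall>r\<in>R. (A #> g) #> inv r = A #> g" and r: "r \<in> R"
  shows "g \<otimes> r \<otimes> inv g \<in> A"
proof -
  have rc: "r \<in> carrier G" using r R subgroup.mem_carrier by metis
  have Ac: "A \<subseteq> carrier G" using A by (rule subgroup.subset)
  have "inv r \<in> R" using R r by (simp add: subgroup.m_inv_closed)
  then have "(A #> g) #> inv (inv r) = A #> g" using fixed by blast
  then have "A #> (g \<otimes> r) = A #> g" using g rc Ac by (simp add: coset_mult_assoc)
  moreover have "g \<otimes> r \<in> A #> (g \<otimes> r)" using g rc A by (intro rcos_self) auto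
  ultimately have "g \<otimes> r \<in> A #> g" by simp
  then obtain a where a: "a \<in> A" "g \<otimes> r = a \<otimes> g" by (auto simp: r_coset_def)
  then have "g \<otimes> r \<otimes> inv g = a" using g Ac by (simp add: m_assoc subset_iff)
  then show ?thesis using a by simp
qed

text \<open>
  Half of Sylow's second theorem: the number of cosets of \<open>A\<close> is prime to \<open>p\<close>, so \<open>R\<close>
  fixes one of them, and fixing \<open>A g\<close> means that \<open>g\<close> conjugates \<open>R\<close> into \<open>A\<close>.
\<close>

lemma (in group) p_subgroup_conj_into:
  assumes R: "subgroup R G" "card R = p ^ k" "prime p" and A: "subgroup A G"
    and idx: "order G = card A * m" "\<not> p dvd m" and fin: "finite (carrier G)"
  obtains g where "g \<in> carrier G" "\<And>r. r \<in> R \<Longrightarrow> g \<otimes> r \<otimes> inv g \<in> A"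
proof -
  let ?F = "{C \<in> rcosets A. \<forall>r\<in>R. C #> inv r = C}"
  have "card (rcosets A) = m"
    using lagrange[OF A] idx(1) subgroup_card_pos[OF A fin] by simp
  then have "\<not> p dvd card ?F"
    using cong_dvd_iff[OF p_subgroup_fixed_cosets[OF R A fin]] idx(2) by simp
  then have "?F \<noteq> {}" by force
  then obtain C where C: "C \<in> rcosets A" "\<forall>r\<in>R. C #> inv r = C" by blast
  then obtain g where g: "g \<in> carrier G" "C = A #> g" using C(1) by (elim rcosetsE)
  show thesis
    using g C by (intro that[OF g(1)] fixed_coset_conj[OF R(1) A g(1)]) auto
qed

text \<open>
  With fewer than \<open>p\<close> cosets, the congruence between the number of cosets and the number
  of fixed ones is an equality.
\<close>

lemma (in group) p_subgroup_small_index: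
  assumes R: "subgroup R G" "card R = p ^ k" "prime p" and A: "subgroup A G"
    and idx: "order G = q * card A" "q < p" and fin: "finite (carrier G)"
    and g: "g \<in> carrier G" and r: "r \<in> R"
  shows "g \<otimes> r \<otimes> inv g \<in> A"
proof -
  let ?F = "{C \<in> rcosets A. \<forall>r\<in>R. C #> inv r = C}"
  have cr: "card (rcosets A) = q"
    using lagrange[OF A] idx(1) subgroup_card_pos[OF A fin] by simp
  have fr: "finite (rcosets A)" using fin rcosets_subset_PowG[OF A] finite_subset by blast
  then have "card ?F \<le> q" unfolding cr[symmetric] by (intro card_mono) auto
  then have "card ?F = card (rcosets A)"
    using p_subgroup_fixed_cosets[OF R A fin] idx(2) cr by (simp add: cong_def)
  then have "?F = rcosets A" using fr by (intro card_subset_eq) auto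
  moreover have "A #> g \<in> rcosets A" using g A subgroup.subset by (intro rcosetsI) auto
  ultimately have "\<forall>r\<in>R. (A #> g) #> inv r = A #> g" by blast
  then show ?thesis using R(1) A g r by (intro fixed_coset_conj)
qed

text \<open>
  The fixed points of \<open>R\<close> on \<open>N\<close> under conjugation are at least one in number, because
  of the identity, and a multiple of \<open>p\<close>.
\<close>

lemma (in group) p_subgroup_centralises:
  assumes R: "subgroup R G" "card R = p ^ k" "prime p" and N: "subgroup N G" "p dvd card N"
    and norm: "\<And>r n. r \<in> R \<Longrightarrow> n \<in> N \<Longrightarrow> r \<otimes> n \<otimes> inv r \<in> N" and fin: "finite (carrier G)"
  obtains v where "v \<in> N" "v \<noteq> \<one>" "\<And>r. r \<in> R \<Longrightarrow> r \<otimes> v = v \<otimes> r"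
proof -
  have Rc: "r \<in> carrier G" if "r \<in> R" for r using that R(1) subgroup.mem_carrier by metis
  have Nc: "n \<in> carrier G" if "n \<in> N" for n using that N(1) subgroup.mem_carrier by metis
  let ?F = "{x \<in> N. \<forall>r\<in>R. r \<otimes> x \<otimes> inv r = x}"
  have finN: "finite N" using N(1) fin by (rule subgroup_finite)
  have "[card N = card {x \<in> N. \<forall>r\<in>carrier (G\<lparr>carrier := R\<rparr>). r \<otimes> x \<otimes> inv r = x}] (mod p)"
  proof (rule p_group_action_fixed_points)
    show "group (G\<lparr>carrier := R\<rparr>)" using R(1) by (rule subgroup_imp_group)
    show "\<one>\<^bsub>G\<lparr>carrier := R\<rparr>\<^esub> \<otimes> x \<otimes> inv \<one>\<^bsub>G\<lparr>carrier := R\<rparr>\<^esub> = x" if "x \<in> N" for x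
      using Nc[OF that] by simp
    show "g \<otimes>\<^bsub>G\<lparr>carrier := R\<rparr>\<^esub> h \<otimes> x \<otimes> inv (g \<otimes>\<^bsub>G\<lparr>carrier := R\<rparr>\<^esub> h)
        = g \<otimes> (h \<otimes> x \<otimes> inv h) \<otimes> inv g"
      if "g \<in> carrier (G\<lparr>carrier := R\<rparr>)" "h \<in> carrier (G\<lparr>carrier := R\<rparr>)" "x \<in> N" for g h x
      using that Rc Nc[OF that(3)] by (simp add: inv_mult_group m_assoc)
  qed (use R norm finN in auto)
  then have "p dvd card ?F" using N(2) by (simp add: cong_dvd_iff)
  moreover have one: "\<one> \<in> ?F" using N(1) Rc by (simp add: subgroup.one_closed)
  ultimately have "?F \<noteq> {\<one>}"
    using R(3) by (metis One_nat_def card.empty card.insert empty_iff finite.emptyI not_prime_unit)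
  then obtain v where v: "v \<in> N" "v \<noteq> \<one>" "\<And>r. r \<in> R \<Longrightarrow> r \<otimes> v \<otimes> inv r = v" using one by blast
  show thesis
  proof (rule that[OF v(1,2)])
    fix r assume r: "r \<in> R"
    have "r \<otimes> v = (r \<otimes> v \<otimes> inv r) \<otimes> r" using Rc[OF r] Nc[OF v(1)] by (simp add: m_assoc)
    then show "r \<otimes> v = v \<otimes> r" using v(3)[OF r] by simp
  qed
qed

section \<open>Sylow subgroups\<close>

lemma (in group) sylow_subgroupI:
  assumes "subgroup P G" "card P = p ^ k" "order G = card P * m" "\<not> p dvd m" "prime p"
  shows "sylow_subgroup p P G"
proof -
  have "multiplicity p (order G) = k"
  proof (rule multiplicity_eqI)
    show "p ^ k dvd order G" unfolding assms(2,3) by simp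
    have "p ^ k \<noteq> 0" using assms(5) by auto
    then show "\<not> p ^ Suc k dvd order G"
      unfolding assms(2,3) power_Suc2 using assms(4) by (simp add: dvd_times_left_cancel_iff)
  qed
  then show ?thesis using assms(1,2) by (simp add: sylow_subgroup_def)
qed

lemma (in group) sylow_subgroupE:
  assumes "sylow_subgroup p P G" "prime p" "finite (carrier G)"
  obtains m where "subgroup P G" "card P = p ^ multiplicity p (order G)"
    "order G = card P * m" "\<not> p dvd m"
proof -
  have P: "subgroup P G" "card P = p ^ multiplicity p (order G)"
    using assms(1) by (auto simp: sylow_subgroup_def)
  have "order G \<noteq> 0" using assms(3) order_gt_0_iff_finite by simp
  moreover have "\<not> is_unit p" using assms(2) not_prime_unit by blast
  ultimately obtain m where "order G = p ^ multiplicity p (order G) * m" "\<not> p dvd m"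
    by (rule multiplicity_decompose')
  show thesis
  proof (rule that[OF P])
    show "order G = card P * m" unfolding P(2) by fact
  qed fact
qed

lemma (in group) sylow_exists:
  assumes "prime p" "finite (carrier G)"
  obtains P where "sylow_subgroup p P G"
proof -
  obtain m where "order G = p ^ multiplicity p (order G) * m"
    using multiplicity_dvd[of p "order G"] by (auto elim: dvdE)
  then obtain P where "subgroup P G" "card P = p ^ multiplicity p (order G)"
    using sylow_thm[OF assms(1) is_group _ assms(2)] by blast
  then show thesis by (intro that) (simp add: sylow_subgroup_def)
qed

lemma (in group) sylow_in_subgroup:
  assumes P: "sylow_subgroup p P G" "prime p" "finite (carrier G)" and B: "subgroup B G" "P \<subseteq> B"
  shows "sylow_subgroup p P (G\<lparr>carrier := B\<rparr>)"
proof -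
  obtain m where m: "subgroup P G" "card P = p ^ multiplicity p (order G)"
    "order G = card P * m" "\<not> p dvd m" using P by (rule sylow_subgroupE)
  have "card P dvd card B" using m(1) B P(3) by (intro card_subgroup_dvd)
  then obtain d where d: "card B = card P * d" by (elim dvdE)
  have "card B dvd order G" using B(1) by (rule subgroup_card_dvd_order)
  then have "d dvd m" using d m(3) subgroup_card_pos[OF m(1) P(3)] by simp
  then have "\<not> p dvd d" using m(4) dvd_trans by blast
  then show ?thesis
    using m B d P(2) subgroup_imp_group[OF B(1)]
    by (intro group.sylow_subgroupI) (auto simp: subgroup_update_iff)
qed

lemma (in group) sylow_of_index:
  assumes B: "subgroup B G" and P: "sylow_subgroup p P (G\<lparr>carrier := B\<rparr>)" "prime p"
    and fin: "finite (carrier G)" and idx: "order G = card B * j" "\<not> p dvd j"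
  shows "sylow_subgroup p P G"
proof -
  interpret B: group "G\<lparr>carrier := B\<rparr>" using B by (rule subgroup_imp_group)
  have fB: "finite (carrier (G\<lparr>carrier := B\<rparr>))" using subgroup_finite[OF B fin] by simp
  obtain m where m: "subgroup P (G\<lparr>carrier := B\<rparr>)" "card P = p ^ multiplicity p (order (G\<lparr>carrier := B\<rparr>))"
    "order (G\<lparr>carrier := B\<rparr>) = card P * m" "\<not> p dvd m" using P fB by (rule B.sylow_subgroupE)
  have "order G = card P * (m * j)" using m(3) idx(1) by simp
  moreover have "\<not> p dvd m * j" using m(4) idx(2) P(2) by (simp add: prime_dvd_mult_iff)
  moreover have "subgroup P G" using m(1) B by (simp add: subgroup_update_iff)
  ultimately show ?thesis using m(2) P(2) by (intro sylow_subgroupI)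
qed

lemma (in group) p_subgroup_in_normal_sylow:
  assumes P: "sylow_subgroup p P G" "prime p" "finite (carrier G)" "P \<lhd> G"
    and R: "subgroup R G" "card R = p ^ k"
  shows "R \<subseteq> P"
proof
  fix r assume r: "r \<in> R"
  obtain m where m: "subgroup P G" "card P = p ^ multiplicity p (order G)"
    "order G = card P * m" "\<not> p dvd m" using P(1-3) by (rule sylow_subgroupE)
  obtain g where g: "g \<in> carrier G" "\<And>r. r \<in> R \<Longrightarrow> g \<otimes> r \<otimes> inv g \<in> P"
    by (rule p_subgroup_conj_into[OF R P(2) m(1,3,4) P(3)]) blast
  have rc: "r \<in> carrier G" using r R(1) subgroup.mem_carrier by metis
  have "inv g \<otimes> (g \<otimes> r \<otimes> inv g) \<otimes> g \<in> P" using P(4) g r by (intro normal.inv_op_closed1) auto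
  moreover have "inv g \<otimes> (g \<otimes> r \<otimes> inv g) \<otimes> g = r"
    using g rc by (simp add: m_assoc inv_mult_cancel)
  ultimately show "r \<in> P" by simp
qed

lemma (in group) conj_epi:
  assumes "g \<in> carrier G" "finite (carrier G)"
  shows "finite_epi G G (\<lambda>x. g \<otimes> x \<otimes> inv g)" and "inj_on (\<lambda>x. g \<otimes> x \<otimes> inv g) (carrier G)"
proof -
  show inj: "inj_on (\<lambda>x. g \<otimes> x \<otimes> inv g) (carrier G)"
    using assms(1) by (auto intro!: inj_onI)
  show "finite_epi G G (\<lambda>x. g \<otimes> x \<otimes> inv g)"
  proof (rule finite_epiI)
    show "(\<lambda>x. g \<otimes> x \<otimes> inv g) \<in> hom G G"
    proof (rule homI)
      fix x y assume "x \<in> carrier G" "y \<in> carrier G"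
      then show "g \<otimes> (x \<otimes> y) \<otimes> inv g = g \<otimes> x \<otimes> inv g \<otimes> (g \<otimes> y \<otimes> inv g)"
        using assms(1) by (simp add: m_assoc inv_mult_cancel)
    qed (use assms in auto)
    have "(\<lambda>x. g \<otimes> x \<otimes> inv g) ` carrier G \<subseteq> carrier G" using assms(1) by auto
    then show "(\<lambda>x. g \<otimes> x \<otimes> inv g) ` carrier G = carrier G"
      using inj assms(2) by (simp add: card_image card_subset_eq)
  qed (use assms in auto)
qed

context finite_epi
begin

lemma sylow_image:
  assumes P: "sylow_subgroup p P G" "prime p"
  shows "sylow_subgroup p (h ` P) H"
proof -
  obtain m where m: "subgroup P G" "card P = p ^ multiplicity p (order G)"
    "order G = card P * m" "\<not> p dvd m" using P finG by (rule G.sylow_subgroupE)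
  have im: "subgroup (h ` P) H" using m(1) by (rule image_subgroup)
  have cP: "card P = card (ker \<inter> P) * card (h ` P)" using m(1) finG by (rule card_hom_image)
  then have "card (h ` P) dvd p ^ multiplicity p (order G)" unfolding m(2) by simp
  then obtain i where i: "card (h ` P) = p ^ i" using P(2) by (metis divides_primepow_nat)
  obtain c where c: "order H = card (h ` P) * c"
    using H.subgroup_card_dvd_order[OF im] by (elim dvdE)
  have kerP: "subgroup (ker \<inter> P) G"
    using subgroup_kernel m(1) by (rule G.subgroups_Inter_pair)
  have "card (ker \<inter> P) dvd card ker"
    using kerP subgroup_kernel finG by (intro G.card_subgroup_dvd) auto
  then obtain d where d: "card ker = card (ker \<inter> P) * d" by (elim dvdE)
  have "card P * (d * c) = card ker * order H" unfolding cP d c by (simp only: ac_simps)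
  also have "\<dots> = card P * m" using order_epi m(3) by simp
  finally have "card P * (d * c) = card P * m" .
  then have "d * c = m" using G.subgroup_card_pos[OF m(1) finG] by (metis mult_left_cancel less_not_refl2)
  then have "\<not> p dvd c" using m(4) by auto
  then show ?thesis using im i c P(2) by (intro H.sylow_subgroupI)
qed

text \<open>
  A Sylow subgroup of the preimage of \<open>Q\<close> has index prime to \<open>p\<close> in \<open>G\<close>, and its image
  is a Sylow subgroup contained in \<open>Q\<close>.
\<close>

lemma sylow_lift:
  assumes Q: "sylow_subgroup p Q H" "prime p"
  obtains P where "sylow_subgroup p P G" "h ` P = Q"
proof -
  obtain m where m: "subgroup Q H" "card Q = p ^ multiplicity p (order H)"
    "order H = card Q * m" "\<not> p dvd m" using Q finH by (rule H.sylow_subgroupE)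
  have B: "subgroup (preim Q) G" using m(1) by (rule preim_subgroup)
  interpret B: group "G\<lparr>carrier := preim Q\<rparr>" using B by (rule G.subgroup_imp_group)
  have "finite (carrier (G\<lparr>carrier := preim Q\<rparr>))" using G.subgroup_finite[OF B finG] by simp
  then obtain P where P: "sylow_subgroup p P (G\<lparr>carrier := preim Q\<rparr>)"
    using Q(2) by (elim B.sylow_exists[rotated])
  have "order G = card (preim Q) * m" using order_epi m(3) card_preim[OF m(1)] by simp
  then have PG: "sylow_subgroup p P G" using B P Q(2) finG m(4) by (intro G.sylow_of_index)
  then have "sylow_subgroup p (h ` P) H" using Q(2) by (rule sylow_image)
  then have "card (h ` P) = card Q" using m(2) by (simp add: sylow_subgroup_def)
  moreover have "P \<subseteq> preim Q" using P subgroup.subset unfolding sylow_subgroup_def by fastforce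
  then have "h ` P \<subseteq> Q" by blast
  moreover have "finite Q" using m(1) finH by (rule H.subgroup_finite)
  ultimately have "h ` P = Q" by (simp add: card_subset_eq)
  with PG show thesis by (rule that)
qed

end

text \<open>
  Any Sylow subgroup of \<open>G\<close> above \<open>Q\<close> meets \<open>U\<close> in a \<open>p\<close>-subgroup of \<open>U\<close> above \<open>Q\<close>,
  which cannot exceed \<open>Q\<close>.
\<close>

lemma (in group) sylow_of_subgroup:
  assumes U: "subgroup U G" and Q: "sylow_subgroup p Q (G\<lparr>carrier := U\<rparr>)" "prime p"
    and fin: "finite (carrier G)"
  obtains P where "sylow_subgroup p P G" "P \<inter> U = Q"
proof -
  interpret U: group "G\<lparr>carrier := U\<rparr>" using U by (rule subgroup_imp_group)
  have fU: "finite (carrier (G\<lparr>carrier := U\<rparr>))" using subgroup_finite[OF U fin] by simp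
  obtain m where m: "subgroup Q (G\<lparr>carrier := U\<rparr>)" "card Q = p ^ multiplicity p (order (G\<lparr>carrier := U\<rparr>))"
    "order (G\<lparr>carrier := U\<rparr>) = card Q * m" "\<not> p dvd m" using Q fU by (rule U.sylow_subgroupE)
  have QU: "subgroup Q G" "Q \<subseteq> U" using m(1) U by (simp_all add: subgroup_update_iff)
  obtain P0 where P0: "sylow_subgroup p P0 G" using Q(2) fin by (rule sylow_exists)
  obtain m0 where m0: "subgroup P0 G" "card P0 = p ^ multiplicity p (order G)"
    "order G = card P0 * m0" "\<not> p dvd m0" using P0 Q(2) fin by (rule sylow_subgroupE)
  obtain g where g: "g \<in> carrier G" "\<And>r. r \<in> Q \<Longrightarrow> g \<otimes> r \<otimes> inv g \<in> P0"
    by (rule p_subgroup_conj_into[OF QU(1) m(2) Q(2) m0(1,3,4) fin]) blast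
  define P where "P = (\<lambda>x. inv g \<otimes> x \<otimes> inv (inv g)) ` P0"
  have P: "sylow_subgroup p P G"
    unfolding P_def using P0 Q(2) conj_epi(1)[OF _ fin, of "inv g"] g(1)
    by (intro finite_epi.sylow_image) auto
  have QP: "Q \<subseteq> P"
  proof
    fix r assume r: "r \<in> Q"
    have rc: "r \<in> carrier G" using r QU(1) subgroup.mem_carrier by metis
    have "inv g \<otimes> (g \<otimes> r \<otimes> inv g) \<otimes> inv (inv g) = r"
      using g rc by (simp add: m_assoc inv_mult_cancel)
    then show "r \<in> P" unfolding P_def using g(2)[OF r] by (metis imageI)
  qed
  have sP: "subgroup P G" using P by (simp add: sylow_subgroup_def)
  have sPU: "subgroup (P \<inter> U) G" using sP U by (rule subgroups_Inter_pair)
  have "card (P \<inter> U) dvd card P" using sPU sP fin by (intro card_subgroup_dvd) auto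
  then obtain i where i: "card (P \<inter> U) = p ^ i"
    using P Q(2) unfolding sylow_subgroup_def by (metis divides_primepow_nat)
  have "card (P \<inter> U) dvd card Q * m"
    using card_subgroup_dvd[OF sPU U _ fin] m(3) by simp
  moreover have "coprime (card (P \<inter> U)) m"
    unfolding i using m(4) Q(2) by (simp add: prime_imp_coprime)
  ultimately have "card (P \<inter> U) dvd card Q" by (simp add: coprime_dvd_mult_left_iff)
  then have "card (P \<inter> U) \<le> card Q"
    using subgroup_card_pos[OF QU(1) fin] by (rule dvd_imp_le)
  moreover have "Q \<subseteq> P \<inter> U" using QP QU(2) by blast
  moreover have "finite (P \<inter> U)" using sPU fin by (rule subgroup_finite)
  ultimately have "P \<inter> U = Q" by (metis card_seteq)
  with P show thesis by (rule that)
qed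

text \<open>
  The conjugate of \<open>S\<close> by \<open>g\<close> is another Sylow subgroup of \<open>N\<close>, so an element of \<open>N\<close>
  moves it back into \<open>S\<close>.
\<close>

lemma (in group) frattini_argument:
  assumes N: "N \<lhd> G" and S: "sylow_subgroup p S (G\<lparr>carrier := N\<rparr>)" "prime p"
    and fin: "finite (carrier G)" and g: "g \<in> carrier G"
  obtains n x where "n \<in> N" "x \<in> carrier G" "g = n \<otimes> x" "\<And>s. s \<in> S \<Longrightarrow> x \<otimes> s \<otimes> inv x \<in> S"
proof -
  have sN: "subgroup N G" using N by (rule normal_imp_subgroup)
  interpret N: group "G\<lparr>carrier := N\<rparr>" using sN by (rule subgroup_imp_group)
  have fN: "finite (carrier (G\<lparr>carrier := N\<rparr>))" using subgroup_finite[OF sN fin] by simp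
  obtain m where m: "subgroup S (G\<lparr>carrier := N\<rparr>)" "card S = p ^ multiplicity p (order (G\<lparr>carrier := N\<rparr>))"
    "order (G\<lparr>carrier := N\<rparr>) = card S * m" "\<not> p dvd m" using S fN by (rule N.sylow_subgroupE)
  have SN: "subgroup S G" "S \<subseteq> N" using m(1) sN by (simp_all add: subgroup_update_iff)
  have Sc: "s \<in> carrier G" if "s \<in> S" for s using that SN(1) subgroup.mem_carrier by metis
  define R where "R = (\<lambda>x. g \<otimes> x \<otimes> inv g) ` S"
  interpret c: finite_epi G G "\<lambda>x. g \<otimes> x \<otimes> inv g" using g fin by (rule conj_epi)
  have "subgroup R G" unfolding R_def using SN(1) by (rule c.image_subgroup)
  moreover have "R \<subseteq> N"
    unfolding R_def using SN(2) normal.inv_op_closed2[OF N g] by blast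
  ultimately have R: "subgroup R (G\<lparr>carrier := N\<rparr>)" using sN by (simp add: subgroup_update_iff)
  have "card R = card S" unfolding R_def
    using conj_epi(2)[OF g fin] SN(1) subgroup.subset by (metis card_image inj_on_subset)
  then have cR: "card R = p ^ multiplicity p (order (G\<lparr>carrier := N\<rparr>))" using m(2) by simp
  obtain n where n: "n \<in> N" "\<And>r. r \<in> R \<Longrightarrow> n \<otimes> r \<otimes> inv n \<in> S"
    by (rule N.p_subgroup_conj_into[OF R cR S(2) m(1,3,4) fN]) (use sN in auto)
  have nc: "n \<in> carrier G" using n(1) sN subgroup.mem_carrier by metis
  show thesis
  proof (rule that)
    show "inv n \<in> N" using n(1) sN by (simp add: subgroup.m_inv_closed)
    show "n \<otimes> g \<in> carrier G" using nc g by simp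
    show "g = inv n \<otimes> (n \<otimes> g)" using nc g by (simp add: m_assoc[symmetric])
    fix s assume s: "s \<in> S"
    then have "n \<otimes> (g \<otimes> s \<otimes> inv g) \<otimes> inv n \<in> S" by (intro n(2)) (simp add: R_def)
    moreover have "n \<otimes> (g \<otimes> s \<otimes> inv g) \<otimes> inv n = n \<otimes> g \<otimes> s \<otimes> inv (n \<otimes> g)"
      using nc g Sc[OF s] by (simp add: m_assoc inv_mult_group)
    ultimately show "n \<otimes> g \<otimes> s \<otimes> inv (n \<otimes> g) \<in> S" by simp
  qed
qed

section \<open>Chains of admissible steps\<close>

definition power_free :: "nat \<Rightarrow> nat \<Rightarrow> bool" where
  "power_free t n \<longleftrightarrow> \<not> (\<exists>q. prime q \<and> q ^ (t + 1) dvd n)"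

text \<open>
  One admissible step between subgroups of \<open>G\<close>, with the index expressed by
  cardinalities. Apart from the requirement that both sets be subgroups, the carrier of
  \<open>G\<close> does not enter: a chain inside a subgroup is the same as a chain of \<open>G\<close> that ends
  there, and chains can be composed as members of a reflexive transitive closure.
\<close>

definition KP_link :: "nat \<Rightarrow> ('a, 'b) monoid_scheme \<Rightarrow> 'a set \<Rightarrow> 'a set \<Rightarrow> bool" where
  "KP_link t G A B \<longleftrightarrow> subgroup A G \<and> subgroup B G \<and> A \<subseteq> B \<and>
     ((\<forall>b\<in>B. \<forall>a\<in>A. b \<otimes>\<^bsub>G\<^esub> a \<otimes>\<^bsub>G\<^esub> inv\<^bsub>G\<^esub> b \<in> A) \<or>
      (\<exists>p. prime p \<and> card B = p * card A \<and> power_free t (p - 1)))"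

abbreviation KP_chain :: "nat \<Rightarrow> ('a, 'b) monoid_scheme \<Rightarrow> 'a set \<Rightarrow> 'a set \<Rightarrow> bool" where
  "KP_chain t G \<equiv> (KP_link t G)\<^sup>*\<^sup>*"

lemma (in group) KP_link_normalI:
  assumes "subgroup A G" "subgroup B G" "A \<subseteq> B"
    "\<And>a b. a \<in> A \<Longrightarrow> b \<in> B \<Longrightarrow> b \<otimes> a \<otimes> inv b \<in> A"
  shows "KP_link t G A B"
  using assms by (simp add: KP_link_def)

lemma (in group) KP_link_indexI:
  assumes "subgroup A G" "subgroup B G" "A \<subseteq> B" "prime p" "card B = p * card A" "power_free t (p - 1)"
  shows "KP_link t G A B"
  using assms unfolding KP_link_def by blast

lemma KP_link_cases:
  assumes "KP_link t G A B"
  obtains (normal) "subgroup A G" "subgroup B G" "A \<subseteq> B"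
    "\<And>a b. a \<in> A \<Longrightarrow> b \<in> B \<Longrightarrow> b \<otimes>\<^bsub>G\<^esub> a \<otimes>\<^bsub>G\<^esub> inv\<^bsub>G\<^esub> b \<in> A"
  | (index) p where "subgroup A G" "subgroup B G" "A \<subseteq> B" "prime p" "card B = p * card A"
    "power_free t (p - 1)"
  using assms unfolding KP_link_def by blast

lemma (in group) normal_update_iff:
  assumes "subgroup B G" "subgroup A G" "A \<subseteq> B"
  shows "A \<lhd> G\<lparr>carrier := B\<rparr> \<longleftrightarrow> (\<forall>b\<in>B. \<forall>a\<in>A. b \<otimes> a \<otimes> inv b \<in> A)"
proof -
  interpret B: group "G\<lparr>carrier := B\<rparr>" using assms(1) by (rule subgroup_imp_group)
  have "subgroup A (G\<lparr>carrier := B\<rparr>)" using assms by (simp add: subgroup_update_iff)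
  then show ?thesis
    unfolding B.normal_inv_iff using m_inv_consistent[OF assms(1)] by simp
qed

lemma (in group) KP_step_iff_link:
  assumes "finite (carrier G)" "subgroup A G" "subgroup B G" "A \<subseteq> B"
  shows "KP_step t G A B \<longleftrightarrow> KP_link t G A B"
proof -
  interpret B: group "G\<lparr>carrier := B\<rparr>" using assms(3) by (rule subgroup_imp_group)
  have "subgroup A (G\<lparr>carrier := B\<rparr>)" using assms by (simp add: subgroup_update_iff)
  then have "card (rcosets\<^bsub>G\<lparr>carrier := B\<rparr>\<^esub> A) * card A = card B" using B.lagrange by fastforce
  then have "card (rcosets\<^bsub>G\<lparr>carrier := B\<rparr>\<^esub> A) = p \<longleftrightarrow> card B = p * card A" for p
    using subgroup_card_pos[OF assms(2,1)] by auto
  then show ?thesis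
    using assms by (auto simp: KP_step_def KP_link_def normal_update_iff power_free_def)
qed

lemma KP_chain_subgroup:
  assumes "KP_chain t G A B" "subgroup A G" shows "subgroup B G" "A \<subseteq> B"
proof -
  have "subgroup B G \<and> A \<subseteq> B" using assms by (induction) (auto simp: KP_link_def)
  then show "subgroup B G" "A \<subseteq> B" by auto
qed

lemma (in group) KP_subnormal_iff_KP_chain:
  assumes fin: "finite (carrier G)"
  shows "KP_subnormal t A G \<longleftrightarrow> subgroup A G \<and> KP_chain t G A (carrier G)"
proof
  assume "KP_subnormal t A G"
  then obtain n :: nat and C where nC: "C 0 = A \<and> C n = carrier G \<and> (\<forall>i\<le>n. subgroup (C i) G) \<and>
      (\<forall>i\<in>{1..n}. C (i - 1) \<subseteq> C i \<and> KP_step t G (C (i - 1)) (C i))"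
    unfolding KP_subnormal_def by (elim exE)
  have Csub: "subgroup (C i) G" if "i \<le> n" for i using nC that by simp
  have C4: "C (i - 1) \<subseteq> C i \<and> KP_step t G (C (i - 1)) (C i)" if "i \<in> {1..n}" for i
    using nC that by simp
  have "KP_chain t G A (C i)" if "i \<le> n" for i
    using that
  proof (induction i)
    case (Suc i)
    have "C i \<subseteq> C (Suc i) \<and> KP_step t G (C i) (C (Suc i))" using C4[of "Suc i"] Suc.prems by simp
    then have "KP_link t G (C i) (C (Suc i))"
      using KP_step_iff_link[OF fin Csub[of i] Csub[of "Suc i"]] Suc.prems by simp
    then show ?case using Suc by simp
  qed (use nC in simp)
  then show "subgroup A G \<and> KP_chain t G A (carrier G)" using nC by force
next
  assume "subgroup A G \<and> KP_chain t G A (carrier G)"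
  then obtain n f where f: "subgroup A G" "f 0 = A" "f n = carrier G" "\<And>i. i < n \<Longrightarrow> KP_link t G (f i) (f (Suc i))"
    by (auto simp: rtranclp_power relpowp_fun_conv)
  have sub: "subgroup (f i) G" if "i \<le> n" for i
    using that f(1,2) f(4)[of "i - 1"] by (cases i) (auto simp: KP_link_def)
  have "f (i - 1) \<subseteq> f i \<and> KP_step t G (f (i - 1)) (f i)" if "i \<in> {1..n}" for i
  proof -
    have "i - 1 < n" "Suc (i - 1) = i" using that by auto
    then have st: "KP_link t G (f (i - 1)) (f i)" using f(4)[of "i - 1"] by simp
    then have "f (i - 1) \<subseteq> f i" by (simp add: KP_link_def)
    then show ?thesis using st KP_step_iff_link[OF fin, of "f (i - 1)" "f i"] by (simp add: KP_link_def)
  qed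
  then show "KP_subnormal t A G"
    unfolding KP_subnormal_def using f sub by (intro exI[of _ n] exI[of _ f]) simp
qed

lemma sylow_KP_group_iff:
  "sylow_KP_group t G \<longleftrightarrow> group G \<and> finite (carrier G) \<and>
     (\<forall>p P. prime p \<longrightarrow> sylow_subgroup p P G \<longrightarrow> KP_chain t G P (carrier G))"
  unfolding sylow_KP_group_def using group.KP_subnormal_iff_KP_chain[of G t]
  by (auto simp: sylow_subgroup_def)

lemma (in group) KP_link_update_iff:
  assumes U: "subgroup U G" and B: "B \<subseteq> U"
  shows "KP_link t (G\<lparr>carrier := U\<rparr>) A B \<longleftrightarrow> KP_link t G A B"
proof -
  have "inv\<^bsub>G\<lparr>carrier := U\<rparr>\<^esub> b = inv b" if "b \<in> B" for b
    using that B m_inv_consistent[OF U] by blast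
  then show ?thesis using B U by (auto simp: KP_link_def subgroup_update_iff)
qed

lemma (in group) KP_chain_update_iff:
  assumes U: "subgroup U G" and A: "subgroup A G" and B: "B \<subseteq> U"
  shows "KP_chain t (G\<lparr>carrier := U\<rparr>) A B \<longleftrightarrow> KP_chain t G A B"
proof
  assume "KP_chain t G A B"
  then show "KP_chain t (G\<lparr>carrier := U\<rparr>) A B" using B
  proof (induction rule: rtranclp_induct)
    case (step B C)
    then have "B \<subseteq> C" by (simp add: KP_link_def)
    then show ?case using step KP_link_update_iff[OF U, of C] by (meson order_trans rtranclp.rtrancl_into_rtrancl)
  qed simp
next
  assume "KP_chain t (G\<lparr>carrier := U\<rparr>) A B"
  then show "KP_chain t G A B" using B
  proof (induction rule: rtranclp_induct)
    case (step B C)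
    then have "B \<subseteq> C" by (simp add: KP_link_def)
    then show ?case using step KP_link_update_iff[OF U, of C] by (meson order_trans rtranclp.rtrancl_into_rtrancl)
  qed simp
qed

context finite_epi
begin

text \<open>
  The index of the image of \<open>A\<close> in the image of \<open>B\<close> divides the index of \<open>A\<close> in \<open>B\<close>. If
  the latter is prime, the images either coincide, which is a normal step, or keep their
  index.
\<close>

lemma KP_link_image:
  assumes "KP_link t G A B" shows "KP_link t H (h ` A) (h ` B)"
  using assms
proof (cases rule: KP_link_cases)
  case normal
  show ?thesis
  proof (rule H.KP_link_normalI)
    show "subgroup (h ` A) H" "subgroup (h ` B) H" using normal by (simp_all add: image_subgroup)
    show "h ` A \<subseteq> h ` B" using normal by blast
    fix x y assume "x \<in> h ` A" "y \<in> h ` B"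
    then obtain a b where ab: "a \<in> A" "b \<in> B" "x = h a" "y = h b" by blast
    have "a \<in> carrier G" "b \<in> carrier G" using ab normal(1,2) subgroup.mem_carrier by metis+
    then have "y \<otimes>\<^bsub>H\<^esub> x \<otimes>\<^bsub>H\<^esub> inv\<^bsub>H\<^esub> y = h (b \<otimes> a \<otimes> inv b)" using ab by simp
    then show "y \<otimes>\<^bsub>H\<^esub> x \<otimes>\<^bsub>H\<^esub> inv\<^bsub>H\<^esub> y \<in> h ` A" using normal(4)[OF ab(1,2)] by simp
  qed
next
  case (index p)
  have sub: "subgroup (h ` A) H" "subgroup (h ` B) H" using index by (simp_all add: image_subgroup)
  have incl: "h ` A \<subseteq> h ` B" using index by blast
  have kA: "subgroup (ker \<inter> A) G" using subgroup_kernel index(1) by (rule G.subgroups_Inter_pair)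
  have kB: "subgroup (ker \<inter> B) G" using subgroup_kernel index(2) by (rule G.subgroups_Inter_pair)
  have "card (ker \<inter> A) dvd card (ker \<inter> B)" using kA kB index(3) finG by (intro G.card_subgroup_dvd) auto
  then obtain d where d: "card (ker \<inter> B) = card (ker \<inter> A) * d" by (elim dvdE)
  have "card (h ` A) dvd card (h ` B)" using sub incl finH by (intro H.card_subgroup_dvd)
  then obtain c where c: "card (h ` B) = card (h ` A) * c" by (elim dvdE)
  have "card A * (d * c) = card B"
    using card_hom_image[OF index(1) finG] card_hom_image[OF index(2) finG] c d by simp
  also have "\<dots> = card A * p" using index(5) by simp
  finally have "d * c = p" using G.subgroup_card_pos[OF index(1) finG] by (metis mult_left_cancel less_not_refl2)
  then have "c = 1 \<or> c = p" using index(4) by (metis dvd_triv_right prime_nat_iff)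
  then show ?thesis
  proof
    assume "c = 1"
    then have "h ` A = h ` B" using c incl H.subgroup_finite[OF sub(2) finH] by (simp add: card_subset_eq)
    then show ?thesis using sub
      by (intro H.KP_link_normalI) (auto simp: subgroup.m_closed subgroup.m_inv_closed)
  next
    assume "c = p"
    then show ?thesis using sub incl index c by (intro H.KP_link_indexI[of _ _ p]) auto
  qed
qed

lemma KP_link_preim:
  assumes "KP_link t H A B" shows "KP_link t G (preim A) (preim B)"
  using assms
proof (cases rule: KP_link_cases)
  case normal
  show ?thesis
  proof (rule G.KP_link_normalI)
    show "subgroup (preim A) G" "subgroup (preim B) G" using normal by (simp_all add: preim_subgroup)
    show "preim A \<subseteq> preim B" using normal by blast
    fix a b assume "a \<in> preim A" "b \<in> preim B"
    then show "b \<otimes> a \<otimes> inv b \<in> preim A" using normal(4)[of "h a" "h b"] by simp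
  qed
next
  case (index p)
  show ?thesis
  proof (rule G.KP_link_indexI)
    show "subgroup (preim A) G" "subgroup (preim B) G" using index by (simp_all add: preim_subgroup)
    show "preim A \<subseteq> preim B" using index by blast
    show "card (preim B) = p * card (preim A)" using index by (simp add: card_preim)
  qed (use index in auto)
qed

lemma KP_chain_image:
  assumes "KP_chain t G A B" shows "KP_chain t H (h ` A) (h ` B)"
  using assms by (induction rule: rtranclp_induct) (auto intro: KP_link_image rtranclp.rtrancl_into_rtrancl)

lemma KP_chain_preim:
  assumes "KP_chain t H A B" shows "KP_chain t G (preim A) (preim B)"
  using assms by (induction rule: rtranclp_induct) (auto intro: KP_link_preim rtranclp.rtrancl_into_rtrancl)

lemma KP_chain_preim_carrier:
  assumes "KP_chain t H A (carrier H)" shows "KP_chain t G (preim A) (carrier G)"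
proof -
  have "preim (carrier H) = carrier G" using hom_closed by blast
  then show ?thesis using KP_chain_preim[OF assms] by simp
qed

lemma sylow_KP_image:
  assumes "sylow_KP_group t G" shows "sylow_KP_group t H"
  unfolding sylow_KP_group_iff
proof (intro conjI allI impI)
  show "group H" "finite (carrier H)" by (auto simp: finH)
  fix p Q assume p: "prime p" and Q: "sylow_subgroup p Q H"
  obtain P where P: "sylow_subgroup p P G" "h ` P = Q" using Q p by (rule sylow_lift)
  have "KP_chain t G P (carrier G)" using assms p P(1) unfolding sylow_KP_group_iff by blast
  then show "KP_chain t H Q (carrier H)" using KP_chain_image P(2) surj by metis
qed

lemma sylow_KP_injective:
  assumes "sylow_KP_group t H" "ker = {\<one>}" shows "sylow_KP_group t G"
proof -
  obtain g where "finite_epi H G g" using finite_epi_axioms assms(2) by (rule finite_epi_inverse)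
  then show ?thesis using assms(1) finite_epi.sylow_KP_image by blast
qed

lemma KP_chain_preim_image_sylow:
  assumes "sylow_KP_group t H" "prime p" "sylow_subgroup p P G"
  shows "KP_chain t G (preim (h ` P)) (carrier G)"
  using assms sylow_image[OF assms(3,2)] KP_chain_preim_carrier unfolding sylow_KP_group_iff by blast

end

lemma sylow_KP_factor:
  assumes "finite_epi G H f" "finite_epi G K g" "kernel G H f \<subseteq> kernel G K g" "sylow_KP_group t H"
  shows "sylow_KP_group t K"
proof -
  obtain e where "finite_epi H K e" using assms(1-3) by (rule finite_epi_factor)
  then show ?thesis using assms(4) by (rule finite_epi.sylow_KP_image)
qed

section \<open>The Sylow subgroup for the largest prime\<close>

text \<open>
  If the Sylow subgroup \<open>P\<close> is normal in one member \<open>A\<close> of the chain, it contains every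
  \<open>p\<close>-subgroup of \<open>A\<close>; so it suffices that conjugates of \<open>P\<close> under the next member \<open>B\<close>
  still lie in \<open>A\<close>. Over a normal step this is clear. Over a step of prime index \<open>q\<close> one
  has \<open>q < p\<close>, and then \<open>P\<close> fixes all \<open>q\<close> cosets of \<open>A\<close> in \<open>B\<close>.
\<close>

lemma (in group) KP_chain_sylow_normalised:
  assumes P: "sylow_subgroup p P G" "prime p" and fin: "finite (carrier G)"
    and large: "\<And>q. prime q \<Longrightarrow> q dvd order G \<Longrightarrow> q \<le> p"
    and chain: "KP_chain t G P B"
  shows "\<forall>b\<in>B. \<forall>x\<in>P. b \<otimes> x \<otimes> inv b \<in> P"
  using chain
proof (induction rule: rtranclp_induct)
  case base
  then show ?case using P(1) unfolding sylow_subgroup_def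
    by (auto simp: subgroup.m_closed subgroup.m_inv_closed)
next
  case (step A B)
  obtain m where m: "subgroup P G" "card P = p ^ multiplicity p (order G)"
    "order G = card P * m" "\<not> p dvd m" using P fin by (rule sylow_subgroupE)
  have PA: "subgroup A G" "P \<subseteq> A" using KP_chain_subgroup[OF step.hyps(1) m(1)] by auto
  interpret A: group "G\<lparr>carrier := A\<rparr>" using PA(1) by (rule subgroup_imp_group)
  have fA: "finite (carrier (G\<lparr>carrier := A\<rparr>))" using subgroup_finite[OF PA(1) fin] by simp
  have SA: "sylow_subgroup p P (G\<lparr>carrier := A\<rparr>)" using P fin PA by (intro sylow_in_subgroup)
  have NA: "P \<lhd> G\<lparr>carrier := A\<rparr>" using step.IH PA m(1) by (simp add: normal_update_iff)
  have Pc: "P \<subseteq> carrier G" using m(1) by (rule subgroup.subset)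
  have in_A: "\<forall>b\<in>B. \<forall>x\<in>P. b \<otimes> x \<otimes> inv b \<in> A"
    using step.hyps(2)
  proof (cases rule: KP_link_cases)
    case normal
    then show ?thesis using PA(2) by blast
  next
    case (index q)
    interpret B: group "G\<lparr>carrier := B\<rparr>" using index(2) by (rule subgroup_imp_group)
    have fB: "finite (carrier (G\<lparr>carrier := B\<rparr>))" using subgroup_finite[OF index(2) fin] by simp
    have Bd: "card B dvd order G" using index(2) by (rule subgroup_card_dvd_order)
    then have "q dvd order G" using index(5) dvd_trans dvd_triv_left by metis
    then have "q \<le> p" using large index(4) by blast
    moreover have "q \<noteq> p"
    proof
      assume "q = p"
      have "card P dvd card A" using m(1) PA fin by (intro card_subgroup_dvd)
      then have "card P * p dvd card P * m"
        using Bd index(5) m(3) \<open>q = p\<close> by (metis dvd_trans mult.commute mult_dvd_mono dvd_refl)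
      then show False using m(4) subgroup_card_pos[OF m(1) fin] by simp
    qed
    ultimately have "q < p" by simp
    have sB: "subgroup P (G\<lparr>carrier := B\<rparr>)" "subgroup A (G\<lparr>carrier := B\<rparr>)"
      using m(1) PA index by (auto simp: subgroup_update_iff)
    have ord: "order (G\<lparr>carrier := B\<rparr>) = q * card A" using index(5) by simp
    show ?thesis
      using B.p_subgroup_small_index[OF sB(1) m(2) P(2) sB(2) ord \<open>q < p\<close> fB] m_inv_consistent[OF index(2)]
      by simp
  qed
  show ?case
  proof (intro ballI)
    fix b x assume b: "b \<in> B" and x: "x \<in> P"
    have bc: "b \<in> carrier G" using b step.hyps(2) unfolding KP_link_def by (meson subgroup.mem_carrier)
    define R where "R = (\<lambda>x. b \<otimes> x \<otimes> inv b) ` P"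
    have "subgroup R G" unfolding R_def
      using finite_epi.image_subgroup[OF conj_epi(1)[OF bc fin] m(1)] .
    moreover have "R \<subseteq> A" unfolding R_def using in_A b by blast
    ultimately have "subgroup R (G\<lparr>carrier := A\<rparr>)" using PA(1) by (simp add: subgroup_update_iff)
    moreover have "card R = p ^ multiplicity p (order G)" unfolding R_def m(2)[symmetric]
      using inj_on_subset[OF conj_epi(2)[OF bc fin] Pc] by (rule card_image)
    ultimately have "R \<subseteq> P" using A.p_subgroup_in_normal_sylow[OF SA P(2) fA NA] by blast
    then show "b \<otimes> x \<otimes> inv b \<in> P" using x by (auto simp: R_def)
  qed
qed

lemma (in group) largest_sylow_normal:
  assumes "sylow_KP_group t G" "sylow_subgroup p P G" "prime p"
    and "\<And>q. prime q \<Longrightarrow> q dvd order G \<Longrightarrow> q \<le> p"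
  shows "P \<lhd> G"
proof (rule normal_invI)
  have fin: "finite (carrier G)" and chain: "KP_chain t G P (carrier G)"
    using assms unfolding sylow_KP_group_iff by blast+
  show "subgroup P G" using assms(2) by (simp add: sylow_subgroup_def)
  show "x \<otimes> n \<otimes> inv x \<in> P" if "x \<in> carrier G" "n \<in> P" for x n
    using KP_chain_sylow_normalised[OF assms(2,3) fin assms(4) chain] that by blast
qed

section \<open>Solubility\<close>

lemma (in group) trivial_solvable:
  assumes "carrier G = {\<one>}" shows "solvable G"
  unfolding solvable_iff_trivial_derived_seq using assms by (intro exI[of _ 0]) simp

lemma comm_group_solvable:
  assumes "comm_group G" shows "solvable G"
proof -
  interpret comm_group G by fact
  have "(derived G ^^ 1) (carrier G) = {\<one>\<^bsub>G\<^esub>}" using derived_eq_singleton[of "carrier G"] by simp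
  then show ?thesis unfolding solvable_iff_trivial_derived_seq by blast
qed

lemma (in group) solvable_restrict:
  assumes "solvable G" "subgroup B G" shows "solvable (G\<lparr>carrier := B\<rparr>)"
proof -
  have "group_hom (G\<lparr>carrier := B\<rparr>) G (\<lambda>x. x)"
    using canonical_inj_is_hom[OF assms(2)] by (simp add: id_def)
  then show ?thesis by (rule group_hom.inj_hom_imp_solvable[OF _ _ assms(1)]) simp
qed

lemma (in finite_epi) solvable_extension:
  assumes "solvable (G\<lparr>carrier := ker\<rparr>)" "solvable H" shows "solvable G"
proof (rule solvable_condition)
  show "group_hom (G\<lparr>carrier := ker\<rparr>) G id"
    using G.canonical_inj_is_hom[OF subgroup_kernel] .
  show "group_hom G H h" by (rule group_hom_axioms)
  show "ker \<subseteq> id ` carrier (G\<lparr>carrier := ker\<rparr>)" by simp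
qed (fact surj assms)+

text \<open>
  The subgroup provided is the centre; it is nontrivial because the group acts on itself
  by conjugation with more than one fixed point.
\<close>

lemma (in group) p_group_center:
  assumes "prime p" "card (carrier G) = p ^ k" "k \<noteq> 0"
  obtains Z where "Z \<lhd> G" "comm_group (G\<lparr>carrier := Z\<rparr>)" "card Z > 1"
proof -
  have fin: "finite (carrier G)" using assms by (metis card_ge_0_finite prime_gt_0_nat zero_less_power)
  define Z where "Z = {z \<in> carrier G. \<forall>g\<in>carrier G. g \<otimes> z = z \<otimes> g}"
  have Zc: "z \<in> carrier G" and Zg: "g \<in> carrier G \<Longrightarrow> g \<otimes> z = z \<otimes> g" if "z \<in> Z" for z g
    using that unfolding Z_def by blast+
  have ZI: "z \<in> Z" if "z \<in> carrier G" "\<And>g. g \<in> carrier G \<Longrightarrow> g \<otimes> z = z \<otimes> g" for z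
    using that unfolding Z_def by blast
  have sZ: "subgroup Z G"
  proof (rule subgroupI)
    show "Z \<subseteq> carrier G" using Zc by blast
    have "\<one> \<in> Z" by (rule ZI) simp_all
    then show "Z \<noteq> {}" by blast
    show "inv a \<in> Z" if a: "a \<in> Z" for a
    proof (rule ZI)
      show "inv a \<in> carrier G" using Zc[OF a] by simp
      fix g assume g: "g \<in> carrier G"
      have "inv a \<otimes> (a \<otimes> g) \<otimes> inv a = inv a \<otimes> (g \<otimes> a) \<otimes> inv a" using Zg[OF a g] by simp
      then show "g \<otimes> inv a = inv a \<otimes> g" using Zc[OF a] g by (simp add: m_assoc inv_mult_cancel)
    qed
    show "a \<otimes> b \<in> Z" if a: "a \<in> Z" and b: "b \<in> Z" for a b
    proof (rule ZI)
      show "a \<otimes> b \<in> carrier G" using Zc[OF a] Zc[OF b] by simp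
      fix g assume g: "g \<in> carrier G"
      have "g \<otimes> (a \<otimes> b) = (g \<otimes> a) \<otimes> b" using Zc[OF a] Zc[OF b] g by (simp add: m_assoc)
      also have "g \<otimes> a = a \<otimes> g" using Zg[OF a g] .
      also have "a \<otimes> g \<otimes> b = a \<otimes> (g \<otimes> b)" using Zc[OF a] Zc[OF b] g by (simp add: m_assoc)
      also have "g \<otimes> b = b \<otimes> g" using Zg[OF b g] .
      finally show "g \<otimes> (a \<otimes> b) = a \<otimes> b \<otimes> g" using Zc[OF a] Zc[OF b] g by (simp add: m_assoc)
    qed
  qed
  have Z: "Z \<lhd> G"
  proof (rule normal_invI[OF sZ])
    fix x n assume x: "x \<in> carrier G" and n: "n \<in> Z"
    have "x \<otimes> n \<otimes> inv x = n \<otimes> x \<otimes> inv x" using Zg[OF n x] by simp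
    also have "\<dots> = n" using x Zc[OF n] by (simp add: m_assoc)
    finally show "x \<otimes> n \<otimes> inv x \<in> Z" using n by simp
  qed
  have "p dvd card (carrier G)" using assms by simp
  then obtain v where v: "v \<in> carrier G" "v \<noteq> \<one>" "\<And>r. r \<in> carrier G \<Longrightarrow> r \<otimes> v = v \<otimes> r"
    by (rule p_subgroup_centralises[OF subgroup_self assms(2,1) subgroup_self _ _ fin]) simp_all
  have "v \<in> Z" using v(1,3) by (rule ZI)
  then have "{\<one>, v} \<subseteq> Z" using subgroup.one_closed[OF sZ] by simp
  then have "card {\<one>, v} \<le> card Z" using subgroup_finite[OF sZ fin] by (rule card_mono[rotated])
  then have "card Z > 1" using v(2) by simp
  moreover have "comm_group (G\<lparr>carrier := Z\<rparr>)"
  proof (rule group.group_comm_groupI)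
    show "group (G\<lparr>carrier := Z\<rparr>)" using sZ by (rule subgroup_imp_group)
    show "x \<otimes>\<^bsub>G\<lparr>carrier := Z\<rparr>\<^esub> y = y \<otimes>\<^bsub>G\<lparr>carrier := Z\<rparr>\<^esub> x"
      if x: "x \<in> carrier (G\<lparr>carrier := Z\<rparr>)" and y: "y \<in> carrier (G\<lparr>carrier := Z\<rparr>)" for x y
      using Zg[of y x] Zc[of x] x y by simp
  qed
  ultimately show thesis using Z by (intro that)
qed

lemma p_group_solvable_nat:
  fixes G :: "nat monoid"
  assumes "group G" "prime p" "card (carrier G) = p ^ k"
  shows "solvable G"
  using assms
proof (induction k arbitrary: G rule: less_induct)
  case (less k)
  interpret group G by fact
  have fin: "finite (carrier G)" using less.prems by (metis card_ge_0_finite prime_gt_0_nat zero_less_power)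
  show ?case
  proof (cases "k = 0")
    case True
    then have "order G = 1" using less.prems by (simp add: order_def)
    then show ?thesis using order_one_triv_iff trivial_solvable by blast
  next
    case False
    then obtain Z where Z: "Z \<lhd> G" "comm_group (G\<lparr>carrier := Z\<rparr>)" "card Z > 1"
      using less.prems by (elim p_group_center[rotated])
    obtain K :: "nat monoid" and f where f: "finite_epi G K f" "kernel G K f = Z"
      using Z(1) fin by (rule nat_quotient)
    interpret f: finite_epi G K f by fact
    have oG: "card Z * order K = p ^ k" using f.order_epi f(2) less.prems(3) by (simp add: order_def)
    then have "order K dvd p ^ k" by (metis dvd_triv_right)
    then obtain j where j: "order K = p ^ j" using less.prems(2) by (metis divides_primepow_nat)
    have "order K > 0" using j less.prems(2) by (simp add: prime_gt_0_nat)
    then have "order K < p ^ k" unfolding oG[symmetric] using Z(3) by simp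
    then have "j < k" using j less.prems(2) by (metis power_strict_increasing_iff prime_gt_1_nat)
    then have "solvable K" using less.IH[of j K] less.prems(2) j by (simp add: order_def)
    then show ?thesis using f.solvable_extension f(2) comm_group_solvable[OF Z(2)] by simp
  qed
qed

lemma p_group_solvable:
  assumes "group G" "prime p" "card (carrier G) = p ^ k"
  shows "solvable G"
proof -
  have fin: "finite (carrier G)" using assms by (metis card_ge_0_finite prime_gt_0_nat zero_less_power)
  obtain K :: "nat monoid" and f where f: "finite_epi G K f" "kernel G K f = {\<one>\<^bsub>G\<^esub>}"
    using assms(1) fin by (rule nat_copy)
  interpret f: finite_epi G K f by fact
  have "order K = p ^ k" using f.order_epi f(2) assms(3) by (simp add: order_def)
  then have "solvable K" using p_group_solvable_nat[of K p k] assms(2) by (simp add: order_def)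
  moreover have "inj_on f (carrier G)" using f(2) by (simp add: f.inj_iff_trivial_ker)
  ultimately show ?thesis by (intro f.inj_hom_imp_solvable)
qed

lemma (in group) largest_prime:
  assumes "finite (carrier G)" "order G \<noteq> 1"
  obtains p where "prime p" "p dvd order G" "\<And>q. prime q \<Longrightarrow> q dvd order G \<Longrightarrow> q \<le> p"
proof -
  have pos: "order G > 0" using assms(1) order_gt_0_iff_finite by blast
  let ?S = "{p. prime p \<and> p dvd order G}"
  have "?S \<subseteq> {..order G}" using pos by (auto intro: dvd_imp_le)
  then have fin: "finite ?S" by (rule finite_subset) simp
  have "?S \<noteq> {}" using assms(2) prime_factor_nat by blast
  then have "Max ?S \<in> ?S" using fin by (rule Max_in[rotated])
  then show thesis using fin by (intro that[of "Max ?S"]) (auto intro: Max_ge)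
qed

lemma (in group) sylow_nontrivial:
  assumes "sylow_subgroup p P G" "prime p" "p dvd order G" "finite (carrier G)"
  shows "p dvd card P" "card P > 1"
proof -
  obtain m where m: "subgroup P G" "card P = p ^ multiplicity p (order G)"
    "order G = card P * m" "\<not> p dvd m" using assms(1,2,4) by (rule sylow_subgroupE)
  then show "p dvd card P" using assms(2,3) by (metis prime_dvd_mult_iff)
  then show "card P > 1" using assms(2) subgroup_card_pos[OF m(1) assms(4)]
    by (metis One_nat_def dvd_1_iff_1 less_one linorder_neqE_nat not_prime_1 less_irrefl)
qed

text \<open>
  Induction along the Sylow tower: the Sylow subgroup for the largest prime is normal,
  and the quotient by it belongs to the class again.
\<close>

lemma sylow_KP_tower_induct [consumes 1, case_names trivial step]:
  fixes G :: "nat monoid"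
  assumes "sylow_KP_group t G"
    and triv: "\<And>G :: nat monoid. group G \<Longrightarrow> order G = 1 \<Longrightarrow> Q G"
    and step: "\<And>(G :: nat monoid) (K :: nat monoid) f p.
       finite_epi G K f \<Longrightarrow> prime p \<Longrightarrow> p dvd order G \<Longrightarrow> (\<And>q. prime q \<Longrightarrow> q dvd order G \<Longrightarrow> q \<le> p) \<Longrightarrow>
       sylow_subgroup p (kernel G K f) G \<Longrightarrow> Q K \<Longrightarrow> Q G"
  shows "Q G"
  using assms(1)
proof (induction "order G" arbitrary: G rule: less_induct)
  case less
  interpret group G using less.prems by (simp add: sylow_KP_group_def)
  have fin: "finite (carrier G)" using less.prems by (simp add: sylow_KP_group_def)
  show ?case
  proof (cases "order G = 1")
    case True
    then show ?thesis using triv by blast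
  next
    case False
    then obtain p where p: "prime p" "p dvd order G" "\<And>q. prime q \<Longrightarrow> q dvd order G \<Longrightarrow> q \<le> p"
      using largest_prime[OF fin] by blast
    obtain P where P: "sylow_subgroup p P G" using p(1) fin by (rule sylow_exists)
    have "P \<lhd> G" using less.prems P p(1,3) by (rule largest_sylow_normal)
    then obtain K :: "nat monoid" and f where f: "finite_epi G K f" "kernel G K f = P"
      using fin by (rule nat_quotient)
    interpret f: finite_epi G K f by fact
    have "order G > 0" using fin order_gt_0_iff_finite by blast
    then have "order K < order G"
      using f.order_epi f(2) sylow_nontrivial(2)[OF P p(1,2) fin] by simp
    then have "Q K" using less.hyps f.sylow_KP_image[OF less.prems] by blast
    then show ?thesis using step[OF f(1) p] P f(2) by simp
  qed
qed

lemma (in finite_epi) solvable_by_p_kernel: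
  assumes "solvable H" "prime p" "card ker = p ^ k" shows "solvable G"
proof (rule solvable_extension)
  show "solvable (G\<lparr>carrier := ker\<rparr>)"
    using G.subgroup_imp_group[OF subgroup_kernel] assms(2,3) by (intro p_group_solvable[of _ p k]) simp_all
qed fact

lemma sylow_KP_solvable:
  assumes "sylow_KP_group t G" shows "solvable G"
proof -
  interpret group G using assms by (simp add: sylow_KP_group_def)
  have fin: "finite (carrier G)" using assms by (simp add: sylow_KP_group_def)
  obtain K :: "nat monoid" and f where f: "finite_epi G K f" "kernel G K f = {\<one>\<^bsub>G\<^esub>}"
    using is_group fin by (rule nat_copy)
  interpret f: finite_epi G K f by fact
  have "sylow_KP_group t K" using assms by (rule f.sylow_KP_image)
  then have "solvable K"
  proof (induction rule: sylow_KP_tower_induct)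
    case (trivial G)
    then show ?case using group.order_one_triv_iff[of G] group.trivial_solvable by blast
  next
    case (step G K f p)
    then show ?case by (intro finite_epi.solvable_by_p_kernel[of G K f p]) (auto simp: sylow_subgroup_def)
  qed
  moreover have "inj_on f (carrier G)" using f(2) by (simp add: f.inj_iff_trivial_ker)
  ultimately show ?thesis by (intro f.inj_hom_imp_solvable)
qed

section \<open>Subgroups of prime index\<close>

lemma (in group) conj_pow:
  assumes "b \<in> carrier G" "z \<in> carrier G"
  shows "b \<otimes> (z [^] (n::nat)) \<otimes> inv b = (b \<otimes> z \<otimes> inv b) [^] n"
proof (induction n)
  case (Suc n)
  have "b \<otimes> (z [^] Suc n) \<otimes> inv b = (b \<otimes> (z [^] n) \<otimes> inv b) \<otimes> (b \<otimes> z \<otimes> inv b)"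
    using assms by (simp add: m_assoc inv_mult_cancel)
  then show ?case using Suc by simp
qed (use assms in simp)

lemma (in group) prime_order_generator:
  assumes Z: "subgroup Z G" "card Z = p" "prime p" and fin: "finite (carrier G)"
  obtains z where "z \<in> Z" "z \<noteq> \<one>" "\<And>y. y \<in> Z \<Longrightarrow> \<exists>i::nat. y = z [^] i" "z [^] p = \<one>"
proof -
  have "Z \<noteq> {\<one>}" using Z by auto
  then obtain z where z: "z \<in> Z" "z \<noteq> \<one>" using subgroup.one_closed[OF Z(1)] by blast
  have zc: "z \<in> carrier G" using z(1) Z(1) subgroup.mem_carrier by metis
  have sub: "subgroup (generate G {z}) G" using zc by (intro generate_is_subgroup) simp
  have incl: "generate G {z} \<subseteq> Z" using z(1) Z(1) by (intro generate_subgroup_incl) auto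
  have "card (generate G {z}) dvd p" using card_subgroup_dvd[OF sub Z(1) incl fin] Z(2) by simp
  moreover have "card (generate G {z}) \<noteq> 1"
    using z(2) generate.incl[of z "{z}"] generate.one[of G "{z}"] by (metis card_1_singletonE insertI1 singletonD)
  ultimately have "card (generate G {z}) = card Z" using Z(2,3) by (auto simp: prime_nat_iff)
  then have eq: "generate G {z} = Z" using incl subgroup_finite[OF Z(1) fin] by (simp add: card_subset_eq)
  interpret Z: group "G\<lparr>carrier := Z\<rparr>" using Z(1) by (rule subgroup_imp_group)
  have "z [^]\<^bsub>G\<lparr>carrier := Z\<rparr>\<^esub> order (G\<lparr>carrier := Z\<rparr>) = \<one>" using Z.pow_order_eq_1[of z] z(1) by simp
  then have "z [^] p = \<one>" using Z(2) nat_pow_consistent[of z p Z] by simp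
  moreover have "\<exists>i::nat. y = z [^] i" if "y \<in> Z" for y
    using that generate_pow_on_finite_carrier[OF fin zc] eq by auto
  ultimately show thesis using z that by blast
qed

text \<open>
  Conjugation induces power maps on a group of prime order. Power maps commute, which
  gives the statement about commutators, and Fermat's little theorem gives the one about
  powers.
\<close>

lemma (in group) prime_order_normal_action:
  assumes Z: "Z \<lhd> G" "card Z = p" "prime p" and fin: "finite (carrier G)" and z: "z \<in> Z"
  shows "y \<in> Z \<Longrightarrow> y \<otimes> z = z \<otimes> y"
    and "b \<in> carrier G \<Longrightarrow> c \<in> carrier G \<Longrightarrow> (b \<otimes> c \<otimes> inv b \<otimes> inv c) \<otimes> z \<otimes> inv (b \<otimes> c \<otimes> inv b \<otimes> inv c) = z"
    and "b \<in> carrier G \<Longrightarrow> (b [^] (p - 1)) \<otimes> z \<otimes> inv (b [^] (p - 1)) = z"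
proof -
  have sZ: "subgroup Z G" using Z(1) by (rule normal_imp_subgroup)
  have Zc: "y \<in> carrier G" if "y \<in> Z" for y using that sZ subgroup.mem_carrier by metis
  obtain w where w: "w \<in> Z" "w \<noteq> \<one>" "\<And>y. y \<in> Z \<Longrightarrow> \<exists>i::nat. y = w [^] i" "w [^] p = \<one>"
    by (rule prime_order_generator[OF sZ Z(2,3) fin]) blast
  have wc: "w \<in> carrier G" using w(1) by (rule Zc)
  show "y \<otimes> z = z \<otimes> y" if y: "y \<in> Z"
  proof -
    obtain i j :: nat where "y = w [^] i" "z = w [^] j" using w(3)[OF y] w(3)[OF z] by blast
    then show ?thesis using wc by (simp add: nat_pow_mult add.commute)
  qed
  have zp: "y [^] p = \<one>" if y: "y \<in> Z" for y
  proof -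
    obtain i :: nat where i: "y = w [^] i" using w(3)[OF y] by blast
    have "y [^] p = (w [^] p) [^] i" unfolding i using wc by (simp add: nat_pow_pow mult.commute)
    then show ?thesis using w(4) by simp
  qed
  have conj: "b \<otimes> y \<otimes> inv b \<in> Z" if "b \<in> carrier G" "y \<in> Z" for b y
    using Z(1) that by (rule normal.inv_op_closed2)
  have pow: "\<exists>i::nat. \<forall>y\<in>Z. b \<otimes> y \<otimes> inv b = y [^] i" if b: "b \<in> carrier G" for b
  proof -
    obtain i :: nat where i: "b \<otimes> w \<otimes> inv b = w [^] i" using w(3)[OF conj[OF b w(1)]] by blast
    have "b \<otimes> y \<otimes> inv b = y [^] i" if "y \<in> Z" for y
    proof -
      obtain j :: nat where j: "y = w [^] j" using w(3)[OF \<open>y \<in> Z\<close>] by blast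
      show ?thesis unfolding j conj_pow[OF b wc] i using wc by (simp add: nat_pow_pow mult.commute)
    qed
    then show ?thesis by blast
  qed
  show "(b \<otimes> c \<otimes> inv b \<otimes> inv c) \<otimes> z \<otimes> inv (b \<otimes> c \<otimes> inv b \<otimes> inv c) = z"
    if b: "b \<in> carrier G" and c: "c \<in> carrier G"
  proof -
    obtain i j :: nat where i: "\<And>y. y \<in> Z \<Longrightarrow> b \<otimes> y \<otimes> inv b = y [^] i"
      and j: "\<And>y. y \<in> Z \<Longrightarrow> c \<otimes> y \<otimes> inv c = y [^] j" using pow[OF b] pow[OF c] by blast
    \<comment> \<open>Writing \<open>z\<close> as the conjugate of \<open>y\<close> by \<open>c b\<close> turns its conjugate by the commutator of \<open>b\<close> and \<open>c\<close> into the conjugate of \<open>y\<close> by \<open>b c\<close>.\<close>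
    define y where "y = inv b \<otimes> (inv c \<otimes> z \<otimes> c) \<otimes> b"
    have zc: "z \<in> carrier G" using z by (rule Zc)
    have y: "y \<in> Z" unfolding y_def using Z(1) b c z by (intro normal.inv_op_closed1) auto
    then have yc: "y \<in> carrier G" by (rule Zc)
    have pws: "y [^] j \<in> Z" "y [^] i \<in> Z"
      using i[OF y] j[OF y] conj[OF b y] conj[OF c y] by simp_all
    have "(b \<otimes> c \<otimes> inv b \<otimes> inv c) \<otimes> z \<otimes> inv (b \<otimes> c \<otimes> inv b \<otimes> inv c)
        = b \<otimes> (c \<otimes> y \<otimes> inv c) \<otimes> inv b"
      unfolding y_def using b c zc by (simp add: m_assoc inv_mult_group inv_mult_cancel)
    also have "\<dots> = y [^] (j * i)" using i[OF pws(1)] j[OF y] yc by (simp add: nat_pow_pow)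
    also have "\<dots> = c \<otimes> (b \<otimes> y \<otimes> inv b) \<otimes> inv c"
      using j[OF pws(2)] i[OF y] yc by (simp add: nat_pow_pow mult.commute)
    also have "\<dots> = z" unfolding y_def using b c zc by (simp add: m_assoc inv_mult_group inv_mult_cancel)
    finally show ?thesis .
  qed
  show "(b [^] (p - 1)) \<otimes> z \<otimes> inv (b [^] (p - 1)) = z" if b: "b \<in> carrier G"
  proof -
    obtain i :: nat where i: "\<And>y. y \<in> Z \<Longrightarrow> b \<otimes> y \<otimes> inv b = y [^] i" using pow[OF b] by blast
    have iter: "(b [^] n) \<otimes> y \<otimes> inv (b [^] n) = y [^] (i ^ n)" if "y \<in> Z" for n :: nat and y
    proof (induction n)
      case 0
      then show ?case using Zc[OF that] by simp
    next
      case (Suc n)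
      have yc: "y \<in> carrier G" using that by (rule Zc)
      have y': "y [^] (i ^ n) \<in> Z" using Suc conj[OF nat_pow_closed[OF b] that, of n] by simp
      have "(b [^] Suc n) \<otimes> y \<otimes> inv (b [^] Suc n) = b \<otimes> ((b [^] n) \<otimes> y \<otimes> inv (b [^] n)) \<otimes> inv b"
        using b yc nat_pow_Suc2[OF b, of n] by (simp add: m_assoc inv_mult_group del: nat_pow_Suc)
      also have "\<dots> = (y [^] (i ^ n)) [^] i" using Suc i[OF y'] by simp
      also have "\<dots> = y [^] (i ^ Suc n)" using yc by (simp add: nat_pow_pow mult.commute)
      finally show ?case .
    qed
    have "\<not> p dvd i"
    proof
      assume "p dvd i"
      then obtain k where "i = p * k" by (elim dvdE)
      then have "b \<otimes> w \<otimes> inv b = \<one>" using i[OF w(1)] w(4) wc by (simp add: nat_pow_pow[symmetric])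
      moreover have "b \<otimes> w = (b \<otimes> w \<otimes> inv b) \<otimes> b" using b wc by (simp add: m_assoc)
      ultimately have "b \<otimes> w = b" using b by simp
      then show False using w(2) b wc by simp
    qed
    then have "[i ^ (p - 1) = 1] (mod p)" using Z(3) by (intro fermat_theorem)
    then have "p dvd i ^ (p - 1) - 1" by (rule cong_to_1_nat)
    then obtain k where "i ^ (p - 1) - 1 = p * k" by (elim dvdE)
    moreover have "i > 0" using \<open>\<not> p dvd i\<close> by (intro gr0I) auto
    then have "i ^ (p - 1) > 0" by simp
    ultimately have k: "i ^ (p - 1) = 1 + p * k" by linarith
    have zc: "z \<in> carrier G" using z by (rule Zc)
    have "z [^] (p * k) = \<one>" using nat_pow_pow[OF zc, of p k] zp[OF z] by simp
    then have "z [^] (i ^ (p - 1)) = z" unfolding k using nat_pow_mult[OF zc, of 1 "p * k"] zc by simp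
    then show ?thesis using iter[OF z, of "p - 1"] by simp
  qed
qed

text \<open>
  The normaliser of \<open>K\<close> contains the maximal subgroup \<open>A\<close> and also the subgroup \<open>L\<close>,
  which is not inside \<open>A\<close>.
\<close>

lemma (in group) normal_by_maximal_subgroup:
  assumes A: "subgroup A G" and max: "\<And>M. subgroup M G \<Longrightarrow> A \<subseteq> M \<Longrightarrow> M = A \<or> M = carrier G"
    and K: "subgroup K G" and AK: "\<And>a x. a \<in> A \<Longrightarrow> x \<in> K \<Longrightarrow> a \<otimes> x \<otimes> inv a \<in> K"
    and L: "subgroup L G" "\<not> L \<subseteq> A" and LK: "\<And>y x. y \<in> L \<Longrightarrow> x \<in> K \<Longrightarrow> y \<otimes> x \<otimes> inv y \<in> K"
  shows "K \<lhd> G"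
proof -
  define M where "M = {g \<in> carrier G. \<forall>x\<in>K. g \<otimes> x \<otimes> inv g \<in> K \<and> inv g \<otimes> x \<otimes> g \<in> K}"
  have Kc: "x \<in> carrier G" if "x \<in> K" for x using that K subgroup.mem_carrier by metis
  have M: "subgroup M G"
  proof (rule subgroupI)
    show "M \<subseteq> carrier G" by (auto simp: M_def)
    show "M \<noteq> {}" using Kc by (auto simp: M_def intro!: exI[of _ \<one>])
    show "inv a \<in> M" if "a \<in> M" for a using that by (simp add: M_def)
    show "a \<otimes> b \<in> M" if "a \<in> M" "b \<in> M" for a b
    proof -
      have ab: "a \<in> carrier G" "b \<in> carrier G" using that by (auto simp: M_def)
      have "a \<otimes> b \<otimes> x \<otimes> inv (a \<otimes> b) \<in> K \<and> inv (a \<otimes> b) \<otimes> x \<otimes> (a \<otimes> b) \<in> K" if x: "x \<in> K" for x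
      proof -
        have "a \<otimes> b \<otimes> x \<otimes> inv (a \<otimes> b) = a \<otimes> (b \<otimes> x \<otimes> inv b) \<otimes> inv a"
          "inv (a \<otimes> b) \<otimes> x \<otimes> (a \<otimes> b) = inv b \<otimes> (inv a \<otimes> x \<otimes> a) \<otimes> b"
          using ab Kc[OF x] by (simp_all add: m_assoc inv_mult_group)
        then show ?thesis using \<open>a \<in> M\<close> \<open>b \<in> M\<close> x by (simp add: M_def)
      qed
      then show ?thesis using ab by (simp add: M_def)
    qed
  qed
  have "g \<in> M" if g: "g \<in> S" and S: "subgroup S G" "\<And>y x. y \<in> S \<Longrightarrow> x \<in> K \<Longrightarrow> y \<otimes> x \<otimes> inv y \<in> K" for g S
  proof -
    have gc: "g \<in> carrier G" using g S(1) subgroup.mem_carrier by metis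
    have "inv g \<in> S" using g S(1) by (simp add: subgroup.m_inv_closed)
    then show ?thesis using S(2)[OF g] S(2)[of "inv g"] gc by (simp add: M_def)
  qed
  then have "A \<subseteq> M" "L \<subseteq> M" using A AK L(1) LK by blast+
  then have "M = carrier G" using max[OF M] L(2) by blast
  then show ?thesis using K by (intro normal_invI) (auto simp: M_def)
qed

lemma (in group) maximal_normal_cover:
  assumes A: "subgroup A G" and max: "\<And>M. subgroup M G \<Longrightarrow> A \<subseteq> M \<Longrightarrow> M = A \<or> M = carrier G"
    and N: "N \<lhd> G" "\<not> N \<subseteq> A" and fin: "finite (carrier G)" and g: "g \<in> carrier G"
  shows "\<exists>a\<in>A. \<exists>u\<in>N. g = a \<otimes> u"
proof -
  obtain K :: "nat monoid" and f where f: "finite_epi G K f" "kernel G K f = N"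
    using N(1) fin by (rule nat_quotient)
  interpret f: finite_epi G K f by fact
  have im: "subgroup (f ` A) K" using A by (rule f.image_subgroup)
  have s: "subgroup (f.preim (f ` A)) G" using im by (rule f.preim_subgroup)
  have "A \<subseteq> f.preim (f ` A)" using subgroup.subset[OF A] by blast
  moreover have "N \<subseteq> f.preim (f ` A)" using f.ker_in_preim[OF im] f(2) by simp
  ultimately have "f.preim (f ` A) = carrier G" using max[OF s] N(2) by blast
  then have "g \<in> f.preim (f ` A)" using g by simp
  then obtain k a where "k \<in> kernel G K f" "a \<in> A" "g = a \<otimes> k"
    using A by (elim f.preim_image_member[rotated])
  then show ?thesis using f(2) by blast
qed

lemma (in group) prime_index_maximal:
  assumes A: "subgroup A G" "order G = p * card A" "prime p" and fin: "finite (carrier G)"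
    and M: "subgroup M G" "A \<subseteq> M"
  shows "M = A \<or> M = carrier G"
proof -
  have "card A dvd card M" using A(1) M fin by (intro card_subgroup_dvd)
  then obtain c where c: "card M = card A * c" by (elim dvdE)
  have pos: "card A > 0" using A(1) fin by (rule subgroup_card_pos)
  have "card M dvd order G" using M(1) by (rule subgroup_card_dvd_order)
  then have "card A * c dvd card A * p" using c A(2) by (simp add: mult.commute)
  then have "c dvd p" using pos by simp
  then have "c = 1 \<or> c = p" using A(3) by (simp add: prime_nat_iff)
  then show ?thesis
  proof
    assume "c = 1"
    then have "card A = card M" using c by simp
    then show ?thesis using card_subset_eq[OF subgroup_finite[OF M(1) fin] M(2)] by simp
  next
    assume "c = p"
    then have "card M = card (carrier G)" using c A(2) by (simp add: order_def mult.commute)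
    then show ?thesis using subgroup.subset[OF M(1)] fin by (simp add: card_subset_eq)
  qed
qed

lemma (in group) solvable_derived_less:
  assumes "solvable G" "subgroup L G" "L \<noteq> {\<one>}"
  shows "derived G L \<noteq> L"
proof
  assume eq: "derived G L = L"
  obtain n where "(derived G ^^ n) L = {\<one>}"
    using solvable_imp_trivial_derived_seq[OF solvable_subgroup[OF assms(2,1)]] by blast
  moreover have "(derived G ^^ n) L = L" by (induction n) (simp_all add: eq)
  ultimately show False using assms(3) by simp
qed

text \<open>
  If \<open>h\<close> has kernel \<open>D \<subseteq> N\<close>, this set consists of the elements that act
  trivially on \<open>N / D\<close> by conjugation.
\<close>

abbreviation image_centraliser :: "('a, 'b) monoid_scheme \<Rightarrow> ('c, 'd) monoid_scheme \<Rightarrow> ('a \<Rightarrow> 'c) \<Rightarrow> 'a set \<Rightarrow> 'a set" where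
  "image_centraliser G H h N \<equiv>
     {g \<in> carrier G. \<forall>y\<in>N. h g \<otimes>\<^bsub>H\<^esub> h y \<otimes>\<^bsub>H\<^esub> inv\<^bsub>H\<^esub> h g = h y}"

lemma (in finite_epi) centraliser_normal:
  assumes "N \<lhd> G"
  shows "image_centraliser G H h N \<lhd> G" (is "?C \<lhd> G")
proof -
  have Nc: "y \<in> carrier G" if "y \<in> N" for y
    using that assms normal_imp_subgroup subgroup.mem_carrier by metis
  define C where "C = ?C"
  have sC: "subgroup C G"
  proof (rule G.subgroupI)
    show "C \<subseteq> carrier G" by (auto simp: C_def)
    show "C \<noteq> {}" using Nc by (auto simp: C_def intro!: exI[of _ \<one>])
    show "a \<otimes> b \<in> C" if "a \<in> C" "b \<in> C" for a b
    proof -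
      have "h (a \<otimes> b) \<otimes>\<^bsub>H\<^esub> h y \<otimes>\<^bsub>H\<^esub> inv\<^bsub>H\<^esub> h (a \<otimes> b) = h y" if y: "y \<in> N" for y
      proof -
        have "h (a \<otimes> b) \<otimes>\<^bsub>H\<^esub> h y \<otimes>\<^bsub>H\<^esub> inv\<^bsub>H\<^esub> h (a \<otimes> b)
            = h a \<otimes>\<^bsub>H\<^esub> (h b \<otimes>\<^bsub>H\<^esub> h y \<otimes>\<^bsub>H\<^esub> inv\<^bsub>H\<^esub> h b) \<otimes>\<^bsub>H\<^esub> inv\<^bsub>H\<^esub> h a"
          using \<open>a \<in> C\<close> \<open>b \<in> C\<close> Nc[OF y] by (simp add: C_def H.m_assoc H.inv_mult_group)
        then show ?thesis using \<open>a \<in> C\<close> \<open>b \<in> C\<close> y by (simp add: C_def)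
      qed
      then show ?thesis using that by (simp add: C_def)
    qed
    show "inv a \<in> C" if a: "a \<in> C" for a
    proof -
      have ac: "a \<in> carrier G" using a by (simp add: C_def)
      have "h (inv a) \<otimes>\<^bsub>H\<^esub> h y \<otimes>\<^bsub>H\<^esub> inv\<^bsub>H\<^esub> h (inv a) = h y" if y: "y \<in> N" for y
      proof -
        have "h a \<otimes>\<^bsub>H\<^esub> h y \<otimes>\<^bsub>H\<^esub> inv\<^bsub>H\<^esub> h a = h y" using a y by (simp add: C_def)
        then have "inv\<^bsub>H\<^esub> h a \<otimes>\<^bsub>H\<^esub> h y \<otimes>\<^bsub>H\<^esub> h a
            = inv\<^bsub>H\<^esub> h a \<otimes>\<^bsub>H\<^esub> (h a \<otimes>\<^bsub>H\<^esub> h y \<otimes>\<^bsub>H\<^esub> inv\<^bsub>H\<^esub> h a) \<otimes>\<^bsub>H\<^esub> h a" by simp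
        also have "\<dots> = h y" using ac Nc[OF y] by (simp add: H.m_assoc H.inv_mult_cancel)
        finally show ?thesis using ac by simp
      qed
      then show ?thesis using ac by (simp add: C_def)
    qed
  qed
  have Cc: "x \<in> carrier G" if "x \<in> C" for x using that by (simp add: C_def)
  have C: "C \<lhd> G"
  proof (rule G.normal_invI[OF sC])
    fix g x assume g: "g \<in> carrier G" and x: "x \<in> C"
    have xc: "x \<in> carrier G" using x by (rule Cc)
    have "h (g \<otimes> x \<otimes> inv g) \<otimes>\<^bsub>H\<^esub> h y \<otimes>\<^bsub>H\<^esub> inv\<^bsub>H\<^esub> h (g \<otimes> x \<otimes> inv g) = h y" if y: "y \<in> N" for y
    proof -
      have yc: "y \<in> carrier G" using y by (rule Nc)
      have y': "inv g \<otimes> y \<otimes> g \<in> N" using assms g y by (rule normal.inv_op_closed1)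
      have "h (g \<otimes> x \<otimes> inv g) \<otimes>\<^bsub>H\<^esub> h y \<otimes>\<^bsub>H\<^esub> inv\<^bsub>H\<^esub> h (g \<otimes> x \<otimes> inv g)
          = h g \<otimes>\<^bsub>H\<^esub> (h x \<otimes>\<^bsub>H\<^esub> h (inv g \<otimes> y \<otimes> g) \<otimes>\<^bsub>H\<^esub> inv\<^bsub>H\<^esub> h x) \<otimes>\<^bsub>H\<^esub> inv\<^bsub>H\<^esub> h g"
        using g xc yc by (simp add: H.m_assoc H.inv_mult_group)
      also have "h x \<otimes>\<^bsub>H\<^esub> h (inv g \<otimes> y \<otimes> g) \<otimes>\<^bsub>H\<^esub> inv\<^bsub>H\<^esub> h x = h (inv g \<otimes> y \<otimes> g)"
        using x y' by (simp add: C_def)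
      also have "h g \<otimes>\<^bsub>H\<^esub> h (inv g \<otimes> y \<otimes> g) \<otimes>\<^bsub>H\<^esub> inv\<^bsub>H\<^esub> h g = h y"
        using g yc by (simp add: H.m_assoc H.inv_mult_cancel)
      finally show ?thesis .
    qed
    then show "g \<otimes> x \<otimes> inv g \<in> C" using g xc by (simp add: C_def)
  qed
  then show ?thesis by (simp add: C_def)
qed

text \<open>
  The soluble primitive group of prime degree \<open>p\<close> behind a subgroup \<open>A\<close> of index \<open>p\<close>. A
  normal subgroup \<open>L\<close> that is minimal among those not contained in \<open>A\<close> has its derived
  subgroup inside \<open>A\<close>, hence \<open>L \<inter> A\<close> is normal in \<open>G = A L\<close> and the factor
  \<open>L / (L \<inter> A)\<close> has order \<open>p\<close>. The subgroup \<open>C\<close> is the centraliser of this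
  factor, so that \<open>G / C\<close> acts faithfully on a group of order \<open>p\<close>: it is abelian of
  exponent dividing \<open>p - 1\<close>.
\<close>

lemma (in group) prime_index_structure:
  assumes solv: "solvable G" and fin: "finite (carrier G)"
    and A: "subgroup A G" "order G = p * card A" "prime p"
  obtains C where "C \<lhd> G" "C \<inter> A \<lhd> G" "card C = p * card (C \<inter> A)" "\<not> C \<subseteq> A"
    "\<And>b c. b \<in> carrier G \<Longrightarrow> c \<in> carrier G \<Longrightarrow> b \<otimes> c \<otimes> inv b \<otimes> inv c \<in> C"
    "\<And>b. b \<in> carrier G \<Longrightarrow> b [^] (p - 1) \<in> C"
proof -
  note max = prime_index_maximal[OF A fin]
  have Ac: "A \<subseteq> carrier G" using A(1) by (rule subgroup.subset)
  have A1: "\<one> \<in> A" using A(1) by (rule subgroup.one_closed)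
  have "\<not> carrier G \<subseteq> A"
  proof
    assume "carrier G \<subseteq> A"
    then have "order G \<le> card A"
      unfolding order_def using subgroup_finite[OF A(1) fin] by (intro card_mono)
    moreover have "1 * card A < p * card A"
      using prime_gt_1_nat[OF A(3)] subgroup_card_pos[OF A(1) fin] by (intro mult_strict_right_mono)
    ultimately show False using A(2) by simp
  qed
  then have "\<exists>L. (L \<lhd> G \<and> \<not> L \<subseteq> A) \<and> (\<forall>L'. L' \<lhd> G \<and> \<not> L' \<subseteq> A \<longrightarrow> card L \<le> card L')"
    using normal_self by (intro ex_has_least_nat[where k = "carrier G"] conjI)
  then obtain L where L: "L \<lhd> G" "\<not> L \<subseteq> A"
    and min: "\<And>L'. L' \<lhd> G \<Longrightarrow> \<not> L' \<subseteq> A \<Longrightarrow> card L \<le> card L'" by blast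
  have sL: "subgroup L G" using L(1) by (rule normal_imp_subgroup)
  have Lc: "y \<in> carrier G" if "y \<in> L" for y using that sL subgroup.mem_carrier by metis
  have "L \<noteq> {\<one>}" using L(2) A1 by blast
  then have ne: "derived G L \<noteq> L" using solv sL by (intro solvable_derived_less)
  have dL: "derived G L \<subseteq> L" by (rule derived_incl[OF order_refl sL])
  then have "card (derived G L) < card L" using ne subgroup_finite[OF sL fin] by (simp add: psubset_card_mono)
  then have dA: "derived G L \<subseteq> A" using min[OF derived_is_normal[OF L(1)]] by (cases "derived G L \<subseteq> A") simp_all
  have comm: "y \<otimes> x \<otimes> inv y \<otimes> inv x \<in> derived G L" if "y \<in> L" "x \<in> L" for y x
    unfolding derived_def using that by (intro generate.incl) blast
  have sN: "subgroup (L \<inter> A) G" using sL A(1) by (rule subgroups_Inter_pair)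
  have N: "L \<inter> A \<lhd> G"
  proof (rule normal_by_maximal_subgroup[OF A(1) _ sN _ sL L(2)])
    show "M = A \<or> M = carrier G" if "subgroup M G" "A \<subseteq> M" for M using that by (rule max)
  next
    fix a x assume "a \<in> A" "x \<in> L \<inter> A"
    then show "a \<otimes> x \<otimes> inv a \<in> L \<inter> A"
      using normal.inv_op_closed2[OF L(1)] A(1) Ac by (auto simp: subgroup.m_closed subgroup.m_inv_closed)
  next
    fix y x assume y: "y \<in> L" and x: "x \<in> L \<inter> A"
    have eq: "y \<otimes> x \<otimes> inv y = (y \<otimes> x \<otimes> inv y \<otimes> inv x) \<otimes> x" using y x Lc by (simp add: m_assoc)
    have "y \<otimes> x \<otimes> inv y \<otimes> inv x \<in> L \<inter> A" using comm[of y x] y x dA dL by blast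
    then have "(y \<otimes> x \<otimes> inv y \<otimes> inv x) \<otimes> x \<in> L \<inter> A" using x by (rule subgroup.m_closed[OF sN])
    then show "y \<otimes> x \<otimes> inv y \<in> L \<inter> A" by (simp only: eq[symmetric])
  qed
  have count: "card M = p * card (M \<inter> A)" if M: "M \<lhd> G" "\<not> M \<subseteq> A" for M
  proof -
    have "card M * card A = order G * card (A \<inter> M)"
    proof (rule card_transitive_supplement[OF normal_imp_subgroup[OF M(1)] A(1) fin])
      fix g assume g: "g \<in> carrier G"
      show "\<exists>a\<in>A. \<exists>u\<in>M. g = a \<otimes> u"
      proof (rule maximal_normal_cover[OF A(1) _ M fin g])
        show "M = A \<or> M = carrier G" if "subgroup M G" "A \<subseteq> M" for M using that by (rule max)
      qed
    qed
    also have "\<dots> = (p * card (M \<inter> A)) * card A" unfolding A(2) Int_commute[of M A] by (simp only: ac_simps)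
    finally have "card M * card A = (p * card (M \<inter> A)) * card A" .
    then show ?thesis using subgroup_card_pos[OF A(1) fin] by simp
  qed
  obtain K :: "nat monoid" and f where f: "finite_epi G K f" "kernel G K f = L \<inter> A"
    using N fin by (rule nat_quotient)
  interpret f: finite_epi G K f by fact
  have Z: "f ` L \<lhd> K" using L(1) by (rule f.image_normal)
  have "card L = card (L \<inter> A) * card (f ` L)"
  proof -
    have "kernel G K f \<inter> L = L \<inter> A" using f(2) by blast
    then show ?thesis using f.card_hom_image[OF sL fin] by simp
  qed
  then have cZ: "card (f ` L) = p"
    using count[OF L] subgroup_card_pos[OF sN fin] by simp
  note act = f.H.prime_order_normal_action[OF Z cZ A(3) f.finH]
  define C where "C = image_centraliser G K f L"
  have C: "C \<lhd> G" unfolding C_def using L(1) by (rule f.centraliser_normal)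
  have sC: "subgroup C G" using C by (rule normal_imp_subgroup)
  have Cc: "x \<in> carrier G" if "x \<in> C" for x using that by (simp add: C_def)
  have LC: "L \<subseteq> C"
  proof
    fix x assume x: "x \<in> L"
    have xc: "x \<in> carrier G" using x by (rule Lc)
    have "f x \<otimes>\<^bsub>K\<^esub> f y \<otimes>\<^bsub>K\<^esub> inv\<^bsub>K\<^esub> f x = f y" if y: "y \<in> L" for y
      using act(1)[of "f y" "f x"] x y xc Lc[OF y] by (simp add: f.H.m_assoc)
    then show "x \<in> C" using xc by (simp add: C_def)
  qed
  have sK: "subgroup (C \<inter> A) G" using sC A(1) by (rule subgroups_Inter_pair)
  have K: "C \<inter> A \<lhd> G"
  proof (rule normal_by_maximal_subgroup[OF A(1) _ sK _ sL L(2)])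
    show "M = A \<or> M = carrier G" if "subgroup M G" "A \<subseteq> M" for M using that by (rule max)
  next
    fix a x assume "a \<in> A" "x \<in> C \<inter> A"
    then show "a \<otimes> x \<otimes> inv a \<in> C \<inter> A"
      using normal.inv_op_closed2[OF C] A(1) Ac by (auto simp: subgroup.m_closed subgroup.m_inv_closed)
  next
    fix y x assume y: "y \<in> L" and x: "x \<in> C \<inter> A"
    have yc: "y \<in> carrier G" using y by (rule Lc)
    have xc: "x \<in> carrier G" using x Cc by blast
    have fx: "f x \<otimes>\<^bsub>K\<^esub> f y \<otimes>\<^bsub>K\<^esub> inv\<^bsub>K\<^esub> f x = f y" using x y by (simp add: C_def)
    have "f (y \<otimes> (x \<otimes> inv y \<otimes> inv x)) = f y \<otimes>\<^bsub>K\<^esub> inv\<^bsub>K\<^esub> (f x \<otimes>\<^bsub>K\<^esub> f y \<otimes>\<^bsub>K\<^esub> inv\<^bsub>K\<^esub> f x)"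
      using xc yc by (simp add: f.H.m_assoc f.H.inv_mult_group)
    then have "f (y \<otimes> (x \<otimes> inv y \<otimes> inv x)) = \<one>\<^bsub>K\<^esub>" using yc fx by simp
    then have "y \<otimes> (x \<otimes> inv y \<otimes> inv x) \<in> kernel G K f" using xc yc by (simp add: kernel_def)
    then have in_CA: "y \<otimes> (x \<otimes> inv y \<otimes> inv x) \<in> C \<inter> A" using f(2) LC by blast
    have "y \<otimes> x \<otimes> inv y = (y \<otimes> (x \<otimes> inv y \<otimes> inv x)) \<otimes> x" using xc yc by (simp add: m_assoc)
    then show "y \<otimes> x \<otimes> inv y \<in> C \<inter> A" using in_CA x sK by (simp add: subgroup.m_closed del: Int_iff)
  qed
  show thesis
  proof (rule that[OF C K])
    show nC: "\<not> C \<subseteq> A" using L(2) LC by blast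
    show "card C = p * card (C \<inter> A)" using C nC by (rule count)
    fix b assume b: "b \<in> carrier G"
    show "b [^] (p - 1) \<in> C"
      using b act(3)[of _ "f b"] by (simp add: C_def f.hom_nat_pow)
    fix c assume c: "c \<in> carrier G"
    have "f (b \<otimes> c \<otimes> inv b \<otimes> inv c) = f b \<otimes>\<^bsub>K\<^esub> f c \<otimes>\<^bsub>K\<^esub> inv\<^bsub>K\<^esub> f b \<otimes>\<^bsub>K\<^esub> inv\<^bsub>K\<^esub> f c"
      using b c by simp
    then show "b \<otimes> c \<otimes> inv b \<otimes> inv c \<in> C"
      using b c act(2)[of _ "f b" "f c"] by (simp add: C_def)
  qed
qed

section \<open>Inheritance by subgroups\<close>

text \<open>
  Intersecting a step of prime index with a subgroup \<open>U\<close> need not give a step of prime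
  index, but in a soluble group it still gives an admissible one. With \<open>C\<close> as in
  \<open>prime_index_structure\<close> there are two cases. If \<open>C \<inter> U\<close> is contained in \<open>A\<close>,
  then so are the commutators of \<open>B \<inter> U\<close>, and the step becomes normal. Otherwise
  \<open>C \<inter> U\<close> and \<open>C \<inter> A\<close> generate \<open>C\<close>, whence \<open>B = A (B \<inter> U)\<close> and the
  index is preserved.
\<close>

lemma (in group) KP_link_inter:
  assumes solv: "solvable G" and fin: "finite (carrier G)" and st: "KP_link t G A B" and U: "subgroup U G"
  shows "KP_link t G (A \<inter> U) (B \<inter> U)"
  using st
proof (cases rule: KP_link_cases)
  case normal
  have sub: "subgroup (A \<inter> U) G" "subgroup (B \<inter> U) G" using normal(1,2) U by (auto intro: subgroups_Inter_pair)
  show ?thesis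
  proof (rule KP_link_normalI[OF sub])
    show "A \<inter> U \<subseteq> B \<inter> U" using normal(3) by blast
    fix a b assume "a \<in> A \<inter> U" "b \<in> B \<inter> U"
    then show "b \<otimes> a \<otimes> inv b \<in> A \<inter> U"
      using normal(4)[of a b] U by (simp add: subgroup.m_closed subgroup.m_inv_closed)
  qed
next
  case (index p)
  have sub: "subgroup (A \<inter> U) G" "subgroup (B \<inter> U) G" using index(1,2) U by (auto intro: subgroups_Inter_pair)
  have Bc: "B \<subseteq> carrier G" using index(2) by (rule subgroup.subset)
  let ?B = "G\<lparr>carrier := B\<rparr>"
  interpret B: group ?B using index(2) by (rule subgroup_imp_group)
  have finB: "finite (carrier ?B)" using subgroup_finite[OF index(2) fin] by simp
  have invB: "inv\<^bsub>?B\<^esub> b = inv b" if "b \<in> B" for b using m_inv_consistent[OF index(2) that] .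
  have A: "subgroup A ?B" using index(1,2,3) by (simp add: subgroup_update_iff)
  have U': "subgroup (B \<inter> U) ?B" using sub(2) index(2) by (simp add: subgroup_update_iff)
  have ordB: "order ?B = p * card A" using index(5) by simp
  obtain C where C: "C \<lhd> ?B" "C \<inter> A \<lhd> ?B" "card C = p * card (C \<inter> A)" "\<not> C \<subseteq> A"
    and comm: "\<And>b c. b \<in> carrier ?B \<Longrightarrow> c \<in> carrier ?B \<Longrightarrow>
      b \<otimes>\<^bsub>?B\<^esub> c \<otimes>\<^bsub>?B\<^esub> inv\<^bsub>?B\<^esub> b \<otimes>\<^bsub>?B\<^esub> inv\<^bsub>?B\<^esub> c \<in> C"
    by (rule B.prime_index_structure[OF solvable_restrict[OF solv index(2)] finB A ordB index(4)]) blast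
  have sC: "subgroup C ?B" using C(1) by (rule normal_imp_subgroup)
  have CB: "C \<subseteq> B" using subgroup.subset[OF sC] by simp
  show ?thesis
  proof (cases "C \<inter> U \<subseteq> A")
    case True
    show ?thesis
    proof (rule KP_link_normalI[OF sub])
      show "A \<inter> U \<subseteq> B \<inter> U" using index(3) by blast
      fix a b assume a: "a \<in> A \<inter> U" and b: "b \<in> B \<inter> U"
      have aB: "a \<in> B" and bB: "b \<in> B" using a b index(3) by auto
      have ac: "a \<in> carrier G" "b \<in> carrier G" using aB bB Bc by auto
      have "b \<otimes> a \<otimes> inv b \<otimes> inv a \<in> C" using comm[of b a] aB bB invB by simp
      moreover have "b \<otimes> a \<otimes> inv b \<otimes> inv a \<in> U"
        using a b U by (simp add: subgroup.m_closed subgroup.m_inv_closed)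
      ultimately have "b \<otimes> a \<otimes> inv b \<otimes> inv a \<in> A \<inter> U" using True by blast
      then have "b \<otimes> a \<otimes> inv b \<otimes> inv a \<otimes> a \<in> A \<inter> U" using a by (rule subgroup.m_closed[OF sub(1)])
      moreover have "b \<otimes> a \<otimes> inv b \<otimes> inv a \<otimes> a = b \<otimes> a \<otimes> inv b" using ac by (simp add: m_assoc)
      ultimately show "b \<otimes> a \<otimes> inv b \<in> A \<inter> U" by simp
    qed
  next
    case False
    have max: "M = A \<or> M = carrier ?B" if "subgroup M ?B" "A \<subseteq> M" for M
      by (rule B.prime_index_maximal[OF A ordB index(4) finB that])
    have sCU: "subgroup (C \<inter> (B \<inter> U)) ?B" using sC U' by (rule B.subgroups_Inter_pair)
    obtain K :: "nat monoid" and f where f: "finite_epi ?B K f" "kernel ?B K f = C \<inter> A"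
      using C(2) finB by (rule nat_quotient)
    interpret f: finite_epi ?B K f by fact
    \<comment> \<open>\<open>W\<close> is the product of \<open>C \<inter> A\<close> and \<open>C \<inter> U\<close>; it lies strictly above \<open>C \<inter> A\<close>, which has prime index in \<open>C\<close>.\<close>
    define W where "W = f.preim (f ` (C \<inter> (B \<inter> U)))"
    have im: "subgroup (f ` (C \<inter> (B \<inter> U))) K" using sCU by (rule f.image_subgroup)
    have sW: "subgroup W ?B" unfolding W_def using im by (rule f.preim_subgroup)
    have KW: "C \<inter> A \<subseteq> W" unfolding W_def using f.ker_in_preim[OF im] f(2) by simp
    have UW: "C \<inter> U \<subseteq> W" unfolding W_def using CB by auto
    have W_dec: "\<exists>k\<in>C \<inter> A. \<exists>u\<in>C \<inter> U. w = k \<otimes> u" if w: "w \<in> W" for w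
    proof -
      obtain k u where ku: "k \<in> C \<inter> A" "u \<in> C \<inter> (B \<inter> U)" "w = u \<otimes>\<^bsub>?B\<^esub> k"
        by (rule f.preim_image_member[OF sCU w[unfolded W_def]]) (use f(2) in blast)
      have kc: "k \<in> carrier G" "u \<in> carrier G" "k \<in> B" "u \<in> B" using ku CB Bc by auto
      have "u \<otimes>\<^bsub>?B\<^esub> k \<otimes>\<^bsub>?B\<^esub> inv\<^bsub>?B\<^esub> u \<in> C \<inter> A"
        using C(2) ku kc by (intro normal.inv_op_closed2) auto
      then have "u \<otimes> k \<otimes> inv u \<in> C \<inter> A" using invB kc by simp
      moreover have "w = (u \<otimes> k \<otimes> inv u) \<otimes> u" using ku(3) kc by (simp add: m_assoc)
      ultimately show ?thesis using ku(2) by blast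
    qed
    have WC: "W \<subseteq> C"
    proof
      fix w assume "w \<in> W"
      then obtain k u where "k \<in> C \<inter> A" "u \<in> C \<inter> U" "w = k \<otimes> u" using W_dec by blast
      then show "w \<in> C" using subgroup.m_closed[OF sC, of k u] by simp
    qed
    have sK: "subgroup (C \<inter> A) ?B" using C(2) by (rule normal_imp_subgroup)
    \<comment> \<open>The index of \<open>C \<inter> A\<close> in \<open>W\<close> divides \<open>p\<close> and is not \<open>1\<close>.\<close>
    have posK: "card (C \<inter> A) > 0" using sK finB by (rule B.subgroup_card_pos)
    have "card (C \<inter> A) dvd card W" using sK sW KW finB by (intro B.card_subgroup_dvd)
    then obtain c where c: "card W = card (C \<inter> A) * c" by (elim dvdE)
    have "card W dvd card C" using sW sC WC finB by (intro B.card_subgroup_dvd)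
    then have "card (C \<inter> A) * c dvd card (C \<inter> A) * p" using C(3) c by (simp add: mult.commute)
    then have "c dvd p" using posK by simp
    moreover have "c \<noteq> 1"
    proof
      assume "c = 1"
      then have "card (C \<inter> A) = card W" using c by simp
      then have "C \<inter> A = W" using KW B.subgroup_finite[OF sW finB] by (intro card_subset_eq)
      then show False using UW False by blast
    qed
    ultimately have "c = p" using index(4) by (auto simp: prime_nat_iff)
    then have "card W = card C" using c C(3) by simp
    then have CW: "W = C" using WC B.subgroup_finite[OF sC finB] by (intro card_subset_eq)
    have "card (B \<inter> U) * card A = order ?B * card (A \<inter> (B \<inter> U))"
    proof (rule B.card_transitive_supplement[OF U' A finB])
      fix g assume g: "g \<in> carrier ?B"
      obtain a y where ay: "a \<in> A" "y \<in> C" "g = a \<otimes>\<^bsub>?B\<^esub> y"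
        using B.maximal_normal_cover[OF A max C(1,4) finB g] by blast
      obtain k u where ku: "k \<in> C \<inter> A" "u \<in> C \<inter> U" "y = k \<otimes> u" using W_dec ay(2) CW by blast
      have "a \<otimes> k \<in> A" using subgroup.m_closed[OF index(1), of a k] ay ku by simp
      moreover have "g = (a \<otimes> k) \<otimes>\<^bsub>?B\<^esub> u"
        using ay ku CB Bc index(3) by (simp add: m_assoc subset_iff)
      moreover have "u \<in> B \<inter> U" using ku CB by blast
      ultimately show "\<exists>a\<in>A. \<exists>u\<in>B \<inter> U. g = a \<otimes>\<^bsub>?B\<^esub> u" by blast
    qed
    moreover have "A \<inter> (B \<inter> U) = A \<inter> U" using index(3) by blast
    ultimately have "card A * card (B \<inter> U) = card A * (p * card (A \<inter> U))" unfolding ordB by (simp only: ac_simps)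
    then have "card (B \<inter> U) = p * card (A \<inter> U)" using subgroup_card_pos[OF index(1) fin] by simp
    then show ?thesis using sub index(3,4,6) by (intro KP_link_indexI[of _ _ p]) auto
  qed
qed

lemma (in group) KP_chain_inter:
  assumes "solvable G" "finite (carrier G)" "subgroup U G" "KP_chain t G A B"
  shows "KP_chain t G (A \<inter> U) (B \<inter> U)"
  using assms(4)
  by (induction rule: rtranclp_induct) (auto intro: KP_link_inter[OF assms(1,2) _ assms(3)] rtranclp.rtrancl_into_rtrancl)

lemma sylow_KP_subgroup:
  assumes "sylow_KP_group t G" "subgroup U G"
  shows "sylow_KP_group t (G\<lparr>carrier := U\<rparr>)"
  unfolding sylow_KP_group_iff
proof (intro conjI allI impI)
  interpret group G using assms(1) by (simp add: sylow_KP_group_def)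
  have fin: "finite (carrier G)" using assms(1) by (simp add: sylow_KP_group_def)
  show "group (G\<lparr>carrier := U\<rparr>)" using assms(2) by (rule subgroup_imp_group)
  show "finite (carrier (G\<lparr>carrier := U\<rparr>))" using subgroup_finite[OF assms(2) fin] by simp
  fix p Q assume p: "prime p" and Q: "sylow_subgroup p Q (G\<lparr>carrier := U\<rparr>)"
  obtain P where P: "sylow_subgroup p P G" "P \<inter> U = Q" using assms(2) Q p fin by (rule sylow_of_subgroup)
  have "KP_chain t G P (carrier G)" using assms(1) P p unfolding sylow_KP_group_iff by blast
  then have "KP_chain t G (P \<inter> U) (carrier G \<inter> U)"
    using sylow_KP_solvable[OF assms(1)] fin assms(2) by (intro KP_chain_inter)
  moreover have "carrier G \<inter> U = U" using subgroup.subset[OF assms(2)] by blast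
  ultimately have "KP_chain t G Q U" using P(2) by simp
  moreover have "subgroup Q G" using Q assms(2) by (simp add: sylow_subgroup_def subgroup_update_iff)
  ultimately show "KP_chain t (G\<lparr>carrier := U\<rparr>) Q (carrier (G\<lparr>carrier := U\<rparr>))"
    using KP_chain_update_iff[OF assms(2), of Q U t] by simp
qed

section \<open>Direct and subdirect products\<close>

lemma DirProd_projections:
  assumes "group A" "group B" "finite (carrier A)" "finite (carrier B)"
  shows "finite_epi (A \<times>\<times> B) A fst" "finite_epi (A \<times>\<times> B) B snd"
proof -
  interpret A: group A by fact
  interpret B: group B by fact
  have grp: "group (A \<times>\<times> B)" using assms(1,2) by (rule DirProd_group)
  have fin: "finite (carrier (A \<times>\<times> B))" using assms(3,4) by simp
  have ne: "carrier A \<noteq> {}" "carrier B \<noteq> {}" using A.one_closed B.one_closed by blast+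
  show "finite_epi (A \<times>\<times> B) A fst"
    using ne by (intro finite_epiI[OF grp assms(1) _ fin] homI) (auto simp: mult_DirProd')
  show "finite_epi (A \<times>\<times> B) B snd"
    using ne by (intro finite_epiI[OF grp assms(2) _ fin] homI) (auto simp: mult_DirProd')
qed

text \<open>
  Comparing orders, a Sylow subgroup \<open>S\<close> of \<open>A \<times> B\<close> is the product of its
  projections. Pulling back chains along the projections leads from \<open>S\<close> to the preimage
  \<open>T\<close> of its second projection and from there to the whole group.
\<close>

lemma sylow_KP_DirProd:
  assumes "sylow_KP_group t A" "sylow_KP_group t B"
  shows "sylow_KP_group t (A \<times>\<times> B)"
  unfolding sylow_KP_group_iff
proof (intro conjI allI impI)
  interpret A: group A using assms(1) by (simp add: sylow_KP_group_def)
  interpret B: group B using assms(2) by (simp add: sylow_KP_group_def)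
  have finA: "finite (carrier A)" and finB: "finite (carrier B)"
    using assms by (simp_all add: sylow_KP_group_def)
  let ?D = "A \<times>\<times> B"
  interpret f: finite_epi ?D A fst using A.is_group B.is_group finA finB by (rule DirProd_projections)
  interpret s: finite_epi ?D B snd using A.is_group B.is_group finA finB by (rule DirProd_projections)
  show "group ?D" "finite (carrier ?D)" by (rule f.G.is_group) (rule f.finG)
  fix p S assume p: "prime p" and S: "sylow_subgroup p S ?D"
  have sS: "subgroup S ?D" using S by (simp add: sylow_subgroup_def)
  have SA: "sylow_subgroup p (fst ` S) A" using S p by (rule f.sylow_image)
  have SB: "sylow_subgroup p (snd ` S) B" using S p by (rule s.sylow_image)
  have sA: "subgroup (fst ` S) A" and sB: "subgroup (snd ` S) B"
    using SA SB by (simp_all add: sylow_subgroup_def)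
  have pos: "order A \<noteq> 0" "order B \<noteq> 0"
    using finA finB A.order_gt_0_iff_finite B.order_gt_0_iff_finite by auto
  have "order ?D = order A * order B" by (simp add: order_def card_cartesian_product)
  then have "card S = card (fst ` S) * card (snd ` S)"
    using S SA SB pos p
    by (simp add: sylow_subgroup_def prime_elem_multiplicity_mult_distrib power_add)
  then have "card S = card (fst ` S \<times> snd ` S)" by (simp add: card_cartesian_product)
  moreover have "S \<subseteq> fst ` S \<times> snd ` S" by force
  moreover have "finite (fst ` S \<times> snd ` S)"
    using A.subgroup_finite[OF sA finA] B.subgroup_finite[OF sB finB] by simp
  ultimately have prod: "S = fst ` S \<times> snd ` S" by (metis card_subset_eq)
  define T where "T = s.preim (snd ` S)"
  have T: "subgroup T ?D" unfolding T_def using sB by (rule s.preim_subgroup)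
  have memT: "x \<in> T \<longleftrightarrow> fst x \<in> carrier A \<and> snd x \<in> snd ` S" for x
    using subgroup.subset[OF sB] unfolding T_def by (cases x) auto
  have "KP_chain t B (snd ` S) (carrier B)" using assms(2) p SB unfolding sylow_KP_group_iff by blast
  then have kT: "KP_chain t ?D T (carrier ?D)" unfolding T_def by (rule s.KP_chain_preim_carrier)
  interpret fT: finite_epi "?D\<lparr>carrier := T\<rparr>" A fst
  proof (rule finite_epiI)
    show "group (?D\<lparr>carrier := T\<rparr>)" using T by (rule f.G.subgroup_imp_group)
    show "group A" by (rule A.is_group)
    have "T \<subseteq> carrier ?D" using T by (rule subgroup.subset)
    then show "fst \<in> hom (?D\<lparr>carrier := T\<rparr>) A" by (intro homI) (auto simp: mult_DirProd')
    show "finite (carrier (?D\<lparr>carrier := T\<rparr>))" using f.G.subgroup_finite[OF T f.finG] by simp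
    have "x \<in> fst ` T" if "x \<in> carrier A" for x
    proof -
      have "(x, \<one>\<^bsub>B\<^esub>) \<in> T" using that subgroup.one_closed[OF sB] by (simp add: memT)
      then show ?thesis by force
    qed
    then show "fst ` carrier (?D\<lparr>carrier := T\<rparr>) = carrier A" using memT by auto
  qed
  have "KP_chain t A (fst ` S) (carrier A)" using assms(1) p SA unfolding sylow_KP_group_iff by blast
  then have "KP_chain t (?D\<lparr>carrier := T\<rparr>) (fT.preim (fst ` S)) T" using fT.KP_chain_preim_carrier by fastforce
  moreover have "fT.preim (fst ` S) = S"
  proof -
    have carT: "carrier (?D\<lparr>carrier := T\<rparr>) = T" by simp
    have Times: "{x. fst x \<in> M \<and> snd x \<in> N} = M \<times> N" for M N by auto
    have "fT.preim (fst ` S) = {x. fst x \<in> fst ` S \<and> snd x \<in> snd ` S}"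
      unfolding carT using memT subgroup.subset[OF sA] by blast
    also have "\<dots> = fst ` S \<times> snd ` S" by (rule Times)
    also have "\<dots> = S" by (rule prod[symmetric])
    finally show ?thesis .
  qed
  ultimately have "KP_chain t ?D S T" using f.G.KP_chain_update_iff[OF T sS, of T t] by simp
  then show "KP_chain t ?D S (carrier ?D)" using kT by (rule rtranclp_trans)
qed

text \<open>
  The two epimorphisms embed \<open>G\<close> in the direct product of their images.
\<close>

lemma sylow_KP_subdirect:
  assumes f: "finite_epi G A f" and g: "finite_epi G B g"
    and A: "sylow_KP_group t A" and B: "sylow_KP_group t B"
    and triv: "kernel G A f \<inter> kernel G B g \<subseteq> {\<one>\<^bsub>G\<^esub>}"
  shows "sylow_KP_group t G"
proof -
  interpret f: finite_epi G A f by fact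
  interpret g: finite_epi G B g by fact
  let ?h = "\<lambda>x. (f x, g x)"
  have D: "group (A \<times>\<times> B)" using f.H.is_group g.H.is_group by (rule DirProd_group)
  have hom: "?h \<in> hom G (A \<times>\<times> B)" by (rule homI) simp_all
  interpret h: group_hom G "A \<times>\<times> B" ?h
    using D hom by (simp add: group_hom_def group_hom_axioms_def)
  have sub: "subgroup (?h ` carrier G) (A \<times>\<times> B)" by (rule h.img_is_subgroup)
  let ?U = "(A \<times>\<times> B)\<lparr>carrier := ?h ` carrier G\<rparr>"
  have U: "sylow_KP_group t ?U" using sylow_KP_DirProd[OF A B] sub by (rule sylow_KP_subgroup)
  have epi: "finite_epi G ?U ?h"
  proof (rule finite_epiI)
    show "group ?U" using sub by (rule group.subgroup_imp_group[OF D])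
    show "?h \<in> hom G ?U" by (rule homI) simp_all
    show "?h ` carrier G = carrier ?U" by simp
  qed (simp_all add: f.finG)
  have ker: "kernel G ?U ?h = {\<one>\<^bsub>G\<^esub>}"
  proof -
    have "kernel G ?U ?h = kernel G A f \<inter> kernel G B g" unfolding kernel_def by auto
    moreover have "\<one>\<^bsub>G\<^esub> \<in> kernel G A f \<inter> kernel G B g" by (simp add: kernel_def)
    ultimately show ?thesis using triv by blast
  qed
  show ?thesis using epi U ker by (rule finite_epi.sylow_KP_injective)
qed

lemma sylow_KP_quotient_inter:
  assumes "finite (carrier G)" "N1 \<lhd> G" "N2 \<lhd> G" "sylow_KP_group t (G Mod N1)" "sylow_KP_group t (G Mod N2)"
  shows "sylow_KP_group t (G Mod (N1 \<inter> N2))"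
proof -
  interpret group G using assms(2) by (simp add: normal_def)
  let ?N = "N1 \<inter> N2"
  have N: "?N \<lhd> G" using assms(2,3) by (rule normal_subgroup_intersect)
  note epi = finite_epi_quotient[OF _ assms(1)]
  interpret q: finite_epi G "G Mod ?N" "\<lambda>x. ?N #>\<^bsub>G\<^esub> x" using N by (rule epi)
  obtain e1 where e1: "finite_epi (G Mod ?N) (G Mod N1) e1"
    "\<And>x. x \<in> carrier G \<Longrightarrow> e1 (?N #>\<^bsub>G\<^esub> x) = N1 #>\<^bsub>G\<^esub> x"
    using epi[OF N] epi[OF assms(2)] by (metis finite_epi_factor inf.cobounded1)
  obtain e2 where e2: "finite_epi (G Mod ?N) (G Mod N2) e2"
    "\<And>x. x \<in> carrier G \<Longrightarrow> e2 (?N #>\<^bsub>G\<^esub> x) = N2 #>\<^bsub>G\<^esub> x"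
    using epi[OF N] epi[OF assms(3)] by (metis finite_epi_factor inf.cobounded2)
  have "kernel (G Mod ?N) (G Mod N1) e1 \<inter> kernel (G Mod ?N) (G Mod N2) e2 \<subseteq> {\<one>\<^bsub>G Mod ?N\<^esub>}"
  proof
    fix y assume y: "y \<in> kernel (G Mod ?N) (G Mod N1) e1 \<inter> kernel (G Mod ?N) (G Mod N2) e2"
    then have "y \<in> (\<lambda>x. ?N #>\<^bsub>G\<^esub> x) ` carrier G" unfolding q.surj by (simp add: kernel_def)
    then obtain x where x: "x \<in> carrier G" "y = ?N #>\<^bsub>G\<^esub> x" by (elim imageE)
    have "N1 #>\<^bsub>G\<^esub> x = N1" "N2 #>\<^bsub>G\<^esub> x = N2" using y x e1(2) e2(2) by (simp_all add: kernel_def)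
    then have "x \<in> kernel G (G Mod N1) (\<lambda>x. N1 #>\<^bsub>G\<^esub> x)" "x \<in> kernel G (G Mod N2) (\<lambda>x. N2 #>\<^bsub>G\<^esub> x)"
      using x(1) by (simp_all add: kernel_def)
    then have "x \<in> ?N" using epi(2)[OF assms(2)] epi(2)[OF assms(3)] by simp
    then have "x \<in> kernel G (G Mod ?N) (\<lambda>x. ?N #>\<^bsub>G\<^esub> x)" using epi(2)[OF N] by simp
    then show "y \<in> {\<one>\<^bsub>G Mod ?N\<^esub>}" using x(2) by (simp add: kernel_def)
  qed
  then show ?thesis by (rule sylow_KP_subdirect[OF e1(1) e2(1) assms(4,5)])
qed

lemma sylow_KP_trivial:
  assumes "group G" "carrier G = {\<one>\<^bsub>G\<^esub>}"
  shows "sylow_KP_group t G"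
  unfolding sylow_KP_group_iff
proof (intro conjI allI impI)
  show "group G" by fact
  show "finite (carrier G)" by (subst assms(2)) simp
  fix p P assume "sylow_subgroup p P G"
  then have P: "subgroup P G" by (simp add: sylow_subgroup_def)
  have "P = {\<one>\<^bsub>G\<^esub>}" using subgroup.subset[OF P, unfolded assms(2)] subgroup.one_closed[OF P] by blast
  then show "KP_chain t G P (carrier G)" using assms(2) by simp
qed

lemma sylow_KP_product_group:
  assumes "finite I" "\<And>i. i \<in> I \<Longrightarrow> sylow_KP_group t (K i)"
  shows "sylow_KP_group t (product_group I K)"
  using assms
proof (induction I rule: finite_induct)
  case empty
  show ?case
  proof (rule sylow_KP_trivial)
    show "group (product_group {} K)" by (rule product_group) simp
  qed (simp add: fun_eq_iff)
next
  case (insert i J)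
  have grp: "group (K j)" "finite (carrier (K j))" if "j \<in> insert i J" for j
    using insert.prems[OF that] by (simp_all add: sylow_KP_group_def)
  let ?P = "product_group (insert i J) K"
  let ?D = "K i \<times>\<times> product_group J K"
  let ?h = "\<lambda>x. (x i, restrict x J)"
  have D: "sylow_KP_group t ?D" using insert by (intro sylow_KP_DirProd) auto
  have epi: "finite_epi ?P ?D ?h"
  proof (rule finite_epiI)
    show "group ?P" using grp by (intro product_group) 
    show "group ?D" using grp by (intro DirProd_group product_group) auto
    show "?h \<in> hom ?P ?D" using insert.hyps by (intro homI) (auto simp: fun_eq_iff)
    show "finite (carrier ?P)" using grp insert.hyps by (auto intro!: finite_PiE)
    show "?h ` carrier ?P = carrier ?D"
    proof
      show "?h ` carrier ?P \<subseteq> carrier ?D" by auto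
      show "carrier ?D \<subseteq> ?h ` carrier ?P"
      proof
        fix y assume "y \<in> carrier ?D"
        then obtain a b where y: "y = (a, b)" "a \<in> carrier (K i)" "b \<in> (\<Pi>\<^sub>E j\<in>J. carrier (K j))" by auto
        have "b(i := a) \<in> carrier ?P" using y by (simp add: PiE_fun_upd)
        moreover have "?h (b(i := a)) = y"
          using y insert.hyps(2) by (auto simp: fun_eq_iff restrict_def PiE_def extensional_def)
        ultimately show "y \<in> ?h ` carrier ?P" by (intro image_eqI[where x = "b(i := a)"]) simp_all
      qed
    qed
  qed
  have ker: "kernel ?P ?D ?h = {\<one>\<^bsub>?P\<^esub>}"
  proof
    show "kernel ?P ?D ?h \<subseteq> {\<one>\<^bsub>?P\<^esub>}"
    proof
      fix x assume "x \<in> kernel ?P ?D ?h"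
      then have x: "x \<in> (\<Pi>\<^sub>E j\<in>insert i J. carrier (K j))" "x i = \<one>\<^bsub>K i\<^esub>"
        "restrict x J = (\<lambda>j\<in>J. \<one>\<^bsub>K j\<^esub>)" by (simp_all add: kernel_def)
      have "x j = \<one>\<^bsub>K j\<^esub>" if "j \<in> J" for j
        using fun_cong[OF x(3), of j] that by simp
      then have "x = (\<lambda>j\<in>insert i J. \<one>\<^bsub>K j\<^esub>)"
        using x(2) PiE_arb[OF x(1)] by (auto simp: fun_eq_iff restrict_def)
      then show "x \<in> {\<one>\<^bsub>?P\<^esub>}" by simp
    qed
    show "{\<one>\<^bsub>?P\<^esub>} \<subseteq> kernel ?P ?D ?h"
      using grp by (auto simp: kernel_def group.is_monoid fun_eq_iff)
  qed
  show ?case using epi D ker by (rule finite_epi.sylow_KP_injective)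
qed

section \<open>Simultaneous eigenvectors over a prime field\<close>

abbreviation roots_prod :: "nat \<Rightarrow> int Polynomial.poly" where
  "roots_prod m \<equiv> (\<Prod>a\<in>{1..m}. [:- int a, 1:])"

text \<open>
  The linear factors are split off one root at a time. The remainder of a synthetic
  division of \<open>h\<close> at the next root vanishes modulo \<open>p\<close>, because the factors already
  split off do not vanish there.
\<close>

lemma int_poly_factor_mod_prime:
  fixes f :: "int Polynomial.poly"
  assumes p: "prime p" and "m < p" and "\<And>a. a \<in> {1..m} \<Longrightarrow> int p dvd Polynomial.poly f (int a)"
  shows "\<exists>h g. f = roots_prod m * h + Polynomial.smult (int p) g \<and> Polynomial.degree h \<le> Polynomial.degree f - m"
  using assms(2,3)
proof (induction m)
  case 0
  have "f = roots_prod 0 * f + Polynomial.smult (int p) 0" by simp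
  then show ?case by (intro exI[of _ f] exI[of _ 0]) simp
next
  case (Suc m)
  then obtain h g where hg: "f = roots_prod m * h + Polynomial.smult (int p) g"
    and deg: "Polynomial.degree h \<le> Polynomial.degree f - m" by auto
  let ?a = "int (Suc m)"
  have "int p dvd Polynomial.poly f ?a" using Suc.prems(2)[of "Suc m"] by simp
  moreover have "Polynomial.poly f ?a = (\<Prod>a\<in>{1..m}. ?a - int a) * Polynomial.poly h ?a + int p * Polynomial.poly g ?a"
    unfolding hg by (simp add: poly_prod)
  ultimately have "int p dvd (\<Prod>a\<in>{1..m}. ?a - int a) * Polynomial.poly h ?a"
    by (metis dvd_add_left_iff dvd_triv_left)
  moreover have pp: "prime (int p)" using p by simp
  have "\<not> int p dvd (\<Prod>a\<in>{1..m}. ?a - int a)"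
  proof
    assume "int p dvd (\<Prod>a\<in>{1..m}. ?a - int a)"
    then obtain a where a: "a \<in> {1..m}" "int p dvd ?a - int a"
      using pp by (auto simp: prime_dvd_prod_iff)
    have "0 < ?a - int a" "?a - int a < int p" using a(1) Suc.prems(1) by auto
    then show False using a(2) zdvd_not_zless by blast
  qed
  ultimately have "int p dvd Polynomial.poly h ?a" using pp by (simp add: prime_dvd_mult_iff)
  then obtain c where c: "Polynomial.poly h ?a = int p * c" by (elim dvdE)
  define h' where "h' = synthetic_div h ?a"
  have h: "h = [:- ?a, 1:] * h' + [:int p * c:]"
    unfolding h'_def c[symmetric] by (rule synthetic_div_correct'[symmetric])
  have prod: "roots_prod (Suc m) = roots_prod m * [:- ?a, 1:]" by (simp add: atLeastAtMostSuc_conv mult.commute)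
  have "f = roots_prod m * ([:- ?a, 1:] * h' + [:int p * c:]) + Polynomial.smult (int p) g"
    unfolding h[symmetric] by (rule hg)
  also have "\<dots> = roots_prod (Suc m) * h' + Polynomial.smult (int p) (Polynomial.smult c (roots_prod m) + g)"
    unfolding prod by (simp add: algebra_simps smult_add_right)
  finally have "f = roots_prod (Suc m) * h' + Polynomial.smult (int p) (Polynomial.smult c (roots_prod m) + g)" .
  moreover have "Polynomial.degree h' \<le> Polynomial.degree f - Suc m"
    using deg unfolding h'_def by (simp add: degree_synthetic_div)
  ultimately show ?case by blast
qed

text \<open>
  By Fermat's little theorem the numbers from \<open>1\<close> to \<open>p - 1\<close> are roots of
  \<open>X^(p - 1) - 1\<close> modulo \<open>p\<close>, so the cofactor \<open>h\<close> is a constant \<open>c\<close>. Evaluation at \<open>0\<close>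
  shows that \<open>p\<close> does not divide it.
\<close>

lemma roots_prod_fermat:
  assumes "prime p"
  obtains c g where "Polynomial.monom 1 (p - 1) - 1 = Polynomial.smult c (roots_prod (p - 1)) + Polynomial.smult (int p) g"
    "coprime c (int p)"
proof -
  let ?f = "Polynomial.monom 1 (p - 1) - 1 :: int Polynomial.poly"
  have p1: "p > 1" using assms by (rule prime_gt_1_nat)
  have "int p dvd Polynomial.poly ?f (int a)" if "a \<in> {1..p - 1}" for a
  proof -
    have "\<not> p dvd a" using that p1 by (auto dest: dvd_imp_le)
    then have "[a ^ (p - 1) = 1] (mod p)" using assms by (intro fermat_theorem)
    then have "[int a ^ (p - 1) = 1] (mod int p)" by (metis cong_int_iff of_nat_1 of_nat_power)
    then show ?thesis by (simp add: poly_monom cong_iff_dvd_diff)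
  qed
  then obtain h g where hg: "?f = roots_prod (p - 1) * h + Polynomial.smult (int p) g"
    and deg: "Polynomial.degree h \<le> Polynomial.degree ?f - (p - 1)"
    using int_poly_factor_mod_prime[OF assms, of "p - 1" ?f] p1 by auto
  have "Polynomial.degree ?f \<le> p - 1"
    by (intro degree_diff_le) (auto simp: degree_monom_le)
  then have "Polynomial.degree h = 0" using deg by simp
  then obtain c where c: "h = [:c:]" by (rule degree_eq_zeroE)
  have eq: "?f = Polynomial.smult c (roots_prod (p - 1)) + Polynomial.smult (int p) g"
    using hg unfolding c by simp
  have "Polynomial.poly ?f 0 = - 1" using p1 by (simp add: poly_monom)
  then have "- 1 = c * Polynomial.poly (roots_prod (p - 1)) 0 + int p * Polynomial.poly g 0"
    unfolding eq by simp
  then have "\<not> int p dvd c"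
    by (metis dvd_add dvd_minus_iff dvd_mult2 dvd_triv_left int_dvd_int_iff nat_dvd_1_iff_1 of_nat_1 p1 less_irrefl)
  then have "coprime c (int p)"
    using assms by (metis coprime_commute prime_imp_coprime prime_nat_int_transfer)
  then show thesis using eq by (rule that[rotated])
qed

locale abelian_endo = comm_group W + endo: group_hom W W \<sigma> for W (structure) and \<sigma>
begin

text \<open>
  The endomorphism that results from substituting \<open>\<sigma>\<close> for the variable of an
  integer polynomial, written multiplicatively and evaluated by Horner's rule. The group
  is a module over the integer polynomials in this way.
\<close>

definition act :: "int Polynomial.poly \<Rightarrow> 'a \<Rightarrow> 'a" where
  "act f w = foldr (\<lambda>c u. w [^] c \<otimes> \<sigma> u) (coeffs f) \<one>"

lemma act_0 [simp]: "act 0 w = \<one>" by (simp add: act_def)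

lemma act_pCons [simp]: "w \<in> carrier W \<Longrightarrow> act (pCons a f) w = w [^] a \<otimes> \<sigma> (act f w)"
  by (auto simp: act_def cCons_def)

lemma act_closed [simp]: "w \<in> carrier W \<Longrightarrow> act f w \<in> carrier W"
  by (induction f) simp_all

lemma act_add: "w \<in> carrier W \<Longrightarrow> act (f + g) w = act f w \<otimes> act g w"
proof (induction f arbitrary: g)
  case (pCons a f)
  then show ?case by (cases g) (simp add: int_pow_mult m_ac)
qed simp

lemma act_smult: "w \<in> carrier W \<Longrightarrow> act (Polynomial.smult c f) w = act f w [^] c"
  by (induction f) (simp_all add: int_pow_distrib int_pow_pow endo.hom_int_pow mult.commute)

lemma act_linear_factor:
  assumes "w \<in> carrier W"
  shows "act ([:- a, 1:] * f) w = \<sigma> (act f w) \<otimes> act f w [^] (- a)"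
proof -
  have "[:- a, 1:] * f = Polynomial.smult (- a) f + pCons 0 f" by simp
  then show ?thesis using assms by (simp only: act_add act_smult act_pCons) (simp add: m_comm)
qed

lemma funpow_closed [simp]: "w \<in> carrier W \<Longrightarrow> (\<sigma> ^^ n) w \<in> carrier W"
  by (induction n) simp_all

lemma act_monom: "w \<in> carrier W \<Longrightarrow> act (Polynomial.monom 1 n) w = (\<sigma> ^^ n) w"
  by (induction n) (simp_all add: monom_0 monom_Suc)

text \<open>
  Starting from \<open>w\<close>, apply the endomorphisms \<open>\<sigma> - a\<close> for
  \<open>a = 1, 2, \<dots>, p - 1\<close> in turn. Their product agrees modulo \<open>p\<close> with a multiple of
  \<open>\<sigma>^(p - 1) - 1\<close> and so annihilates \<open>w\<close>; the last nontrivial element on the way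
  is an eigenvector.
\<close>

lemma eigenvector:
  assumes p: "prime p" and w: "w \<in> carrier W" "w \<noteq> \<one>"
    and expo: "\<And>v. v \<in> carrier W \<Longrightarrow> v [^] p = \<one>" and fix_pow: "(\<sigma> ^^ (p - 1)) w = w"
  obtains v and a :: nat where "v \<in> carrier W" "v \<noteq> \<one>" "\<sigma> v = v [^] a"
proof -
  have expo_int: "v [^] int p = \<one>" if "v \<in> carrier W" for v using expo[OF that] by (simp add: int_pow_int)
  let ?u = "\<lambda>m. act (roots_prod m) w"
  obtain c g where cg: "Polynomial.monom 1 (p - 1) - 1
      = Polynomial.smult c (roots_prod (p - 1)) + Polynomial.smult (int p) g" "coprime c (int p)"
    using p by (rule roots_prod_fermat)
  have "Polynomial.smult (- 1) 1 = - (1 :: int Polynomial.poly)" by (simp add: one_pCons)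
  then have "Polynomial.monom 1 (p - 1) + Polynomial.smult (- 1) 1
      = Polynomial.smult c (roots_prod (p - 1)) + Polynomial.smult (int p) g"
    using cg(1) by (simp only: diff_conv_add_uminus)
  then have "act (Polynomial.monom 1 (p - 1) + Polynomial.smult (- 1) 1) w
      = act (Polynomial.smult c (roots_prod (p - 1)) + Polynomial.smult (int p) g) w"
    by (rule arg_cong)
  then have "w \<otimes> act 1 w [^] (- 1 :: int) = ?u (p - 1) [^] c"
    using w(1) by (simp only: act_add act_smult act_monom fix_pow expo_int act_closed r_one int_pow_closed)
  moreover have "act 1 w = w" using w(1) by (simp add: one_pCons)
  ultimately have uc: "?u (p - 1) [^] c = \<one>" using w(1) by (simp add: int_pow_neg)
  have u: "?u (p - 1) \<in> carrier W" using w(1) by simp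
  obtain x y where "x * c + y * int p = 1" using cg(2) by (metis coprime_iff_gcd_eq_1 bezout_int)
  then have "?u (p - 1) = ?u (p - 1) [^] (x * c + y * int p)" using u by simp
  also have "\<dots> = (?u (p - 1) [^] c) [^] x \<otimes> (?u (p - 1) [^] int p) [^] y"
    using u by (simp add: int_pow_mult[symmetric] int_pow_pow mult.commute)
  also have "\<dots> = \<one>" using uc expo_int[OF u] by simp
  finally have last: "?u (p - 1) = \<one>" .
  define m where "m = (LEAST m. ?u m = \<one>)"
  have m: "?u m = \<one>" unfolding m_def using last by (rule LeastI)
  have "?u 0 \<noteq> \<one>" using w by (simp add: one_pCons)
  then obtain n where n: "m = Suc n" using m by (cases m) auto
  have un: "?u n \<noteq> \<one>" using not_less_Least[of n "\<lambda>m. ?u m = \<one>"] n unfolding m_def by auto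
  have "roots_prod m = [:- int m, 1:] * roots_prod n" unfolding n by (simp add: atLeastAtMostSuc_conv mult.commute)
  then have "\<sigma> (?u n) \<otimes> ?u n [^] (- int m) = \<one>" using m act_linear_factor[OF w(1), of "int m" "roots_prod n"] by simp
  then have "\<sigma> (?u n) \<otimes> inv (?u n [^] int m) = \<one>" using w(1) by (simp add: int_pow_neg)
  then have "\<sigma> (?u n) = ?u n [^] int m" using w(1) by (metis act_closed endo.hom_closed int_pow_closed inv_closed inv_equality inv_inv)
  then show thesis using un w(1) by (intro that[of "?u n" m]) (simp_all add: int_pow_int)
qed

end

text \<open>
  As \<open>Q\<close> is abelian, the eigenspaces of one of its elements are invariant under all the
  others, so the elements can be treated one after another.
\<close>

lemma (in group) common_eigenspace:
  fixes p :: nat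
  assumes V: "subgroup V G" "V \<noteq> {\<one>}" and comm: "\<And>v w. v \<in> V \<Longrightarrow> w \<in> V \<Longrightarrow> v \<otimes> w = w \<otimes> v"
    and expo: "\<And>v. v \<in> V \<Longrightarrow> v [^] p = \<one>" and p: "prime p"
    and Q: "subgroup Q G" and Qcomm: "\<And>x y. x \<in> Q \<Longrightarrow> y \<in> Q \<Longrightarrow> x \<otimes> y = y \<otimes> x"
    and Qexpo: "\<And>x. x \<in> Q \<Longrightarrow> x [^] (p - 1) = \<one>"
    and QV: "\<And>x v. x \<in> Q \<Longrightarrow> v \<in> V \<Longrightarrow> x \<otimes> v \<otimes> inv x \<in> V"
    and F: "finite F" "F \<subseteq> Q"
  shows "\<exists>W. subgroup W G \<and> W \<subseteq> V \<and> W \<noteq> {\<one>} \<and> (\<forall>x\<in>Q. \<forall>w\<in>W. x \<otimes> w \<otimes> inv x \<in> W) \<and>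
     (\<forall>x\<in>F. \<exists>a::nat. \<forall>w\<in>W. x \<otimes> w \<otimes> inv x = w [^] a)"
  using F
proof (induction F rule: finite_induct)
  case empty
  then show ?case using V QV by blast
next
  case (insert x F)
  have "F \<subseteq> Q" using insert.prems by simp
  from insert.IH[OF this] obtain W where W: "subgroup W G" "W \<subseteq> V" "W \<noteq> {\<one>}"
    and QW: "\<And>y w. y \<in> Q \<Longrightarrow> w \<in> W \<Longrightarrow> y \<otimes> w \<otimes> inv y \<in> W"
    and FW: "\<And>y. y \<in> F \<Longrightarrow> \<exists>a::nat. \<forall>w\<in>W. y \<otimes> w \<otimes> inv y = w [^] a" by blast
  have x: "x \<in> Q" using insert.prems by simp
  have Qc: "y \<in> carrier G" if "y \<in> Q" for y using that Q subgroup.mem_carrier by metis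
  have Wc: "w \<in> carrier G" if "w \<in> W" for w using that W(1) subgroup.mem_carrier by metis
  have xc: "x \<in> carrier G" using x by (rule Qc)
  let ?W = "G\<lparr>carrier := W\<rparr>" and ?s = "\<lambda>w. x \<otimes> w \<otimes> inv x"
  have grpW: "group ?W" using W(1) by (rule subgroup_imp_group)
  have "comm_group ?W"
  proof (rule group.group_comm_groupI[OF grpW])
    show "a \<otimes>\<^bsub>?W\<^esub> b = b \<otimes>\<^bsub>?W\<^esub> a" if "a \<in> carrier ?W" "b \<in> carrier ?W" for a b
      using comm[of a b] that W(2) by auto
  qed
  moreover have "?s \<in> hom ?W ?W"
  proof (rule homI)
    show "?s w \<in> carrier ?W" if "w \<in> carrier ?W" for w using QW[OF x] that by simp
    show "?s (v \<otimes>\<^bsub>?W\<^esub> w) = ?s v \<otimes>\<^bsub>?W\<^esub> ?s w" if "v \<in> carrier ?W" "w \<in> carrier ?W" for v w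
      using xc Wc[of v] Wc[of w] that by (simp add: m_assoc inv_mult_cancel)
  qed
  ultimately interpret E: abelian_endo ?W ?s
    using grpW by (simp add: abelian_endo_def group_hom_def group_hom_axioms_def)
  have pow: "v [^]\<^bsub>?W\<^esub> n = v [^] n" for v and n :: nat by (rule nat_pow_consistent[symmetric])
  have iter: "(?s ^^ n) w = (x [^] n) \<otimes> w \<otimes> inv (x [^] n)" if w: "w \<in> W" for w n
  proof (induction n)
    case (Suc n)
    have "(?s ^^ Suc n) w = x \<otimes> ((x [^] n) \<otimes> w \<otimes> inv (x [^] n)) \<otimes> inv x" using Suc by simp
    also have "\<dots> = (x [^] Suc n) \<otimes> w \<otimes> inv (x [^] Suc n)"
      unfolding nat_pow_Suc2[OF xc, of n] using xc Wc[OF w] by (simp add: m_assoc inv_mult_group)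
    finally show ?case .
  qed (use Wc[OF w] in simp)
  obtain w where w: "w \<in> W" "w \<noteq> \<one>" using W(1,3) subgroup.one_closed by blast
  obtain v and a :: nat where v: "v \<in> W" "v \<noteq> \<one>" "?s v = v [^] a"
  proof (rule E.eigenvector[OF p])
    show "w \<in> carrier ?W" "w \<noteq> \<one>\<^bsub>?W\<^esub>" using w by simp_all
    show "u [^]\<^bsub>?W\<^esub> p = \<one>\<^bsub>?W\<^esub>" if "u \<in> carrier ?W" for u
      using that W(2) expo by (auto simp: pow)
    show "(?s ^^ (p - 1)) w = w" unfolding iter[OF w(1)] Qexpo[OF x] using Wc[OF w(1)] by simp
  qed (auto simp: pow)
  \<comment> \<open>The eigenspace of \<open>x\<close> in \<open>W\<close> for the eigenvalue \<open>a\<close>.\<close>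
  define U where "U = {u \<in> W. ?s u = u [^] a}"
  have Uc: "u \<in> W" "?s u = u [^] a" if "u \<in> U" for u using that by (simp_all add: U_def)
  have UI: "u \<in> U" if "u \<in> W" "?s u = u [^] a" for u using that by (simp add: U_def)
  have sU: "subgroup U G"
  proof (rule subgroupI)
    show "U \<subseteq> carrier G" using Uc(1) Wc by blast
    show "U \<noteq> {}" using v UI by blast
    fix b assume b: "b \<in> U"
    have bc: "b \<in> carrier G" using Uc(1)[OF b] by (rule Wc)
    show "inv b \<in> U"
    proof (rule UI)
      show "inv b \<in> W" using Uc(1)[OF b] W(1) by (simp add: subgroup.m_inv_closed)
      have "?s (inv b) = inv (?s b)" using xc bc by (simp add: inv_mult_group m_assoc)
      then show "?s (inv b) = inv b [^] a" using Uc(2)[OF b] bc by (simp add: nat_pow_inv)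
    qed
    fix d assume d: "d \<in> U"
    have dc: "d \<in> carrier G" using Uc(1)[OF d] by (rule Wc)
    show "b \<otimes> d \<in> U"
    proof (rule UI)
      show "b \<otimes> d \<in> W" using Uc(1)[OF b] Uc(1)[OF d] by (rule subgroup.m_closed[OF W(1)])
      have "?s (b \<otimes> d) = ?s b \<otimes> ?s d" using xc bc dc by (simp add: m_assoc inv_mult_cancel)
      also have "\<dots> = b [^] a \<otimes> d [^] a" by (simp only: Uc(2)[OF b] Uc(2)[OF d])
      also have "\<dots> = (b \<otimes> d) [^] a"
      proof (rule pow_mult_distrib[symmetric])
        show "b \<otimes> d = d \<otimes> b" using comm[of b d] Uc(1)[OF b] Uc(1)[OF d] W(2) by blast
      qed fact+
      finally show "?s (b \<otimes> d) = (b \<otimes> d) [^] a" .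
    qed
  qed
  show ?case
  proof (intro exI[of _ U] conjI ballI)
    show "subgroup U G" by (rule sU)
    show "U \<subseteq> V" using Uc(1) W(2) by blast
    show "U \<noteq> {\<one>}" using v UI by blast
    show "y \<otimes> u \<otimes> inv y \<in> U" if y: "y \<in> Q" and u: "u \<in> U" for y u
    proof (rule UI)
      have uc: "u \<in> carrier G" and yc: "y \<in> carrier G" using Uc(1)[OF u] Wc Qc[OF y] by blast+
      show "y \<otimes> u \<otimes> inv y \<in> W" using y Uc(1)[OF u] by (rule QW)
      have "?s (y \<otimes> u \<otimes> inv y) = (x \<otimes> y) \<otimes> u \<otimes> inv (x \<otimes> y)"
        using xc yc uc by (simp add: m_assoc inv_mult_group)
      also have "\<dots> = (y \<otimes> x) \<otimes> u \<otimes> inv (y \<otimes> x)" using Qcomm[OF x y] by simp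
      also have "\<dots> = y \<otimes> ?s u \<otimes> inv y" using xc yc uc by (simp add: m_assoc inv_mult_group)
      also have "\<dots> = (y \<otimes> u \<otimes> inv y) [^] a" unfolding Uc(2)[OF u] using yc uc by (rule conj_pow)
      finally show "?s (y \<otimes> u \<otimes> inv y) = (y \<otimes> u \<otimes> inv y) [^] a" .
    qed
    show "\<exists>a::nat. \<forall>w\<in>U. y \<otimes> w \<otimes> inv y = w [^] a" if y: "y \<in> insert x F" for y
    proof (cases "y = x")
      case True
      then show ?thesis using Uc(2) by blast
    next
      case False
      then obtain b :: nat where "\<forall>w\<in>W. y \<otimes> w \<otimes> inv y = w [^] b" using FW[of y] y by blast
      then show ?thesis using Uc(1) by blast
    qed
  qed
qed

text \<open>
  The elements of order dividing \<open>p\<close> in the centre of \<open>P\<close> form a nontrivial elementary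
  abelian group on which \<open>Q\<close> acts. A common eigenvector \<open>w\<close> of \<open>Q\<close> spans a subgroup of
  order \<open>p\<close> that is normalised by \<open>Q\<close> and centralised by \<open>P\<close>, hence normal in \<open>G = P Q\<close>.
\<close>

lemma (in group) normal_eigenline:
  assumes fin: "finite (carrier G)" and P: "P \<lhd> G" and cP: "card P = p ^ Suc k" and p: "prime p"
    and sQ: "subgroup Q G" and comm: "\<And>x y. x \<in> Q \<Longrightarrow> y \<in> Q \<Longrightarrow> x \<otimes> y = y \<otimes> x"
    and expo: "\<And>x. x \<in> Q \<Longrightarrow> x [^] (p - 1) = \<one>"
    and cover: "\<And>g. g \<in> carrier G \<Longrightarrow> \<exists>y\<in>P. \<exists>x\<in>Q. g = y \<otimes> x"
  obtains D where "D \<lhd> G" "card D = p" "D \<subseteq> P" "\<And>d. d \<in> D \<Longrightarrow> d [^] p = \<one>"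
proof -
  have sP: "subgroup P G" using P by (rule normal_imp_subgroup)
  have Pc: "y \<in> carrier G" if "y \<in> P" for y using that sP subgroup.mem_carrier by metis
  have Qc: "y \<in> carrier G" if "y \<in> Q" for y using that sQ subgroup.mem_carrier by metis
  interpret P: group "G\<lparr>carrier := P\<rparr>" using sP by (rule subgroup_imp_group)
  have Ppow: "u [^] (p ^ Suc k) = \<one>" if "u \<in> P" for u
    using P.pow_order_eq_1[of u] that cP by (simp add: nat_pow_consistent[symmetric])
  define V where "V = {v \<in> P. v [^] p = \<one> \<and> (\<forall>y\<in>P. y \<otimes> v = v \<otimes> y)}"
  have Vd: "v \<in> P" "v [^] p = \<one>" "y \<in> P \<Longrightarrow> y \<otimes> v = v \<otimes> y" if "v \<in> V" for v y
    using that unfolding V_def by blast+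
  have VI: "v \<in> V" if "v \<in> P" "v [^] p = \<one>" "\<And>y. y \<in> P \<Longrightarrow> y \<otimes> v = v \<otimes> y" for v
    using that unfolding V_def by blast
  have sV: "subgroup V G"
  proof (rule subgroupI)
    show "V \<subseteq> carrier G" using Vd(1) Pc by blast
    have "\<one> \<in> V" using subgroup.one_closed[OF sP] Pc by (intro VI) simp_all
    then show "V \<noteq> {}" by blast
    fix a assume a: "a \<in> V"
    have ac: "a \<in> carrier G" using Vd(1)[OF a] by (rule Pc)
    show "inv a \<in> V"
    proof (rule VI)
      show "inv a \<in> P" using Vd(1)[OF a] sP by (simp add: subgroup.m_inv_closed)
      show "inv a [^] p = \<one>" using ac Vd(2)[OF a] by (simp add: nat_pow_inv)
      fix y assume y: "y \<in> P"
      have "inv a \<otimes> (a \<otimes> y) \<otimes> inv a = inv a \<otimes> (y \<otimes> a) \<otimes> inv a"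
        using Vd(3)[OF a y] by simp
      then show "y \<otimes> inv a = inv a \<otimes> y" using ac Pc[OF y] by (simp add: m_assoc inv_mult_cancel)
    qed
    fix b assume b: "b \<in> V"
    have bc: "b \<in> carrier G" using Vd(1)[OF b] by (rule Pc)
    show "a \<otimes> b \<in> V"
    proof (rule VI)
      show "a \<otimes> b \<in> P" using Vd(1)[OF a] Vd(1)[OF b] by (rule subgroup.m_closed[OF sP])
      have "a \<otimes> b = b \<otimes> a" using Vd(3)[OF b Vd(1)[OF a]] .
      then show "(a \<otimes> b) [^] p = \<one>"
        using Vd(2)[OF a] Vd(2)[OF b] ac bc pow_mult_distrib[of a b p] by simp
      fix y assume y: "y \<in> P"
      have yc: "y \<in> carrier G" using y by (rule Pc)
      have "y \<otimes> (a \<otimes> b) = (y \<otimes> a) \<otimes> b" using ac bc yc by (simp add: m_assoc)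
      also have "\<dots> = a \<otimes> (y \<otimes> b)" unfolding Vd(3)[OF a y] using ac bc yc by (simp add: m_assoc)
      also have "\<dots> = a \<otimes> b \<otimes> y" unfolding Vd(3)[OF b y] using ac bc yc by (simp add: m_assoc)
      finally show "y \<otimes> (a \<otimes> b) = a \<otimes> b \<otimes> y" .
    qed
  qed
  have "p dvd card P" using cP by simp
  then obtain u where u: "u \<in> P" "u \<noteq> \<one>" "\<And>y. y \<in> P \<Longrightarrow> y \<otimes> u = u \<otimes> y"
    by (rule p_subgroup_centralises[OF sP cP p sP _ _ fin])
       (use sP in \<open>auto simp: subgroup.m_closed subgroup.m_inv_closed\<close>)
  have uc: "u \<in> carrier G" using u(1) by (rule Pc)
  \<comment> \<open>The last nontrivial element among the iterated \<open>p\<close>th powers of \<open>u\<close> has order \<open>p\<close>.\<close>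
  define n where "n = (LEAST n. u [^] (p ^ n) = \<one>)"
  have n: "u [^] (p ^ n) = \<one>" unfolding n_def using Ppow[OF u(1)] by (rule LeastI)
  then have "n \<noteq> 0" using u(2) uc by (cases n) auto
  then obtain m where m: "n = Suc m" by (cases n) auto
  define v where "v = u [^] (p ^ m)"
  have v1: "v \<noteq> \<one>" using not_less_Least[of m "\<lambda>n. u [^] (p ^ n) = \<one>"] m unfolding n_def v_def by auto
  have "v \<in> V"
  proof (rule VI)
    have "u [^]\<^bsub>G\<lparr>carrier := P\<rparr>\<^esub> (p ^ m) \<in> carrier (G\<lparr>carrier := P\<rparr>)" using u(1) by (intro P.nat_pow_closed) simp
    then show "v \<in> P" unfolding v_def by (simp add: nat_pow_consistent[symmetric])
    have "v [^] p = u [^] (p ^ n)" unfolding v_def m using uc by (simp add: nat_pow_pow mult.commute)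
    then show "v [^] p = \<one>" using n by simp
    fix y assume y: "y \<in> P"
    have "u \<otimes> y = y \<otimes> u" using u(3)[OF y] by simp
    then show "y \<otimes> v = v \<otimes> y" unfolding v_def using uc Pc[OF y] by (intro group_commutes_pow[symmetric])
  qed
  then have V1: "V \<noteq> {\<one>}" using v1 by blast
  have Vcomm: "a \<otimes> b = b \<otimes> a" if "a \<in> V" "b \<in> V" for a b
    using Vd(3)[OF that(2) Vd(1)[OF that(1)]] .
  have QV: "x \<otimes> w \<otimes> inv x \<in> V" if x: "x \<in> Q" and w: "w \<in> V" for x w
  proof (rule VI)
    have xc: "x \<in> carrier G" and wc: "w \<in> carrier G" using x w Vd(1) Pc Qc by blast+
    show "x \<otimes> w \<otimes> inv x \<in> P" using P xc Vd(1)[OF w] by (rule normal.inv_op_closed2)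
    show "(x \<otimes> w \<otimes> inv x) [^] p = \<one>"
      unfolding conj_pow[OF xc wc, symmetric] Vd(2)[OF w] using xc by simp
    fix y assume y: "y \<in> P"
    have yc: "y \<in> carrier G" using y by (rule Pc)
    define z where "z = inv x \<otimes> y \<otimes> x"
    have z: "z \<in> P" unfolding z_def using P xc y by (rule normal.inv_op_closed1)
    have zc: "z \<in> carrier G" using z by (rule Pc)
    have yz: "y = x \<otimes> z \<otimes> inv x" unfolding z_def using xc yc by (simp add: m_assoc inv_mult_cancel)
    have "y \<otimes> (x \<otimes> w \<otimes> inv x) = x \<otimes> (z \<otimes> w) \<otimes> inv x"
      unfolding yz using xc wc zc by (simp add: m_assoc inv_mult_cancel)
    also have "\<dots> = x \<otimes> (w \<otimes> z) \<otimes> inv x" using Vd(3)[OF w z] by simp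
    also have "\<dots> = x \<otimes> w \<otimes> inv x \<otimes> y"
      unfolding yz using xc wc zc by (simp add: m_assoc inv_mult_cancel)
    finally show "y \<otimes> (x \<otimes> w \<otimes> inv x) = x \<otimes> w \<otimes> inv x \<otimes> y" .
  qed
  obtain W where W: "subgroup W G" "W \<subseteq> V" "W \<noteq> {\<one>}"
    and eig: "\<And>x. x \<in> Q \<Longrightarrow> \<exists>a::nat. \<forall>w\<in>W. x \<otimes> w \<otimes> inv x = w [^] a"
    using common_eigenspace[OF sV V1 Vcomm Vd(2) p sQ comm expo QV subgroup_finite[OF sQ fin] order_refl] by blast
  obtain w where w: "w \<in> W" "w \<noteq> \<one>" using W(1,3) subgroup.one_closed by blast
  have wV: "w \<in> V" using w(1) W(2) by blast
  have wc: "w \<in> carrier G" using Vd(1)[OF wV] by (rule Pc)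
  define D where "D = generate G {w}"
  have sD: "subgroup D G" unfolding D_def using wc by (intro generate_is_subgroup) simp
  have Dpow: "\<exists>i::nat. d = w [^] i" if "d \<in> D" for d
    using that generate_pow_on_finite_carrier[OF fin wc] unfolding D_def by auto
  have powD: "w [^] (i::nat) \<in> D" for i
    using generate_pow_on_finite_carrier[OF fin wc] unfolding D_def by auto
  have DP: "D \<subseteq> P" unfolding D_def using Vd(1)[OF wV] by (intro generate_subgroup_incl[OF _ sP]) simp
  have "ord w dvd p" using Vd(2)[OF wV] wc by (simp add: pow_eq_id)
  moreover have "ord w \<noteq> 1" using w(2) wc ord_eq_1 by blast
  ultimately have "ord w = p" using p by (auto simp: prime_nat_iff)
  then have cD: "card D = p" unfolding D_def using generate_pow_card[OF wc] by simp
  have nD: "D \<lhd> G"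
  proof (rule normal_invI[OF sD])
    fix g d assume g: "g \<in> carrier G" and d: "d \<in> D"
    obtain i :: nat where i: "d = w [^] i" using Dpow[OF d] by blast
    obtain y x where yx: "y \<in> P" "x \<in> Q" "g = y \<otimes> x" using cover[OF g] by blast
    obtain a :: nat where a: "x \<otimes> w \<otimes> inv x = w [^] a" using eig[OF yx(2)] w(1) by blast
    have yc: "y \<in> carrier G" and xc: "x \<in> carrier G" using yx Pc Qc by blast+
    have "y \<otimes> w = w \<otimes> y" using Vd(3)[OF wV yx(1)] .
    then have ywa: "w [^] a \<otimes> y = y \<otimes> w [^] a" using wc yc by (intro group_commutes_pow) simp_all
    have "g \<otimes> w \<otimes> inv g = y \<otimes> (x \<otimes> w \<otimes> inv x) \<otimes> inv y"
      unfolding yx(3) using yc xc wc by (simp add: m_assoc inv_mult_group)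
    also have "\<dots> = w [^] a" unfolding a ywa[symmetric] using yc wc by (simp add: m_assoc)
    finally have "g \<otimes> d \<otimes> inv g = (w [^] a) [^] i" unfolding i conj_pow[OF g wc] by simp
    then show "g \<otimes> d \<otimes> inv g \<in> D" using powD wc by (simp add: nat_pow_pow)
  qed
  show thesis
  proof (rule that[OF nD cD DP])
    fix d assume "d \<in> D"
    then obtain i :: nat where i: "d = w [^] i" using Dpow by blast
    have "d [^] p = (w [^] p) [^] i" unfolding i using wc by (simp add: nat_pow_pow mult.commute)
    then show "d [^] p = \<one>" using Vd(2)[OF wV] by simp
  qed
qed

text \<open>
  Induction on the order of \<open>P\<close>: after factoring out a normal subgroup \<open>D\<close> of order \<open>p\<close>,
  the chain for the quotient pulls back to one from \<open>Q D\<close> to \<open>G\<close>. The exponents \<open>p\<close> of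
  \<open>D\<close> and \<open>p - 1\<close> of \<open>Q\<close> are coprime, so \<open>Q\<close> has index \<open>p\<close> in \<open>Q D\<close>.
\<close>

lemma KP_chain_abelian_complement:
  fixes G :: "nat monoid"
  assumes "group G" "finite (carrier G)" "P \<lhd> G" "card P = p ^ k" "prime p" "power_free t (p - 1)"
    and "subgroup Q G" "\<And>x y. x \<in> Q \<Longrightarrow> y \<in> Q \<Longrightarrow> x \<otimes>\<^bsub>G\<^esub> y = y \<otimes>\<^bsub>G\<^esub> x"
    and "\<And>x. x \<in> Q \<Longrightarrow> x [^]\<^bsub>G\<^esub> (p - 1) = \<one>\<^bsub>G\<^esub>"
    and "\<And>g. g \<in> carrier G \<Longrightarrow> \<exists>y\<in>P. \<exists>x\<in>Q. g = y \<otimes>\<^bsub>G\<^esub> x"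
  shows "KP_chain t G Q (carrier G)"
  using assms
proof (induction k arbitrary: G P Q)
  case (0 G P Q)
  interpret group G by fact
  have sP: "subgroup P G" using "0.prems"(3) by (rule normal_imp_subgroup)
  have "card P = 1" using "0.prems"(4) by simp
  then have P1: "P = {\<one>\<^bsub>G\<^esub>}" using subgroup.one_closed[OF sP] by (auto simp: card_1_singleton_iff)
  have Qc: "Q \<subseteq> carrier G" using "0.prems"(7) by (rule subgroup.subset)
  have "carrier G \<subseteq> Q"
  proof
    fix g assume "g \<in> carrier G"
    then obtain x where "x \<in> Q" "g = \<one>\<^bsub>G\<^esub> \<otimes>\<^bsub>G\<^esub> x" using "0.prems"(10) P1 by blast
    then show "g \<in> Q" using Qc by auto
  qed
  then have "Q = carrier G" using Qc by blast
  then show ?case by simp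
next
  case (Suc k G P Q)
  note comm = Suc.prems(8) and expo = Suc.prems(9) and cover = Suc.prems(10)
  interpret group G by fact
  have fin: "finite (carrier G)" by fact
  have p: "prime p" by fact
  have sP: "subgroup P G" using Suc.prems(3) by (rule normal_imp_subgroup)
  have sQ: "subgroup Q G" by fact
  have Pc: "y \<in> carrier G" if "y \<in> P" for y using that sP subgroup.mem_carrier by metis
  have Qc: "y \<in> carrier G" if "y \<in> Q" for y using that sQ subgroup.mem_carrier by metis
  obtain D where nD: "D \<lhd> G" and cD: "card D = p" and DP: "D \<subseteq> P"
    and Dp: "\<And>d. d \<in> D \<Longrightarrow> d [^]\<^bsub>G\<^esub> p = \<one>\<^bsub>G\<^esub>"
    by (rule normal_eigenline[OF fin Suc.prems(3,4) p sQ comm expo cover]) blast+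
  have sD: "subgroup D G" using nD by (rule normal_imp_subgroup)
  obtain K :: "nat monoid" and f where f: "finite_epi G K f" "kernel G K f = D"
    using nD fin by (rule nat_quotient)
  interpret f: finite_epi G K f by fact
  have "KP_chain t K (f ` Q) (carrier K)"
  proof (rule Suc.IH[of K "f ` P" "f ` Q"])
    show "group K" "finite (carrier K)" by (rule f.H.is_group) (rule f.finH)
    show "f ` P \<lhd> K" using Suc.prems(3) by (rule f.image_normal)
    have "f.ker \<inter> P = D" using f(2) DP by blast
    then have "p ^ Suc k = p * card (f ` P)" using f.card_hom_image[OF sP fin] Suc.prems(4) cD by simp
    then show "card (f ` P) = p ^ k" using p by (simp add: prime_gt_0_nat)
    show "prime p" "power_free t (p - 1)" by fact+
    show "subgroup (f ` Q) K" using sQ by (rule f.image_subgroup)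
    show "x \<otimes>\<^bsub>K\<^esub> y = y \<otimes>\<^bsub>K\<^esub> x" if x: "x \<in> f ` Q" and y: "y \<in> f ` Q" for x y
    proof -
      obtain a b where ab: "a \<in> Q" "b \<in> Q" "x = f a" "y = f b" using x y by blast
      then show ?thesis using Qc comm[OF ab(1,2)] by (metis f.hom_mult)
    qed
    show "x [^]\<^bsub>K\<^esub> (p - 1) = \<one>\<^bsub>K\<^esub>" if x: "x \<in> f ` Q" for x
    proof -
      obtain a where a: "a \<in> Q" "x = f a" using x by blast
      then have "x [^]\<^bsub>K\<^esub> (p - 1) = f (a [^]\<^bsub>G\<^esub> (p - 1))" using Qc by (simp add: f.hom_nat_pow)
      then show ?thesis using expo[OF a(1)] by simp
    qed
    show "\<exists>y\<in>f ` P. \<exists>x\<in>f ` Q. g = y \<otimes>\<^bsub>K\<^esub> x" if g: "g \<in> carrier K" for g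
    proof -
      obtain g' where g': "g' \<in> carrier G" "g = f g'" using g f.surj by blast
      obtain y x where yx: "y \<in> P" "x \<in> Q" "g' = y \<otimes>\<^bsub>G\<^esub> x" using cover[OF g'(1)] by blast
      then have "g = f y \<otimes>\<^bsub>K\<^esub> f x" using g' Pc Qc by simp
      then show ?thesis using yx by blast
    qed
  qed
  then have kp: "KP_chain t G (f.preim (f ` Q)) (carrier G)" by (rule f.KP_chain_preim_carrier)
  have DQ: "f.ker \<inter> Q = {\<one>\<^bsub>G\<^esub>}"
  proof -
    have "d = \<one>\<^bsub>G\<^esub>" if d: "d \<in> D" "d \<in> Q" for d
    proof -
      have dc: "d \<in> carrier G" using d(2) by (rule Qc)
      have "d [^]\<^bsub>G\<^esub> Suc (p - 1) = \<one>\<^bsub>G\<^esub>" using Dp[OF d(1)] p by (simp add: prime_gt_0_nat del: nat_pow_Suc)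
      then show ?thesis using expo[OF d(2)] dc by simp
    qed
    then show ?thesis using f(2) subgroup.one_closed[OF sD] subgroup.one_closed[OF sQ] by blast
  qed
  have imQ: "subgroup (f ` Q) K" using sQ by (rule f.image_subgroup)
  have "card Q = card (f ` Q)" using f.card_hom_image[OF sQ fin] DQ by simp
  then have "card (f.preim (f ` Q)) = p * card Q" using f.card_preim[OF imQ] f(2) cD by simp
  then have "KP_link t G Q (f.preim (f ` Q))"
  proof (intro KP_link_indexI[of _ _ p])
    show "Q \<subseteq> f.preim (f ` Q)" using Qc by blast
  qed (use sQ imQ f.preim_subgroup p Suc.prems(6) in auto)
  then show ?case using kp by (rule converse_rtranclp_into_rtranclp)
qed

section \<open>The Frattini subgroup\<close>

lemma (in group) normaliser_subgroup:
  assumes "S \<subseteq> carrier G" "finite (carrier G)"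
  shows "subgroup {x \<in> carrier G. \<forall>s\<in>S. x \<otimes> s \<otimes> inv x \<in> S} G" (is "subgroup ?M G")
proof (rule subgroupI)
  have Sc: "s \<in> carrier G" if "s \<in> S" for s using that assms(1) by blast
  show "?M \<subseteq> carrier G" by blast
  have "\<one> \<in> ?M" using Sc by simp
  then show "?M \<noteq> {}" by blast
  have mult: "a \<otimes> b \<in> ?M" if a: "a \<in> ?M" and b: "b \<in> ?M" for a b
  proof -
    have "a \<otimes> b \<otimes> s \<otimes> inv (a \<otimes> b) \<in> S" if s: "s \<in> S" for s
    proof -
      have "a \<otimes> (b \<otimes> s \<otimes> inv b) \<otimes> inv a \<in> S" using a b s by blast
      then show ?thesis using a b Sc[OF s] by (simp add: m_assoc inv_mult_group)
    qed
    then show ?thesis using a b by simp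
  qed
  show "a \<otimes> b \<in> ?M" if "a \<in> ?M" "b \<in> ?M" for a b using that by (rule mult)
  show "inv a \<in> ?M" if a: "a \<in> ?M" for a
  proof -
    have ac: "a \<in> carrier G" using a by blast
    \<comment> \<open>The inverse of \<open>a\<close> is a power of \<open>a\<close>.\<close>
    have "a [^] n \<in> ?M" for n :: nat
    proof (induction n)
      case 0
      then show ?case using \<open>\<one> \<in> ?M\<close> by simp
    next
      case (Suc n)
      then show ?case using mult[OF Suc a] by simp
    qed
    then have "a [^] (order G - 1) \<in> ?M" .
    moreover have "Suc (order G - 1) = order G" using assms(2) order_gt_0_iff_finite by simp
    then have "a [^] (order G - 1) \<otimes> a = \<one>" using pow_order_eq_1[OF ac] by (metis nat_pow_Suc)
    then have "a [^] (order G - 1) = inv a" using ac by (simp add: inv_equality)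
    ultimately show ?thesis by simp
  qed
qed

lemma (in finite_epi) maximal_preim:
  assumes M: "maximal_subgroup M H"
  shows "maximal_subgroup (preim M) G"
  unfolding maximal_subgroup_def
proof (intro conjI allI impI)
  have sM: "subgroup M H" and ne: "M \<noteq> carrier H"
    and max: "\<And>L. subgroup L H \<Longrightarrow> M \<subseteq> L \<Longrightarrow> L = M \<or> L = carrier H"
    using M unfolding maximal_subgroup_def by blast+
  show "subgroup (preim M) G" using sM by (rule preim_subgroup)
  have im: "h ` preim M = M" using subgroup.subset[OF sM] by (rule image_preim)
  show "preim M \<noteq> carrier G"
  proof
    assume "preim M = carrier G"
    then have "M = h ` carrier G" using im by simp
    then show False using ne surj by simp
  qed
  fix L assume L: "subgroup L G" "preim M \<subseteq> L"
  have "M \<subseteq> h ` L" using im L(2) by blast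
  then have "h ` L = M \<or> h ` L = carrier H" using max image_subgroup[OF L(1)] by blast
  moreover have "ker \<subseteq> L" using ker_in_preim[OF sM] L(2) by blast
  then have "preim (h ` L) = L" using L(1) by (intro preim_image)
  moreover have "preim (carrier H) = carrier G" using hom_closed by blast
  ultimately show "L = preim M \<or> L = carrier G" by metis
qed

lemma (in finite_epi) frattini_image: "h ` frattini G \<subseteq> frattini H"
proof
  fix y assume "y \<in> h ` frattini G"
  then obtain x where x: "x \<in> carrier G" "\<And>M. maximal_subgroup M G \<Longrightarrow> x \<in> M" "y = h x"
    unfolding frattini_def by blast
  have "y \<in> M" if "maximal_subgroup M H" for M
    using x(2)[OF maximal_preim[OF that]] x(3) by simp
  then show "y \<in> frattini H" unfolding frattini_def using x by simp
qed

text \<open>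
  Closure under conjugation is an instance of \<open>frattini_image\<close> for an inner
  automorphism.
\<close>

lemma (in group) frattini_normal:
  assumes "finite (carrier G)" shows "frattini G \<lhd> G"
proof (rule normal_invI)
  have max: "subgroup M G" if "maximal_subgroup M G" for M using that by (simp add: maximal_subgroup_def)
  have mem: "x \<in> frattini G \<longleftrightarrow> x \<in> carrier G \<and> (\<forall>M. maximal_subgroup M G \<longrightarrow> x \<in> M)" for x
    unfolding frattini_def by blast
  show "subgroup (frattini G) G"
  proof (rule subgroupI)
    show "frattini G \<subseteq> carrier G" using mem by blast
    have "\<one> \<in> frattini G" unfolding mem using max subgroup.one_closed by blast
    then show "frattini G \<noteq> {}" by blast
    show "inv a \<in> frattini G" if "a \<in> frattini G" for a
      using that max unfolding mem by (simp add: subgroup.m_inv_closed)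
    show "a \<otimes> b \<in> frattini G" if "a \<in> frattini G" "b \<in> frattini G" for a b
      using that max unfolding mem by (simp add: subgroup.m_closed)
  qed
  fix x n assume "x \<in> carrier G" "n \<in> frattini G"
  then show "x \<otimes> n \<otimes> inv x \<in> frattini G"
    using finite_epi.frattini_image[OF conj_epi(1)[OF _ assms]] by blast
qed

text \<open>
  A proper subgroup \<open>M\<close> lies in a maximal one, and that contains the Frattini subgroup
  too.
\<close>

lemma (in group) frattini_nongenerating:
  assumes M: "subgroup M G" and fin: "finite (carrier G)"
    and cover: "\<And>g. g \<in> carrier G \<Longrightarrow> \<exists>m\<in>M. \<exists>x\<in>frattini G. g = m \<otimes> x"
  shows "M = carrier G"
proof (rule ccontr)
  assume ne: "M \<noteq> carrier G"
  let ?S = "\<lambda>L. subgroup L G \<and> M \<subseteq> L \<and> L \<noteq> carrier G"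
  have bound: "card L < Suc (order G)" if "?S L" for L
    unfolding order_def less_Suc_eq_le using that fin by (intro card_mono subgroup.subset) simp_all
  have "\<exists>L. ?S L \<and> (\<forall>L'. ?S L' \<longrightarrow> card L' \<le> card L)"
    by (rule ex_has_greatest_nat[where k = M and b = "Suc (order G)"]) (use M ne bound in auto)
  then obtain L where L: "subgroup L G" "M \<subseteq> L" "L \<noteq> carrier G"
    and max: "\<And>L'. subgroup L' G \<Longrightarrow> M \<subseteq> L' \<Longrightarrow> L' \<noteq> carrier G \<Longrightarrow> card L' \<le> card L" by blast
  have "maximal_subgroup L G"
    unfolding maximal_subgroup_def
  proof (intro conjI allI impI)
    fix L' assume L': "subgroup L' G" "L \<subseteq> L'"
    show "L' = L \<or> L' = carrier G"
    proof (cases "L' = carrier G")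
      case False
      then have "card L' \<le> card L" using max[of L'] L' L(2) by blast
      then have "L = L'" using card_seteq[OF subgroup_finite[OF L'(1) fin] L'(2)] by simp
      then show ?thesis by simp
    qed simp
  qed (use L in auto)
  then have "frattini G \<subseteq> L" unfolding frattini_def by blast
  have "carrier G \<subseteq> L"
  proof
    fix g assume "g \<in> carrier G"
    then obtain m x where "m \<in> M" "x \<in> frattini G" "g = m \<otimes> x" using cover by blast
    then show "g \<in> L" using L(1,2) \<open>frattini G \<subseteq> L\<close> by (auto intro: subgroup.m_closed)
  qed
  then show False using L(3) subgroup.subset[OF L(1)] by blast
qed

text \<open>
  By the Frattini argument \<open>G\<close> is the product of \<open>N\<close> and the normaliser of \<open>S\<close>. Since
  every element of \<open>N\<close> is an element of \<open>S\<close> times a Frattini element, \<open>G\<close> is also the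
  product of that normaliser and the Frattini subgroup, so the normaliser is all of \<open>G\<close>.
\<close>

lemma (in group) sylow_normal_mod_frattini:
  assumes N: "N \<lhd> G" and S: "sylow_subgroup p S (G\<lparr>carrier := N\<rparr>)" "prime p" and fin: "finite (carrier G)"
    and dec: "\<And>n. n \<in> N \<Longrightarrow> \<exists>s\<in>S. \<exists>d\<in>frattini G. n = s \<otimes> d"
  shows "S \<lhd> G"
proof -
  have sN: "subgroup N G" using N by (rule normal_imp_subgroup)
  have sS: "subgroup S G" using S(1) sN by (simp add: sylow_subgroup_def subgroup_update_iff)
  have Sc: "S \<subseteq> carrier G" using sS by (rule subgroup.subset)
  have Phi: "frattini G \<lhd> G" using fin by (rule frattini_normal)
  have Phc: "frattini G \<subseteq> carrier G" by (simp add: frattini_def)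
  define M where "M = {x \<in> carrier G. \<forall>s\<in>S. x \<otimes> s \<otimes> inv x \<in> S}"
  have sM: "subgroup M G" unfolding M_def using Sc fin by (rule normaliser_subgroup)
  have SM: "S \<subseteq> M" unfolding M_def using Sc sS by (auto simp: subgroup.m_closed subgroup.m_inv_closed)
  have "M = carrier G"
  proof (rule frattini_nongenerating[OF sM fin])
    fix g assume g: "g \<in> carrier G"
    obtain n x where nx: "n \<in> N" "x \<in> carrier G" "g = n \<otimes> x" "\<And>s. s \<in> S \<Longrightarrow> x \<otimes> s \<otimes> inv x \<in> S"
      by (rule frattini_argument[OF N S fin g]) blast
    obtain s d where sd: "s \<in> S" "d \<in> frattini G" "n = s \<otimes> d" using dec[OF nx(1)] by blast
    have "x \<in> M" unfolding M_def using nx by blast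
    then have "s \<otimes> x \<in> M" using sd(1) SM by (intro subgroup.m_closed[OF sM]) auto
    moreover have "inv x \<otimes> d \<otimes> x \<in> frattini G" using Phi nx(2) sd(2) by (rule normal.inv_op_closed1)
    moreover have "g = (s \<otimes> x) \<otimes> (inv x \<otimes> d \<otimes> x)"
    proof -
      have "s \<in> carrier G" "d \<in> carrier G" using sd Sc Phc by auto
      then show ?thesis unfolding nx(3) sd(3) using nx(2) by (simp add: m_assoc inv_mult_cancel)
    qed
    ultimately show "\<exists>m\<in>M. \<exists>x\<in>frattini G. g = m \<otimes> x" by blast
  qed
  then show ?thesis using sS by (intro normal_invI) (auto simp: M_def)
qed

lemma (in group) normal_sylow_of_normal:
  assumes N: "N \<lhd> G" and S: "sylow_subgroup p S (G\<lparr>carrier := N\<rparr>)" "prime p" "S \<lhd> G\<lparr>carrier := N\<rparr>"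
    and fin: "finite (carrier G)"
  shows "S \<lhd> G"
proof -
  have sN: "subgroup N G" using N by (rule normal_imp_subgroup)
  interpret N: group "G\<lparr>carrier := N\<rparr>" using sN by (rule subgroup_imp_group)
  have fN: "finite (carrier (G\<lparr>carrier := N\<rparr>))" using subgroup_finite[OF sN fin] by simp
  have sS: "subgroup S G" "S \<subseteq> N" using S(1) sN by (simp_all add: sylow_subgroup_def subgroup_update_iff)
  show ?thesis
  proof (rule normal_invI[OF sS(1)])
    fix g s assume g: "g \<in> carrier G" and s: "s \<in> S"
    define R where "R = (\<lambda>x. g \<otimes> x \<otimes> inv g) ` S"
    have "subgroup R G" unfolding R_def using finite_epi.image_subgroup[OF conj_epi(1)[OF g fin] sS(1)] .
    moreover have "R \<subseteq> N" unfolding R_def using sS(2) normal.inv_op_closed2[OF N g] by blast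
    ultimately have R: "subgroup R (G\<lparr>carrier := N\<rparr>)" using sN by (simp add: subgroup_update_iff)
    have "card R = card S" unfolding R_def
      using inj_on_subset[OF conj_epi(2)[OF g fin] subgroup.subset[OF sS(1)]] by (rule card_image)
    then have "card R = p ^ multiplicity p (order (G\<lparr>carrier := N\<rparr>))" using S(1) by (simp add: sylow_subgroup_def)
    then have "R \<subseteq> S" by (rule N.p_subgroup_in_normal_sylow[OF S(1,2) fN S(3) R])
    then show "g \<otimes> s \<otimes> inv g \<in> S" using s by (auto simp: R_def)
  qed
qed

lemma (in group) subgroup_card_one:
  assumes "subgroup A G" "card A = 1" shows "A = {\<one>}"
proof -
  obtain z where "A = {z}" using assms(2) by (rule card_1_singletonE)
  then show ?thesis using subgroup.one_closed[OF assms(1)] by simp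
qed

lemma (in group) coprime_subgroups_inter:
  assumes "subgroup A G" "subgroup B G" "coprime (card A) (card B)" "finite (carrier G)"
  shows "A \<inter> B = {\<one>}"
proof -
  have s: "subgroup (A \<inter> B) G" using assms(1,2) by (rule subgroups_Inter_pair)
  have "card (A \<inter> B) dvd card A" using s assms by (intro card_subgroup_dvd) auto
  moreover have "card (A \<inter> B) dvd card B" using s assms by (intro card_subgroup_dvd) auto
  ultimately have "card (A \<inter> B) = 1" using assms(3) by (metis coprime_common_divisor_nat)
  with s show ?thesis by (rule subgroup_card_one)
qed

text \<open>
  Let \<open>C\<close> be the subgroup of the elements that act trivially on \<open>P / D\<close>. If \<open>C\<close> is not
  inside \<open>P\<close>, the nontrivial subgroup \<open>C P / P\<close> of \<open>G / P\<close> belongs to the class, so it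
  has a normal Sylow subgroup for its largest prime \<open>r\<close>, which comes from a Sylow
  subgroup \<open>S\<close> of \<open>C\<close>. Then \<open>S P\<close> is normal in \<open>G\<close>, and since \<open>S\<close> acts trivially on
  \<open>P / D\<close>, also \<open>S D\<close> is normal. Because \<open>D\<close> consists of Frattini elements, \<open>S\<close> itself
  is normal, although it meets \<open>P\<close> trivially.
\<close>

lemma (in group) frattini_quotient_centraliser:
  assumes fin: "finite (carrier G)" and P: "P \<lhd> G" "sylow_subgroup p P G" "prime p"
    and \<pi>: "finite_epi G R \<pi>" "kernel G R \<pi> = P" and R: "sylow_KP_group t R"
    and \<psi>: "finite_epi G L \<psi>" "kernel G L \<psi> = D" and D: "D \<subseteq> P" "D \<subseteq> frattini G"
    and no_comp: "\<And>S. S \<lhd> G \<Longrightarrow> S \<inter> P = {\<one>} \<Longrightarrow> S = {\<one>}"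
  shows "image_centraliser G L \<psi> P \<subseteq> P"
proof (rule ccontr)
  define C where "C = image_centraliser G L \<psi> P"
  assume "\<not> image_centraliser G L \<psi> P \<subseteq> P"
  then obtain c where c: "c \<in> C" "c \<notin> P" unfolding C_def by blast
  interpret \<pi>: finite_epi G R \<pi> by fact
  interpret \<psi>: finite_epi G L \<psi> by fact
  have C: "C \<lhd> G" unfolding C_def using P(1) by (rule \<psi>.centraliser_normal)
  have sC: "subgroup C G" using C by (rule normal_imp_subgroup)
  have cc: "c \<in> carrier G" using c(1) by (simp add: C_def)
  define Cb where "Cb = \<pi> ` C"
  have Cb: "Cb \<lhd> R" unfolding Cb_def using C by (rule \<pi>.image_normal)
  have sCb: "subgroup Cb R" using Cb by (rule normal_imp_subgroup)
  let ?R = "R\<lparr>carrier := Cb\<rparr>" and ?C = "G\<lparr>carrier := C\<rparr>"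
  interpret Rb: group ?R using sCb by (rule \<pi>.H.subgroup_imp_group)
  have finR: "finite (carrier ?R)" using \<pi>.H.subgroup_finite[OF sCb \<pi>.finH] by simp
  have KPC: "sylow_KP_group t ?R" using R sCb by (rule sylow_KP_subgroup)
  have "order ?R \<noteq> 1"
  proof
    assume "order ?R = 1"
    then have "Cb = {\<one>\<^bsub>R\<^esub>}" using sCb by (intro \<pi>.H.subgroup_card_one) simp_all
    then have "\<pi> c = \<one>\<^bsub>R\<^esub>" using c(1) unfolding Cb_def by blast
    then show False using c(2) cc \<pi>(2) by (auto simp: kernel_def)
  qed
  then obtain r where r: "prime r" "r dvd order ?R" "\<And>q. prime q \<Longrightarrow> q dvd order ?R \<Longrightarrow> q \<le> r"
    using Rb.largest_prime[OF finR] by blast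
  interpret cb: finite_epi ?C ?R \<pi>
  proof (rule finite_epiI)
    show "group ?C" using sC by (rule subgroup_imp_group)
    show "group ?R" by (rule Rb.is_group)
    show "\<pi> \<in> hom ?C ?R"
      using subgroup.subset[OF sC] by (intro homI) (auto simp: Cb_def subset_iff)
    show "finite (carrier ?C)" using subgroup_finite[OF sC fin] by simp
    show "\<pi> ` carrier ?C = carrier ?R" by (simp add: Cb_def)
  qed
  obtain T where T: "sylow_subgroup r T ?R" using r(1) finR by (rule Rb.sylow_exists)
  obtain S where S: "sylow_subgroup r S ?C" "\<pi> ` S = T" using T r(1) by (rule cb.sylow_lift)
  have "T \<lhd> ?R" using KPC T r(1,3) by (rule Rb.largest_sylow_normal)
  then have nT: "T \<lhd> R" by (rule \<pi>.H.normal_sylow_of_normal[OF Cb T r(1) _ \<pi>.finH])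
  have sT: "subgroup T R" using nT by (rule normal_imp_subgroup)
  have T1: "card T > 1" using T r(1,2) finR by (rule Rb.sylow_nontrivial)
  have sS: "subgroup S G" and SC: "S \<subseteq> C"
    using S(1) sC by (simp_all add: sylow_subgroup_def subgroup_update_iff)
  have Sc: "s \<in> carrier G" if "s \<in> S" for s using that sS subgroup.mem_carrier by metis
  obtain i where cS: "card S = r ^ i" using S(1) by (auto simp: sylow_subgroup_def)
  obtain m where m: "subgroup P G" "card P = p ^ multiplicity p (order G)" "order G = card P * m" "\<not> p dvd m"
    using P(2,3) fin by (rule sylow_subgroupE)
  have oR: "order R = m"
    using \<pi>.order_epi m(3) \<pi>(2) subgroup_card_pos[OF m(1) fin] by simp
  have "r dvd order R" using r(2) \<pi>.H.subgroup_card_dvd_order[OF sCb] by (simp add: dvd_trans)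
  then have rp: "r \<noteq> p" using oR m(4) by blast
  have cop: "coprime r (card P)"
    unfolding m(2) using rp r(1) P(3) by (simp add: primes_coprime)
  then have rP: "\<not> r dvd card P" using r(1) by (metis coprime_common_divisor_nat dvd_refl not_prime_1)
  have SP: "S \<inter> P = {\<one>}"
    using sS m(1) cop fin by (intro coprime_subgroups_inter) (simp_all add: cS)
  have "kernel G R \<pi> \<inter> S = {\<one>}" using \<pi>(2) SP by blast
  then have cT: "card S = card T" using \<pi>.card_hom_image[OF sS fin] S(2) by simp
  \<comment> \<open>\<open>N\<close> is \<open>S P\<close>.\<close>
  define N where "N = \<pi>.preim T"
  have nN: "N \<lhd> G" unfolding N_def using nT by (rule \<pi>.preim_normal)
  have sN: "subgroup N G" using nN by (rule normal_imp_subgroup)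
  have SN: "S \<subseteq> N" unfolding N_def using S(2) Sc by blast
  have sylN: "sylow_subgroup r S (G\<lparr>carrier := N\<rparr>)"
  proof (rule group.sylow_subgroupI)
    show "group (G\<lparr>carrier := N\<rparr>)" using sN by (rule subgroup_imp_group)
    show "subgroup S (G\<lparr>carrier := N\<rparr>)" using sS SN sN by (simp add: subgroup_update_iff)
    show "card S = r ^ i" by (rule cS)
    have "card N = card P * card T" unfolding N_def using \<pi>.card_preim[OF sT] \<pi>(2) by simp
    then show "order (G\<lparr>carrier := N\<rparr>) = card S * card P" using cT by simp
  qed fact+
  have imS: "subgroup (\<psi> ` S) L" using sS by (rule \<psi>.image_subgroup)
  have nS: "\<psi> ` S \<lhd> L"
  proof (rule \<psi>.H.normal_invI[OF imS])
    fix g' s' assume g': "g' \<in> carrier L" and "s' \<in> \<psi> ` S"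
    then obtain s where s: "s \<in> S" "s' = \<psi> s" by blast
    obtain g where g: "g \<in> carrier G" "g' = \<psi> g" using g' \<psi>.surj by blast
    obtain n x where nx: "n \<in> N" "x \<in> carrier G" "g = n \<otimes> x" "\<And>s. s \<in> S \<Longrightarrow> x \<otimes> s \<otimes> inv x \<in> S"
      by (rule frattini_argument[OF nN sylN r(1) fin g(1)]) blast
    have "n \<in> \<pi>.preim (\<pi> ` S)" using nx(1) S(2) by (simp add: N_def)
    then obtain y a where ya: "y \<in> P" "a \<in> S" "n = a \<otimes> y"
      using \<pi>.preim_image_member[OF sS, of n] \<pi>(2) by metis
    have yc: "y \<in> carrier G" using ya(1) m(1) subgroup.mem_carrier by metis
    \<comment> \<open>The factor \<open>y\<close> of \<open>g\<close> acts trivially on the image of \<open>S\<close>, since \<open>S\<close> lies in \<open>C\<close>.\<close>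
    define u where "u = x \<otimes> s \<otimes> inv x"
    have u: "u \<in> S" unfolding u_def using s(1) by (rule nx(4))
    have "\<psi> u \<otimes>\<^bsub>L\<^esub> \<psi> y \<otimes>\<^bsub>L\<^esub> inv\<^bsub>L\<^esub> \<psi> u = \<psi> y" using u SC ya(1) unfolding C_def by blast
    then have "\<psi> u \<otimes>\<^bsub>L\<^esub> \<psi> y \<otimes>\<^bsub>L\<^esub> inv\<^bsub>L\<^esub> \<psi> u \<otimes>\<^bsub>L\<^esub> \<psi> u = \<psi> y \<otimes>\<^bsub>L\<^esub> \<psi> u" by simp
    then have uy: "\<psi> u \<otimes>\<^bsub>L\<^esub> \<psi> y = \<psi> y \<otimes>\<^bsub>L\<^esub> \<psi> u" using yc Sc[OF u] by (simp add: \<psi>.H.m_assoc)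
    have "g' \<otimes>\<^bsub>L\<^esub> s' \<otimes>\<^bsub>L\<^esub> inv\<^bsub>L\<^esub> g' = \<psi> a \<otimes>\<^bsub>L\<^esub> (\<psi> y \<otimes>\<^bsub>L\<^esub> \<psi> u) \<otimes>\<^bsub>L\<^esub> inv\<^bsub>L\<^esub> \<psi> y \<otimes>\<^bsub>L\<^esub> inv\<^bsub>L\<^esub> \<psi> a"
      unfolding g(2) s(2) nx(3) ya(3) u_def using Sc[OF s(1)] Sc[OF ya(2)] yc nx(2)
      by (simp add: \<psi>.H.m_assoc \<psi>.H.inv_mult_group)
    also have "\<dots> = \<psi> (a \<otimes> u \<otimes> inv a)"
      unfolding uy[symmetric] using Sc[OF u] Sc[OF ya(2)] yc by (simp add: \<psi>.H.m_assoc)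
    also have "\<dots> \<in> \<psi> ` S" using ya(2) u sS by (intro imageI) (simp add: subgroup.m_closed subgroup.m_inv_closed)
    finally show "g' \<otimes>\<^bsub>L\<^esub> s' \<otimes>\<^bsub>L\<^esub> inv\<^bsub>L\<^esub> g' \<in> \<psi> ` S" .
  qed
  \<comment> \<open>\<open>W\<close> is \<open>S D\<close>.\<close>
  define W where "W = \<psi>.preim (\<psi> ` S)"
  have nW: "W \<lhd> G" unfolding W_def using nS by (rule \<psi>.preim_normal)
  have sW: "subgroup W G" using nW by (rule normal_imp_subgroup)
  have SW: "S \<subseteq> W" unfolding W_def using Sc by blast
  have sD: "subgroup D G" using \<psi>.subgroup_kernel \<psi>(2) by simp
  have "card D dvd card P" using sD m(1) D(1) fin by (rule card_subgroup_dvd)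
  then have rD: "\<not> r dvd card D" using rP dvd_trans by blast
  have "S \<lhd> G"
  proof (rule sylow_normal_mod_frattini[OF nW _ r(1) fin])
    show "sylow_subgroup r S (G\<lparr>carrier := W\<rparr>)"
    proof (rule group.sylow_subgroupI)
      show "group (G\<lparr>carrier := W\<rparr>)" using sW by (rule subgroup_imp_group)
      show "subgroup S (G\<lparr>carrier := W\<rparr>)" using sS SW sW by (simp add: subgroup_update_iff)
      show "card S = r ^ i" by (rule cS)
      have "kernel G L \<psi> \<inter> S = {\<one>}" using \<psi>(2) SP D(1) subgroup.one_closed[OF sD] by blast
      then have "card S = card (\<psi> ` S)" using \<psi>.card_hom_image[OF sS fin] by simp
      then show "order (G\<lparr>carrier := W\<rparr>) = card S * card D"
        unfolding W_def using \<psi>.card_preim[OF imS] \<psi>(2) by simp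
    qed fact+
    fix n assume "n \<in> W"
    then obtain d s where "d \<in> D" "s \<in> S" "n = s \<otimes> d"
      using \<psi>.preim_image_member[OF sS, of n] \<psi>(2) unfolding W_def by metis
    then show "\<exists>s\<in>S. \<exists>d\<in>frattini G. n = s \<otimes> d" using D(2) by blast
  qed
  then have "S = {\<one>}" using SP by (rule no_comp)
  then show False using cT T1 by simp
qed

text \<open>
  Conjugation by the powers of \<open>x\<close> multiplies \<open>y\<close> by the powers of \<open>d\<close>. The order of \<open>d\<close>
  divides both \<open>m\<close> and \<open>n\<close>.
\<close>

lemma (in group) coprime_shift:
  assumes "x \<in> carrier G" "y \<in> carrier G" "d \<in> carrier G"
    and "x \<otimes> y = d \<otimes> y \<otimes> x" "x \<otimes> d = d \<otimes> x" "x [^] (m::nat) = \<one>" "d [^] (n::nat) = \<one>" "coprime m n"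
  shows "d = \<one>"
proof -
  have iter: "(x [^] k) \<otimes> y = (d [^] k) \<otimes> y \<otimes> (x [^] k)" for k :: nat
  proof (induction k)
    case (Suc k)
    have "d [^] k \<otimes> x = x \<otimes> d [^] k" using assms(1,3,5) by (intro group_commutes_pow) simp_all
    have "(x [^] Suc k) \<otimes> y = x \<otimes> ((x [^] k) \<otimes> y)"
      unfolding nat_pow_Suc2[OF assms(1)] using assms(1,2) by (simp add: m_assoc)
    also have "\<dots> = (x \<otimes> d [^] k) \<otimes> y \<otimes> (x [^] k)" unfolding Suc using assms(1-3) by (simp add: m_assoc)
    also have "\<dots> = d [^] k \<otimes> (x \<otimes> y) \<otimes> (x [^] k)"
      unfolding \<open>d [^] k \<otimes> x = x \<otimes> d [^] k\<close>[symmetric] using assms(1-3) by (simp add: m_assoc)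
    also have "\<dots> = (d [^] Suc k) \<otimes> y \<otimes> (x [^] Suc k)"
      unfolding assms(4) nat_pow_Suc2[OF assms(1)] using assms(1-3) by (simp add: m_assoc)
    finally show ?case .
  qed (use assms in simp)
  have "y = d [^] m \<otimes> y" using iter[of m] assms(2,3,6) by simp
  then have "d [^] m = \<one>" using assms(2,3) by (metis nat_pow_closed r_cancel_one')
  then have "ord d dvd m" "ord d dvd n" using assms(3,7) by (simp_all add: pow_eq_id)
  then have "ord d = 1" using assms(8) by (metis coprime_common_divisor_nat)
  then show ?thesis using assms(3) ord_eq_1 by blast
qed

text \<open>
  Let \<open>D\<close> be the kernel of \<open>\<psi>\<close>. Along a chain that starts at \<open>Q D\<close>, the elements
  \<open>x\<close> described in the assumption act trivially on the part of \<open>P\<close> modulo \<open>D\<close> that has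
  been reached. For a step from \<open>A\<close> to \<open>B\<close> and \<open>y\<close> in \<open>B \<inter> P\<close>, the commutator \<open>d\<close>
  of \<open>x\<close> and \<open>y\<close> lies in \<open>A\<close>: over a normal step because \<open>x\<close> is in \<open>A\<close>, and over a step
  of prime index, which must be \<open>p\<close>, because \<open>x\<close> is in the normal subgroup
  \<open>C \<inter> A\<close> of \<open>prime_index_structure\<close>. By induction \<open>x\<close> commutes with \<open>d\<close> modulo
  \<open>D\<close>, and as \<open>x\<close> and \<open>d\<close> have coprime orders this forces \<open>d\<close> into \<open>D\<close>.
\<close>

lemma (in group) chain_centralises:
  assumes solv: "solvable G" and fin: "finite (carrier G)"
    and P: "P \<lhd> G" "card P = p ^ k" "prime p" and Q: "subgroup Q G" "card Q = q ^ j" "prime q" "p \<noteq> q"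
    and \<psi>: "finite_epi G L \<psi>" "kernel G L \<psi> \<subseteq> P"
    and chain: "KP_chain t G {x \<in> carrier G. \<psi> x \<in> \<psi> ` Q} B" and cB: "card B dvd card P * card Q"
    and x: "x \<in> Q" "(\<exists>a\<in>Q. \<exists>b\<in>Q. x = a \<otimes> b \<otimes> inv a \<otimes> inv b) \<or> (\<exists>a\<in>Q. x = a [^] (p - 1)) \<or> \<not> power_free t (p - 1)"
    and y: "y \<in> B \<inter> P"
  shows "\<psi> x \<otimes>\<^bsub>L\<^esub> \<psi> y = \<psi> y \<otimes>\<^bsub>L\<^esub> \<psi> x"
proof -
  interpret \<psi>: finite_epi G L \<psi> by fact
  have sP: "subgroup P G" using P(1) by (rule normal_imp_subgroup)
  have Pc: "u \<in> carrier G" if "u \<in> P" for u using that sP subgroup.mem_carrier by metis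
  have Qc: "u \<in> carrier G" if "u \<in> Q" for u using that Q(1) subgroup.mem_carrier by metis
  have xc: "x \<in> carrier G" using x(1) by (rule Qc)
  have cop: "coprime (card Q) (card P)" unfolding P(2) Q(2) using P(3) Q(3,4) by (simp add: primes_coprime)
  have QP: "Q \<inter> P = {\<one>}" using Q(1) sP cop fin by (rule coprime_subgroups_inter)
  have pow_card: "\<psi> u [^]\<^bsub>L\<^esub> card U = \<one>\<^bsub>L\<^esub>" if u: "u \<in> U" and U: "subgroup U G" for u U
  proof -
    interpret U: group "G\<lparr>carrier := U\<rparr>" using U by (rule subgroup_imp_group)
    have "u [^] card U = \<one>" using U.pow_order_eq_1[of u] u by (simp add: nat_pow_consistent[symmetric])
    moreover have "u \<in> carrier G" using u U subgroup.mem_carrier by metis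
    ultimately show ?thesis by (metis \<psi>.hom_nat_pow \<psi>.hom_one)
  qed
  show ?thesis
    using chain cB y
  proof (induction arbitrary: y rule: rtranclp_induct)
    case base
    have yc: "y \<in> carrier G" and yP: "y \<in> P" and "y \<in> \<psi>.preim (\<psi> ` Q)" using base Pc by blast+
    then obtain d a where da: "d \<in> kernel G L \<psi>" "a \<in> Q" "y = a \<otimes> d"
      using \<psi>.preim_image_member[OF Q(1)] by metis
    have dP: "d \<in> P" using da(1) \<psi>(2) by blast
    have "a = y \<otimes> inv d" unfolding da(3) using Qc[OF da(2)] Pc[OF dP] by (simp add: m_assoc)
    also have "\<dots> \<in> P" using yP dP sP by (simp add: subgroup.m_closed subgroup.m_inv_closed)
    finally have "a = \<one>" using QP da(2) by blast
    then have "\<psi> y = \<one>\<^bsub>L\<^esub>" using da Pc[OF dP] by (simp add: kernel_def)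
    then show ?case using xc by simp
  next
    case (step A B)
    have sQD: "subgroup (\<psi>.preim (\<psi> ` Q)) G" by (intro \<psi>.preim_subgroup \<psi>.image_subgroup Q(1))
    have sA: "subgroup A G" "\<psi>.preim (\<psi> ` Q) \<subseteq> A" using KP_chain_subgroup[OF step.hyps(1) sQD] by auto
    have QA: "Q \<subseteq> A" using sA(2) Qc by blast
    have sB: "subgroup B G" and AB: "A \<subseteq> B" using step.hyps(2) by (simp_all add: KP_link_def)
    have cA: "card A dvd card P * card Q"
      using card_subgroup_dvd[OF sA(1) sB AB fin] step.prems(1) by (rule dvd_trans)
    have yP: "y \<in> P" and yB: "y \<in> B" using step.prems(2) by auto
    have yc: "y \<in> carrier G" using yP by (rule Pc)
    have xB: "x \<in> B" "x \<in> A" using x(1) QA AB by auto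
    \<comment> \<open>The commutator of \<open>x\<close> and \<open>y\<close>, bracketed so that a conjugate of the inverse of \<open>x\<close> is visible.\<close>
    define d where "d = x \<otimes> (y \<otimes> inv x \<otimes> inv y)"
    have dc: "d \<in> carrier G" unfolding d_def using xc yc by simp
    have dP: "d \<in> P"
    proof -
      have "x \<otimes> y \<otimes> inv x \<in> P" using P(1) xc yP by (rule normal.inv_op_closed2)
      then have "x \<otimes> y \<otimes> inv x \<otimes> inv y \<in> P" using yP sP by (simp add: subgroup.m_closed subgroup.m_inv_closed)
      then show ?thesis unfolding d_def using xc yc by (simp add: m_assoc)
    qed
    have dA: "d \<in> A"
      using step.hyps(2)
    proof (cases rule: KP_link_cases)
      case normal
      have "y \<otimes> inv x \<otimes> inv y \<in> A"
        using xB(2) yB sA(1) by (intro normal(4)) (simp_all add: subgroup.m_inv_closed)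
      then show ?thesis unfolding d_def by (rule subgroup.m_closed[OF sA(1) xB(2)])
    next
      case (index p')
      let ?B = "G\<lparr>carrier := B\<rparr>"
      have "card Q dvd card A" using Q(1) sA(1) QA fin by (rule card_subgroup_dvd)
      then obtain e where e: "card A = card Q * e" by (elim dvdE)
      have "card Q * (p' * e) dvd card Q * card P"
        using step.prems(1) unfolding index(5) e by (simp add: ac_simps)
      then have "p' * e dvd p ^ k" using subgroup_card_pos[OF Q(1) fin] P(2) by simp
      then have "p' dvd p ^ k" by (rule dvd_mult_left)
      \<comment> \<open>The order of \<open>A\<close> is a multiple of \<open>|Q|\<close> and that of \<open>B\<close> divides \<open>|P| |Q|\<close>, so the index divides \<open>|P|\<close>.\<close>
      then have pp: "p' = p" using index(4) P(3) by (metis prime_dvd_power primes_dvd_imp_eq)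
      interpret B: group ?B using sB by (rule subgroup_imp_group)
      have finB: "finite (carrier ?B)" using subgroup_finite[OF sB fin] by simp
      have invB: "inv\<^bsub>?B\<^esub> b = inv b" if "b \<in> B" for b using m_inv_consistent[OF sB that] .
      have A': "subgroup A ?B" using sA(1) sB AB by (simp add: subgroup_update_iff)
      have ordB: "order ?B = p * card A" using index(5) pp by simp
      obtain C where C: "C \<inter> A \<lhd> ?B"
        and comm: "\<And>b c. b \<in> carrier ?B \<Longrightarrow> c \<in> carrier ?B \<Longrightarrow>
          b \<otimes>\<^bsub>?B\<^esub> c \<otimes>\<^bsub>?B\<^esub> inv\<^bsub>?B\<^esub> b \<otimes>\<^bsub>?B\<^esub> inv\<^bsub>?B\<^esub> c \<in> C"
        and pow: "\<And>b. b \<in> carrier ?B \<Longrightarrow> b [^]\<^bsub>?B\<^esub> (p - 1) \<in> C"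
        by (rule B.prime_index_structure[OF solvable_restrict[OF solv sB] finB A' ordB P(3)]) blast
      have "x \<in> C"
        using x(2)
      proof (elim disjE bexE)
        fix a b assume ab: "a \<in> Q" "b \<in> Q" "x = a \<otimes> b \<otimes> inv a \<otimes> inv b"
        have "a \<in> B" "b \<in> B" using ab QA AB by auto
        then show ?thesis using comm[of a b] ab(3) invB by simp
      next
        fix a assume a: "a \<in> Q" "x = a [^] (p - 1)"
        have "a \<in> B" using a QA AB by auto
        then show ?thesis using pow[of a] a(2) by (simp add: nat_pow_consistent[symmetric])
      next
        assume "\<not> power_free t (p - 1)"
        then show ?thesis using index(6) pp by simp
      qed
      then have xK: "x \<in> C \<inter> A" using xB by blast
      have sK: "subgroup (C \<inter> A) ?B" using C by (rule normal_imp_subgroup)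
      have "inv\<^bsub>?B\<^esub> x \<in> C \<inter> A" using xK by (rule subgroup.m_inv_closed[OF sK])
      then have "y \<otimes>\<^bsub>?B\<^esub> inv\<^bsub>?B\<^esub> x \<otimes>\<^bsub>?B\<^esub> inv\<^bsub>?B\<^esub> y \<in> C \<inter> A"
        using C yB by (intro normal.inv_op_closed2) simp_all
      then have "y \<otimes> inv x \<otimes> inv y \<in> C \<inter> A" using invB yB xB by simp
      then have "x \<otimes> (y \<otimes> inv x \<otimes> inv y) \<in> C \<inter> A" using subgroup.m_closed[OF sK xK] by simp
      then show ?thesis unfolding d_def by blast
    qed
    have xd: "\<psi> x \<otimes>\<^bsub>L\<^esub> \<psi> d = \<psi> d \<otimes>\<^bsub>L\<^esub> \<psi> x" using step.IH[OF cA] dA dP by blast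
    have "x \<otimes> y = d \<otimes> y \<otimes> x" unfolding d_def using xc yc by (simp add: m_assoc)
    then have xy: "\<psi> x \<otimes>\<^bsub>L\<^esub> \<psi> y = \<psi> d \<otimes>\<^bsub>L\<^esub> \<psi> y \<otimes>\<^bsub>L\<^esub> \<psi> x" using xc yc dc by (metis \<psi>.hom_mult m_closed)
    have "\<psi> d = \<one>\<^bsub>L\<^esub>"
      using xc yc dc by (intro \<psi>.H.coprime_shift[OF _ _ _ xy xd pow_card[OF x(1) Q(1)] pow_card[OF dP sP] cop]) simp_all
    then show ?case using xy xc yc by simp
  qed
qed

section \<open>Saturation\<close>

lemma (in group) KP_chain_normal_subgroup:
  assumes "N \<lhd> G" shows "KP_chain t G N (carrier G)"
proof -
  have sN: "subgroup N G" using assms by (rule normal_imp_subgroup)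
  have "KP_link t G N (carrier G)"
    using sN subgroup_self subgroup.subset[OF sN] normal.inv_op_closed2[OF assms] by (intro KP_link_normalI)
  then show ?thesis by (rule r_into_rtranclp)
qed

lemma (in group) normal_sylow_unique:
  assumes "sylow_subgroup p P G" "prime p" "finite (carrier G)" "P \<lhd> G" "sylow_subgroup p Q G"
  shows "Q = P"
proof -
  have "Q \<subseteq> P" using assms(5) by (intro p_subgroup_in_normal_sylow[OF assms(1-4)]) (auto simp: sylow_subgroup_def)
  moreover have "finite P" using assms(1,3) subgroup_finite unfolding sylow_subgroup_def by blast
  moreover have "card Q = card P" using assms(1,5) by (simp add: sylow_subgroup_def)
  ultimately show ?thesis by (simp add: card_subset_eq)
qed

text \<open>
  Both \<open>Q P\<close> and \<open>Q D\<close>, where \<open>D\<close> is the kernel of \<open>\<psi>\<close>, are joined to \<open>G\<close> by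
  chains, because \<open>R\<close> and \<open>L\<close> are in the class. Intersecting the second chain with \<open>Q P\<close>
  gives a chain from \<open>Q D\<close> to \<open>Q P\<close>, and \<open>chain_centralises\<close> shows that commutators and
  \<open>(p - 1)\<close>th powers of elements of \<open>Q\<close> act trivially on \<open>P / D\<close>. By assumption such
  elements lie in \<open>P\<close>, so they are trivial: \<open>Q\<close> is abelian of exponent dividing \<open>p - 1\<close>,
  and it is itself trivial if steps of index \<open>p\<close> are not admissible. Then
  \<open>KP_chain_abelian_complement\<close> joins \<open>Q\<close> to \<open>Q P\<close>.
\<close>

lemma KP_chain_over_self_centralising_sylow:
  fixes G :: "nat monoid" (structure) and R L :: "nat monoid"
  assumes fin: "finite (carrier G)"
    and P: "P \<lhd> G" "sylow_subgroup p P G" "prime p"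
    and \<pi>: "finite_epi G R \<pi>" "kernel G R \<pi> = P" and R: "sylow_KP_group t R"
    and \<psi>: "finite_epi G L \<psi>" "kernel G L \<psi> \<subseteq> P" and L: "sylow_KP_group t L"
    and cent: "image_centraliser G L \<psi> P \<subseteq> P"
    and Q: "sylow_subgroup q Q G" "prime q" "q \<noteq> p"
  shows "KP_chain t G Q (carrier G)"
proof -
  interpret group G using P(1) by (simp add: normal_def)
  interpret \<pi>: finite_epi G R \<pi> by fact
  interpret \<psi>: finite_epi G L \<psi> by fact
  have sP: "subgroup P G" using P(1) by (rule normal_imp_subgroup)
  have sQ: "subgroup Q G" using Q(1) by (simp add: sylow_subgroup_def)
  have Pc: "u \<in> carrier G" if "u \<in> P" for u using that sP subgroup.mem_carrier by metis
  have Qc: "u \<in> carrier G" if "u \<in> Q" for u using that sQ subgroup.mem_carrier by metis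
  obtain k where cP: "card P = p ^ k" using P(2) by (auto simp: sylow_subgroup_def)
  obtain j where cQ: "card Q = q ^ j" using Q(1) by (auto simp: sylow_subgroup_def)
  have cop: "coprime (card Q) (card P)" unfolding cP cQ using P(3) Q(2,3) by (simp add: primes_coprime)
  have QP: "Q \<inter> P = {\<one>}" using sQ sP cop fin by (rule coprime_subgroups_inter)
  have solv: "solvable G"
    using sylow_KP_solvable[OF R] P(3) cP \<pi>(2) by (intro \<pi>.solvable_by_p_kernel) simp_all
  \<comment> \<open>\<open>E\<close> is \<open>Q P\<close>, and \<open>QD\<close> below is the product of \<open>Q\<close> with the kernel of \<open>\<psi>\<close>.\<close>
  define E where "E = \<pi>.preim (\<pi> ` Q)"
  have imQ: "subgroup (\<pi> ` Q) R" using sQ by (rule \<pi>.image_subgroup)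
  have sE: "subgroup E G" unfolding E_def using imQ by (rule \<pi>.preim_subgroup)
  have PE: "P \<subseteq> E" unfolding E_def using \<pi>.ker_in_preim[OF imQ] \<pi>(2) by simp
  have QE: "Q \<subseteq> E" unfolding E_def using Qc by blast
  have kE: "KP_chain t G E (carrier G)" unfolding E_def using R Q(2,1) by (rule \<pi>.KP_chain_preim_image_sylow)
  have "kernel G R \<pi> \<inter> Q = {\<one>}" using \<pi>(2) QP by blast
  then have "card Q = card (\<pi> ` Q)" using \<pi>.card_hom_image[OF sQ fin] by simp
  then have cE: "card E = card P * card Q" unfolding E_def using \<pi>.card_preim[OF imQ] \<pi>(2) by simp
  define QD where "QD = \<psi>.preim (\<psi> ` Q)"
  have kQD: "KP_chain t G QD (carrier G)" unfolding QD_def using L Q(2,1) by (rule \<psi>.KP_chain_preim_image_sylow)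
  have "QD \<subseteq> E"
  proof
    fix g assume "g \<in> QD"
    then obtain d a where da: "d \<in> kernel G L \<psi>" "a \<in> Q" "g = a \<otimes> d"
      using \<psi>.preim_image_member[OF sQ, of g] unfolding QD_def by metis
    have "d \<in> E" "a \<in> E" using da \<psi>(2) PE QE by auto
    then show "g \<in> E" unfolding da(3) by (intro subgroup.m_closed[OF sE])
  qed
  moreover have "KP_chain t G (QD \<inter> E) (carrier G \<inter> E)" using solv fin sE kQD by (rule KP_chain_inter)
  moreover have "carrier G \<inter> E = E" using subgroup.subset[OF sE] by blast
  ultimately have "KP_chain t G QD E" by (simp add: Int_absorb2)
  then have chain: "KP_chain t G (\<psi>.preim (\<psi> ` Q)) E" unfolding QD_def .
  have triv: "x = \<one>" if x: "x \<in> Q" "(\<exists>a\<in>Q. \<exists>b\<in>Q. x = a \<otimes> b \<otimes> inv a \<otimes> inv b)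
      \<or> (\<exists>a\<in>Q. x = a [^] (p - 1)) \<or> \<not> power_free t (p - 1)" for x
  proof -
    have "\<psi> x \<otimes>\<^bsub>L\<^esub> \<psi> y \<otimes>\<^bsub>L\<^esub> inv\<^bsub>L\<^esub> \<psi> x = \<psi> y" if y: "y \<in> P" for y
    proof -
      have "\<psi> x \<otimes>\<^bsub>L\<^esub> \<psi> y = \<psi> y \<otimes>\<^bsub>L\<^esub> \<psi> x"
        using y PE Q(3)
        by (intro chain_centralises[OF solv fin P(1) cP P(3) sQ cQ Q(2) _ \<psi> chain _ x]) (auto simp: cE)
      then show ?thesis using Pc[OF y] Qc[OF x(1)] by (simp add: \<psi>.H.m_assoc)
    qed
    then have "x \<in> P" using cent Qc[OF x(1)] by blast
    then show ?thesis using QP x(1) by blast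
  qed
  have "KP_chain t G Q E"
  proof (cases "power_free t (p - 1)")
    case False
    then have "Q = {\<one>}" using triv subgroup.one_closed[OF sQ] by blast
    moreover have "KP_link t G {\<one>} E"
      using triv_subgroup sE subgroup.one_closed[OF sE] subgroup.subset[OF sE]
      by (intro KP_link_normalI) (auto simp: subset_iff)
    ultimately show ?thesis by (simp add: r_into_rtranclp)
  next
    case True
    let ?E = "G\<lparr>carrier := E\<rparr>"
    have "KP_chain t ?E Q (carrier ?E)"
    proof (rule KP_chain_abelian_complement)
      show "group ?E" using sE by (rule subgroup_imp_group)
      show "finite (carrier ?E)" using subgroup_finite[OF sE fin] by simp
      show "P \<lhd> ?E"
        using sE sP PE normal.inv_op_closed2[OF P(1)] subgroup.subset[OF sE]
        by (subst normal_update_iff) auto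
      show "card P = p ^ k" by (rule cP)
      show "subgroup Q ?E" using sQ QE sE by (simp add: subgroup_update_iff)
      show "x \<otimes>\<^bsub>?E\<^esub> y = y \<otimes>\<^bsub>?E\<^esub> x" if x: "x \<in> Q" and y: "y \<in> Q" for x y
      proof -
        have "x \<otimes> y \<otimes> inv x \<otimes> inv y \<in> Q"
          using x y sQ by (simp add: subgroup.m_closed subgroup.m_inv_closed)
        then have "x \<otimes> y \<otimes> inv x \<otimes> inv y = \<one>" using x y by (intro triv) blast+
        moreover have "x \<otimes> y = (x \<otimes> y \<otimes> inv x \<otimes> inv y) \<otimes> (y \<otimes> x)"
          using Qc[OF x] Qc[OF y] by (simp add: m_assoc inv_mult_cancel)
        ultimately show ?thesis using Qc[OF x] Qc[OF y] by simp
      qed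
      show "x [^]\<^bsub>?E\<^esub> (p - 1) = \<one>\<^bsub>?E\<^esub>" if x: "x \<in> Q" for x
      proof -
        interpret Q: group "G\<lparr>carrier := Q\<rparr>" using sQ by (rule subgroup_imp_group)
        have "x [^] (p - 1) \<in> Q"
          using Q.nat_pow_closed[of x "p - 1"] x by (simp add: nat_pow_consistent[symmetric])
        then have "x [^] (p - 1) = \<one>" using x by (intro triv) blast+
        then show ?thesis by (simp add: nat_pow_consistent[symmetric])
      qed
      show "\<exists>y\<in>P. \<exists>x\<in>Q. g = y \<otimes>\<^bsub>?E\<^esub> x" if g: "g \<in> carrier ?E" for g
      proof -
        have "g \<in> \<pi>.preim (\<pi> ` Q)" using g by (simp add: E_def)
        then obtain y a where ya: "y \<in> P" "a \<in> Q" "g = a \<otimes> y"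
          using \<pi>.preim_image_member[OF sQ, of g] \<pi>(2) by metis
        have "a \<otimes> y \<otimes> inv a \<in> P" using P(1) Qc[OF ya(2)] ya(1) by (rule normal.inv_op_closed2)
        moreover have "g = (a \<otimes> y \<otimes> inv a) \<otimes>\<^bsub>?E\<^esub> a"
          using ya(3) Qc[OF ya(2)] Pc[OF ya(1)] by (simp add: m_assoc)
        ultimately show ?thesis using ya(2) by blast
      qed
    qed fact+
    then show ?thesis using KP_chain_update_iff[OF sE sQ, of E t] by simp
  qed
  then show ?thesis using kE by (rule rtranclp_trans)
qed

text \<open>
  Consider a counterexample of least order. The hypothesis passes to all quotients, so
  every proper quotient is in the class, and by \<open>sylow_KP_subdirect\<close> any two nontrivial
  normal subgroups meet nontrivially. The Sylow subgroup \<open>P\<close> for the largest prime is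
  normal modulo the kernel of \<open>f\<close>, hence normal. Its intersection \<open>D\<close> with that kernel
  is nontrivial and consists of Frattini elements, so the elements acting trivially on
  \<open>P / D\<close> lie in \<open>P\<close>. This is the situation of \<open>KP_chain_over_self_centralising_sylow\<close>,
  applied to the quotients by \<open>P\<close> and by \<open>D\<close>.
\<close>

lemma sylow_KP_saturated_nat:
  fixes G K :: "nat monoid"
  assumes "finite_epi G K f" "kernel G K f \<subseteq> frattini G" "sylow_KP_group t K"
  shows "sylow_KP_group t G"
  using assms
proof (induction "order G" arbitrary: G K f rule: less_induct)
  case less
  interpret group G using less.prems(1) by (simp add: finite_epi_def group_hom_def)
  interpret f: finite_epi G K f by fact
  have fin: "finite (carrier G)" by (rule f.finG)
  have quot: "\<exists>(L :: nat monoid) \<psi>. finite_epi G L \<psi> \<and> kernel G L \<psi> = M \<and> sylow_KP_group t L"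
    if M: "M \<lhd> G" "M \<noteq> {\<one>\<^bsub>G\<^esub>}" for M
  proof -
    obtain L :: "nat monoid" and \<psi> where \<psi>: "finite_epi G L \<psi>" "kernel G L \<psi> = M"
      using M(1) fin by (rule nat_quotient)
    interpret \<psi>: finite_epi G L \<psi> by fact
    have sM: "subgroup M G" using M(1) by (rule normal_imp_subgroup)
    have "card M \<noteq> 1" using M(2) sM subgroup_card_one by blast
    moreover have "card M > 0" using sM fin by (rule subgroup_card_pos)
    moreover have "order L > 0" using \<psi>.finH \<psi>.H.order_gt_0_iff_finite by blast
    ultimately have less_ord: "order L < order G" using \<psi>.order_epi \<psi>(2) by simp
    \<comment> \<open>Modulo its normal subgroup \<open>N\<close>, the quotient \<open>L\<close> is an image of \<open>K\<close>.\<close>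
    define N where "N = \<psi> ` kernel G K f"
    have N: "N \<lhd> L" unfolding N_def using f.normal_kernel by (rule \<psi>.image_normal)
    have NF: "N \<subseteq> frattini L" unfolding N_def using less.prems(2) \<psi>.frattini_image by blast
    obtain K' :: "nat monoid" and \<kappa> where \<kappa>: "finite_epi L K' \<kappa>" "kernel L K' \<kappa> = N"
      using N \<psi>.finH by (rule nat_quotient)
    have "kernel G K f \<subseteq> kernel G K' (\<kappa> \<circ> \<psi>)"
    proof
      fix x assume x: "x \<in> kernel G K f"
      then have "\<psi> x \<in> kernel L K' \<kappa>" using \<kappa>(2) by (simp add: N_def)
      then show "x \<in> kernel G K' (\<kappa> \<circ> \<psi>)" using x by (simp add: kernel_def)
    qed
    then have "sylow_KP_group t K'"
      using sylow_KP_factor[OF less.prems(1) finite_epi_comp[OF \<psi>(1) \<kappa>(1)] _ less.prems(3)] by blast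
    then have "sylow_KP_group t L" using less.hyps[OF less_ord \<kappa>(1)] NF \<kappa>(2) by simp
    then show ?thesis using \<psi> by blast
  qed
  have two: "sylow_KP_group t G"
    if M: "M1 \<lhd> G" "M1 \<noteq> {\<one>\<^bsub>G\<^esub>}" "M2 \<lhd> G" "M2 \<noteq> {\<one>\<^bsub>G\<^esub>}" "M1 \<inter> M2 = {\<one>\<^bsub>G\<^esub>}" for M1 M2
  proof -
    obtain L1 :: "nat monoid" and a where a: "finite_epi G L1 a" "kernel G L1 a = M1" "sylow_KP_group t L1"
      using quot[OF M(1,2)] by blast
    obtain L2 :: "nat monoid" and b where b: "finite_epi G L2 b" "kernel G L2 b = M2" "sylow_KP_group t L2"
      using quot[OF M(3,4)] by blast
    show ?thesis using a b M(5) by (intro sylow_KP_subdirect[OF a(1) b(1) a(3) b(3)]) simp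
  qed
  show ?case
  proof (rule ccontr)
    assume notKP: "\<not> sylow_KP_group t G"
    have "order G \<noteq> 1"
    proof
      assume "order G = 1"
      then have "carrier G = {\<one>\<^bsub>G\<^esub>}" using order_one_triv_iff by blast
      then show False using notKP sylow_KP_trivial[OF is_group] by blast
    qed
    then obtain p where p: "prime p" "p dvd order G" "\<And>q. prime q \<Longrightarrow> q dvd order G \<Longrightarrow> q \<le> p"
      using largest_prime[OF fin] by blast
    obtain P where P: "sylow_subgroup p P G" using p(1) fin by (rule sylow_exists)
    have sP: "subgroup P G" using P by (simp add: sylow_subgroup_def)
    have imP: "sylow_subgroup p (f ` P) K" using P p(1) by (rule f.sylow_image)
    have "order K dvd order G" using f.order_epi by simp
    then have "f ` P \<lhd> K"
      using p(3) dvd_trans by (intro f.H.largest_sylow_normal[OF less.prems(3) imP p(1)]) blast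
    then have nN: "f.preim (f ` P) \<lhd> G" by (rule f.preim_normal)
    have PN: "P \<subseteq> f.preim (f ` P)" using subgroup.subset[OF sP] by blast
    have nP: "P \<lhd> G"
    proof (rule sylow_normal_mod_frattini[OF nN _ p(1) fin])
      show "sylow_subgroup p P (G\<lparr>carrier := f.preim (f ` P)\<rparr>)"
        using P p(1) fin normal_imp_subgroup[OF nN] PN by (rule sylow_in_subgroup)
      fix n assume "n \<in> f.preim (f ` P)"
      then obtain d s where "d \<in> kernel G K f" "s \<in> P" "n = s \<otimes>\<^bsub>G\<^esub> d"
        using f.preim_image_member[OF sP, of n] by metis
      then show "\<exists>s\<in>P. \<exists>d\<in>frattini G. n = s \<otimes>\<^bsub>G\<^esub> d" using less.prems(2) by blast
    qed
    have P1: "P \<noteq> {\<one>\<^bsub>G\<^esub>}" using sylow_nontrivial(2)[OF P p(1,2) fin] by auto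
    have ker1: "kernel G K f \<noteq> {\<one>\<^bsub>G\<^esub>}"
      using notKP f.sylow_KP_injective[OF less.prems(3)] by blast
    define D where "D = P \<inter> kernel G K f"
    have nD: "D \<lhd> G" unfolding D_def using nP f.normal_kernel by (rule normal_subgroup_intersect)
    have D1: "D \<noteq> {\<one>\<^bsub>G\<^esub>}" unfolding D_def using two[OF nP P1 f.normal_kernel ker1] notKP by blast
    obtain R :: "nat monoid" and \<pi> where \<pi>: "finite_epi G R \<pi>" "kernel G R \<pi> = P" "sylow_KP_group t R"
      using quot[OF nP P1] by blast
    obtain L :: "nat monoid" and \<psi> where \<psi>: "finite_epi G L \<psi>" "kernel G L \<psi> = D" "sylow_KP_group t L"
      using quot[OF nD D1] by blast
    have DP: "D \<subseteq> P" "D \<subseteq> frattini G" unfolding D_def using less.prems(2) by blast+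
    have cent: "image_centraliser G L \<psi> P \<subseteq> P"
    proof (rule frattini_quotient_centraliser[OF fin nP P p(1) \<pi> \<psi>(1,2) DP])
      fix S assume S: "S \<lhd> G" "S \<inter> P = {\<one>\<^bsub>G\<^esub>}"
      show "S = {\<one>\<^bsub>G\<^esub>}" using two[OF S(1) _ nP P1 S(2)] notKP by blast
    qed
    have "KP_chain t G Q (carrier G)" if q: "prime q" and Q: "sylow_subgroup q Q G" for q Q
    proof (cases "q = p")
      case True
      then have "Q = P" using normal_sylow_unique[OF P p(1) fin nP] Q by simp
      then show ?thesis using KP_chain_normal_subgroup[OF nP] by simp
    next
      case False
      have "kernel G L \<psi> \<subseteq> P" using \<psi>(2) DP(1) by simp
      then show ?thesis
        using KP_chain_over_self_centralising_sylow[OF fin nP P p(1) \<pi> \<psi>(1) _ \<psi>(3) cent Q q False] by blast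
    qed
    then have "sylow_KP_group t G" unfolding sylow_KP_group_iff using is_group fin by blast
    with notKP show False ..
  qed
qed

text \<open>
  The passage from groups of natural numbers to arbitrary element types.
\<close>

lemma sylow_KP_saturated:
  assumes G: "group G" "finite (carrier G)" and KP: "sylow_KP_group t (G Mod frattini G)"
  shows "sylow_KP_group t G"
proof -
  interpret group G by fact
  have nF: "frattini G \<lhd> G" using G(2) by (rule frattini_normal)
  note q = finite_epi_quotient[OF nF G(2)]
  obtain K :: "nat monoid" and f where f: "finite_epi G K f" "kernel G K f = {\<one>\<^bsub>G\<^esub>}"
    using G by (rule nat_copy)
  interpret f: finite_epi G K f by fact
  define N where "N = f ` frattini G"
  have N: "N \<lhd> K" unfolding N_def using nF by (rule f.image_normal)
  obtain L :: "nat monoid" and \<psi> where \<psi>: "finite_epi K L \<psi>" "kernel K L \<psi> = N"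
    using N f.finH by (rule nat_quotient)
  have "kernel G (G Mod frattini G) (\<lambda>x. frattini G #>\<^bsub>G\<^esub> x) \<subseteq> kernel G L (\<psi> \<circ> f)"
  proof
    fix x assume "x \<in> kernel G (G Mod frattini G) (\<lambda>x. frattini G #>\<^bsub>G\<^esub> x)"
    then have x: "x \<in> frattini G" using q(2) by simp
    then have "f x \<in> kernel K L \<psi>" using \<psi>(2) by (simp add: N_def)
    moreover have "x \<in> carrier G" using x by (simp add: frattini_def)
    ultimately show "x \<in> kernel G L (\<psi> \<circ> f)" by (simp add: kernel_def)
  qed
  then have "sylow_KP_group t L"
    using sylow_KP_factor[OF q(1) finite_epi_comp[OF f(1) \<psi>(1)] _ KP] by blast
  moreover have "N \<subseteq> frattini K" unfolding N_def by (rule f.frattini_image)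
  ultimately have "sylow_KP_group t K" using sylow_KP_saturated_nat[OF \<psi>(1)] \<psi>(2) by simp
  then show ?thesis using f(2) by (rule f.sylow_KP_injective)
qed

section \<open>Ore dispersivity and nilpotency\<close>

lemma (in finite_epi) ore_dispersive_step:
  assumes P: "sylow_subgroup p ker G" "prime p" "p dvd order G"
    and large: "\<And>q. prime q \<Longrightarrow> q dvd order G \<Longrightarrow> q \<le> p" and H: "ore_dispersive H"
  shows "ore_dispersive G"
proof -
  obtain n :: nat and r :: "nat \<Rightarrow> nat" and \<alpha> :: "nat \<Rightarrow> nat" where
    all: "(\<forall>i\<in>{1..n}. prime (r i) \<and> \<alpha> i \<ge> 1) \<and>
      (\<forall>i\<in>{1..n}. \<forall>j\<in>{1..n}. i < j \<longrightarrow> r i > r j) \<and>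
      order H = (\<Prod>i=1..n. r i ^ \<alpha> i) \<and>
      (\<forall>i\<in>{1..n}. \<exists>N. N \<lhd> H \<and> card N = (\<Prod>j=1..i. r j ^ \<alpha> j))"
    using H unfolding ore_dispersive_def by (elim exE)
  have r: "prime (r i) \<and> \<alpha> i \<ge> 1" if "i \<in> {1..n}" for i using all that by blast
  have dec: "r i > r j" if "i \<in> {1..n}" "j \<in> {1..n}" "i < j" for i j using all that by blast
  have ordH: "order H = (\<Prod>i=1..n. r i ^ \<alpha> i)" using all by blast
  have norm: "\<exists>N. N \<lhd> H \<and> card N = (\<Prod>j=1..i. r j ^ \<alpha> j)" if "i \<in> {1..n}" for i using all that by blast
  obtain m where m: "subgroup ker G" "card ker = p ^ multiplicity p (order G)" "order G = card ker * m" "\<not> p dvd m"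
    using P(1,2) finG by (rule G.sylow_subgroupE)
  have mH: "order H = m" using order_epi m(3) G.subgroup_card_pos[OF m(1) finG] by simp
  have less: "r i < p" if i: "i \<in> {1..n}" for i
  proof -
    have "r i dvd r i ^ \<alpha> i" using r[OF i] by (simp add: dvd_power)
    also have "\<dots> dvd order H" unfolding ordH using i by (intro dvd_prodI) auto
    finally have dvd: "r i dvd order H" .
    then have "r i dvd order G" using order_epi by simp
    then have "r i \<le> p" using large r[OF i] by blast
    moreover have "r i \<noteq> p" using dvd mH m(4) by metis
    ultimately show ?thesis by simp
  qed
  define e where "e = multiplicity p (order G)"
  \<comment> \<open>The tower of \<open>H\<close> is shifted by one place, and \<open>p\<close> is put in front.\<close>
  define r' where "r' i = (if i = 1 then p else r (i - 1))" for i
  define \<alpha>' where "\<alpha>' i = (if i = 1 then e else \<alpha> (i - 1))" for i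
  have e1: "e \<ge> 1"
    using G.sylow_nontrivial(2)[OF P finG] m(2) by (cases "e = 0") (auto simp: e_def)
  have shift: "(\<Prod>i=1..Suc k. r' i ^ \<alpha>' i) = card ker * (\<Prod>i=1..k. r i ^ \<alpha> i)" for k
  proof -
    have "(\<Prod>i=1..Suc k. r' i ^ \<alpha>' i) = r' 1 ^ \<alpha>' 1 * (\<Prod>i=Suc 1..Suc k. r' i ^ \<alpha>' i)"
      by (intro prod.atLeast_Suc_atMost) simp
    also have "(\<Prod>i=Suc 1..Suc k. r' i ^ \<alpha>' i) = (\<Prod>i=1..k. r' (Suc i) ^ \<alpha>' (Suc i))"
      by (rule prod.shift_bounds_cl_Suc_ivl)
    also have "\<dots> = (\<Prod>i=1..k. r i ^ \<alpha> i)" by (intro prod.cong) (auto simp: r'_def \<alpha>'_def)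
    finally show ?thesis using m(2) by (simp add: r'_def \<alpha>'_def e_def)
  qed
  have split: "i = 1 \<or> (\<exists>k\<in>{1..n}. i = Suc k)" if "i \<in> {1..Suc n}" for i
    using that by (cases i) auto
  have primes: "prime (r' i) \<and> \<alpha>' i \<ge> 1" if i: "i \<in> {1..Suc n}" for i
    using split[OF i] P(2) e1 r by (auto simp: r'_def \<alpha>'_def)
  have decreasing: "r' i > r' j" if i: "i \<in> {1..Suc n}" and j: "j \<in> {1..Suc n}" and ij: "i < j" for i j
  proof -
    obtain l where l: "l \<in> {1..n}" "j = Suc l" using split[OF j] i ij by auto
    show ?thesis
      using split[OF i]
    proof (elim disjE bexE)
      assume "i = 1"
      then show ?thesis using less[OF l(1)] l by (auto simp: r'_def)
    next
      fix k assume k: "k \<in> {1..n}" "i = Suc k"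
      then show ?thesis using dec[OF k(1) l(1)] l ij by (auto simp: r'_def)
    qed
  qed
  have normal: "\<exists>N. N \<lhd> G \<and> card N = (\<Prod>j=1..i. r' j ^ \<alpha>' j)" if i: "i \<in> {1..Suc n}" for i
    using split[OF i]
  proof (elim disjE bexE)
    assume "i = 1"
    then have "card ker = (\<Prod>j=1..i. r' j ^ \<alpha>' j)" using shift[of 0] by simp
    then show ?thesis using normal_kernel by blast
  next
    fix k assume k: "k \<in> {1..n}" "i = Suc k"
    obtain N where N: "N \<lhd> H" "card N = (\<Prod>j=1..k. r j ^ \<alpha> j)" using norm[OF k(1)] by blast
    have "card (preim N) = (\<Prod>j=1..i. r' j ^ \<alpha>' j)"
      unfolding k(2) shift using card_preim[OF normal_imp_subgroup[OF N(1)]] N(2) by simp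
    then show ?thesis using preim_normal[OF N(1)] by blast
  qed
  have "order G = (\<Prod>i=1..Suc n. r' i ^ \<alpha>' i)" unfolding shift using order_epi ordH by simp
  then show ?thesis
    unfolding ore_dispersive_def using primes decreasing normal
    by (intro exI[of _ "Suc n"] exI[of _ r'] exI[of _ \<alpha>'] conjI ballI impI) simp_all
qed

lemma ore_dispersive_trivial:
  assumes "order G = 1" shows "ore_dispersive G"
  unfolding ore_dispersive_def using assms by (intro exI[of _ 0]) simp

lemma sylow_KP_ore_dispersive:
  assumes "sylow_KP_group t G" shows "ore_dispersive G"
proof -
  interpret group G using assms by (simp add: sylow_KP_group_def)
  have fin: "finite (carrier G)" using assms by (simp add: sylow_KP_group_def)
  have nat: "ore_dispersive K" if "sylow_KP_group t K" for K :: "nat monoid"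
    using that
  proof (induction rule: sylow_KP_tower_induct)
    case (trivial K)
    show ?case using trivial(2) by (rule ore_dispersive_trivial)
  next
    case (step G K f p)
    then show ?case by (intro finite_epi.ore_dispersive_step[of G K f p]) auto
  qed
  show ?thesis
  proof (cases "order G = 1")
    case True
    then show ?thesis by (rule ore_dispersive_trivial)
  next
    case False
    then obtain p where p: "prime p" "p dvd order G" "\<And>q. prime q \<Longrightarrow> q dvd order G \<Longrightarrow> q \<le> p"
      using largest_prime[OF fin] by blast
    obtain P where P: "sylow_subgroup p P G" using p(1) fin by (rule sylow_exists)
    have nP: "P \<lhd> G" using assms P p(1,3) by (rule largest_sylow_normal)
    obtain K :: "nat monoid" and f where f: "finite_epi G K f" "kernel G K f = P"
      using nP fin by (rule nat_quotient)
    have "ore_dispersive K" using nat finite_epi.sylow_KP_image[OF f(1) assms] by blast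
    then show ?thesis using finite_epi.ore_dispersive_step[OF f(1)] P p f(2) by blast
  qed
qed

lemma (in group) lower_central_normal: "lower_central G n \<lhd> G"
proof (induction n)
  case 0
  then show ?case by (simp add: normal_self)
next
  case (Suc n)
  let ?S = "\<Union>x\<in>lower_central G n. \<Union>y\<in>carrier G. {x \<otimes> y \<otimes> inv x \<otimes> inv y}"
  have sub: "x \<in> carrier G" if "x \<in> lower_central G n" for x
    using that normal_imp_subgroup[OF Suc] subgroup.mem_carrier by metis
  have "generate G ?S \<lhd> G"
  proof (rule normal_generateI)
    show "?S \<subseteq> carrier G" using sub by auto
    fix h g assume "h \<in> ?S" and g: "g \<in> carrier G"
    then obtain x y where xy: "x \<in> lower_central G n" "y \<in> carrier G" "h = x \<otimes> y \<otimes> inv x \<otimes> inv y" by blast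
    have "g \<otimes> x \<otimes> inv g \<in> lower_central G n" using Suc g xy(1) by (rule normal.inv_op_closed2)
    moreover have "g \<otimes> y \<otimes> inv g \<in> carrier G" using g xy(2) by simp
    moreover have "g \<otimes> h \<otimes> inv g = (g \<otimes> x \<otimes> inv g) \<otimes> (g \<otimes> y \<otimes> inv g) \<otimes> inv (g \<otimes> x \<otimes> inv g) \<otimes> inv (g \<otimes> y \<otimes> inv g)"
      unfolding xy(3) using g sub[OF xy(1)] xy(2) by (simp add: m_assoc inv_mult_group inv_mult_cancel)
    ultimately show "g \<otimes> h \<otimes> inv g \<in> ?S" by blast
  qed
  then show ?case by simp
qed

text \<open>
  Let \<open>\<gamma>\<close> be the lower central series. The subgroups \<open>A \<gamma>(i)\<close> descend from
  \<open>G\<close> to \<open>A\<close>, and each is normal in its predecessor because \<open>\<gamma>(i)\<close> is central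
  modulo \<open>\<gamma>(i + 1)\<close>.
\<close>

lemma nilpotent_subgroup_KP_chain:
  fixes G (structure)
  assumes nil: "nilpotent_group G" and fin: "finite (carrier G)" and A: "subgroup A G"
  shows "KP_chain t G A (carrier G)"
proof -
  interpret group G using nil by (simp add: nilpotent_group_def)
  obtain n where n: "lower_central G n = {\<one>}" using nil by (auto simp: nilpotent_group_def)
  let ?\<gamma> = "lower_central G"
  let ?q = "\<lambda>i x. ?\<gamma> i #> x"
  \<comment> \<open>\<open>M i\<close> is the product of \<open>A\<close> with the \<open>i\<close>th term of the lower central series.\<close>
  define M where "M i = {x \<in> carrier G. ?q i x \<in> ?q i ` A}" for i
  have Ac: "a \<in> carrier G" if "a \<in> A" for a using that A subgroup.mem_carrier by metis
  have epi: "finite_epi G (G Mod ?\<gamma> i) (?q i)" "kernel G (G Mod ?\<gamma> i) (?q i) = ?\<gamma> i" for i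
    using finite_epi_quotient[OF lower_central_normal fin] by blast+
  have sM: "subgroup (M i) G" for i
    unfolding M_def using finite_epi.preim_subgroup[OF epi(1)] finite_epi.image_subgroup[OF epi(1) A] by blast
  have A_in_M: "A \<subseteq> M i" for i unfolding M_def using Ac by blast
  have \<gamma>_in_M: "?\<gamma> i \<subseteq> M i" for i
    unfolding M_def using finite_epi.ker_in_preim[OF epi(1) finite_epi.image_subgroup[OF epi(1) A]] epi(2) by blast
  have M_dec: "\<exists>a\<in>A. \<exists>l\<in>?\<gamma> i. x = a \<otimes> l" if "x \<in> M i" for i x
    using finite_epi.preim_image_member[OF epi(1) A, of x i] that epi(2)[of i] unfolding M_def by metis
  have sub: "l \<in> carrier G" if "l \<in> ?\<gamma> i" for i l
    using that normal_imp_subgroup[OF lower_central_normal] subgroup.mem_carrier by metis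
  have desc: "?\<gamma> (Suc i) \<subseteq> ?\<gamma> i" for i
  proof -
    have s: "subgroup (?\<gamma> i) G" using lower_central_normal by (rule normal_imp_subgroup)
    have "x \<otimes> y \<otimes> inv x \<otimes> inv y \<in> ?\<gamma> i" if x: "x \<in> ?\<gamma> i" and y: "y \<in> carrier G" for x y
    proof -
      have "inv x \<in> ?\<gamma> i" using x by (rule subgroup.m_inv_closed[OF s])
      then have "y \<otimes> inv x \<otimes> inv y \<in> ?\<gamma> i" by (rule normal.inv_op_closed2[OF lower_central_normal y])
      then have "x \<otimes> (y \<otimes> inv x \<otimes> inv y) \<in> ?\<gamma> i" by (rule subgroup.m_closed[OF s x])
      then show ?thesis using sub[OF x] y by (simp add: m_assoc)
    qed
    then show ?thesis using s by (simp del: UN_simps) (intro generate_subgroup_incl, blast, simp)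
  qed
  have st: "KP_link t G (M (Suc i)) (M i)" for i
  proof (rule KP_link_normalI[OF sM sM])
    show "M (Suc i) \<subseteq> M i"
    proof
      fix x assume "x \<in> M (Suc i)"
      then obtain a l where "a \<in> A" "l \<in> ?\<gamma> (Suc i)" "x = a \<otimes> l" using M_dec by blast
      then show "x \<in> M i"
        using A_in_M[of i] \<gamma>_in_M[of i] desc[of i] subgroup.m_closed[OF sM[of i], of a l] by blast
    qed
    fix u b assume u: "u \<in> M (Suc i)" and b: "b \<in> M i"
    interpret q: finite_epi G "G Mod ?\<gamma> (Suc i)" "?q (Suc i)" by (rule epi)
    let ?Q = "G Mod ?\<gamma> (Suc i)" and ?h = "?q (Suc i)"
    obtain a l where al: "a \<in> A" "l \<in> ?\<gamma> i" "b = a \<otimes> l" using M_dec[OF b] by blast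
    have uc: "u \<in> carrier G" and hu: "?h u \<in> ?h ` A" using u by (simp_all add: M_def)
    have lc: "l \<in> carrier G" and ac: "a \<in> carrier G" using al sub Ac by blast+
    have "l \<otimes> u \<otimes> inv l \<otimes> inv u \<in> ?\<gamma> (Suc i)"
      using al(2) uc by (simp del: UN_simps) (intro generate.incl, blast)
    then have "?h (l \<otimes> u \<otimes> inv l \<otimes> inv u) = \<one>\<^bsub>?Q\<^esub>" using epi(2)[of "Suc i"] by (auto simp: kernel_def)
    then have one: "?h (l \<otimes> u \<otimes> inv l \<otimes> inv u) \<otimes>\<^bsub>?Q\<^esub> ?h u = ?h u"
      using q.H.l_one[OF q.hom_closed[OF uc]] by metis
    have "l \<otimes> u \<otimes> inv l = (l \<otimes> u \<otimes> inv l \<otimes> inv u) \<otimes> u"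
      using lc uc by (simp add: m_assoc)
    then have hl: "?h (l \<otimes> u \<otimes> inv l) = ?h u"
      using one q.hom_mult[of "l \<otimes> u \<otimes> inv l \<otimes> inv u" u] lc uc
      by (metis inv_closed m_closed)
    have "b \<otimes> u \<otimes> inv b = a \<otimes> (l \<otimes> u \<otimes> inv l) \<otimes> inv a"
      unfolding al(3) using lc uc ac by (simp add: m_assoc inv_mult_group)
    then have "?h (b \<otimes> u \<otimes> inv b) = ?h a \<otimes>\<^bsub>?Q\<^esub> ?h (l \<otimes> u \<otimes> inv l) \<otimes>\<^bsub>?Q\<^esub> inv\<^bsub>?Q\<^esub> ?h a"
      using q.hom_mult[of "a \<otimes> (l \<otimes> u \<otimes> inv l)" "inv a"]
        q.hom_mult[of a "l \<otimes> u \<otimes> inv l"] q.hom_inv[OF ac] ac lc uc by (metis inv_closed m_closed)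
    also have "\<dots> = ?h a \<otimes>\<^bsub>?Q\<^esub> ?h u \<otimes>\<^bsub>?Q\<^esub> inv\<^bsub>?Q\<^esub> ?h a" unfolding hl ..
    also have "\<dots> \<in> ?h ` A"
    proof -
      have s: "subgroup (?h ` A) ?Q" using A by (rule q.image_subgroup)
      have "?h a \<in> ?h ` A" using al(1) by blast
      then show ?thesis
        using hu by (intro subgroup.m_closed[OF s] subgroup.m_inv_closed[OF s])
    qed
    finally show "b \<otimes> u \<otimes> inv b \<in> M (Suc i)"
      unfolding M_def using ac lc uc al(3) by simp
  qed
  have "KP_chain t G (M i) (M 0)" for i
  proof (induction i)
    case (Suc i)
    with st show ?case by (rule converse_rtranclp_into_rtranclp)
  qed simp
  moreover have "M 0 = carrier G" using \<gamma>_in_M[of 0] subgroup.subset[OF sM[of 0]] by auto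
  moreover have "M n = A"
  proof
    show "M n \<subseteq> A"
    proof
      fix x assume "x \<in> M n"
      then obtain a l where "a \<in> A" "l \<in> ?\<gamma> n" "x = a \<otimes> l" using M_dec[of x n] by blast
      then show "x \<in> A" using Ac n by simp
    qed
  qed (rule A_in_M)
  ultimately show ?thesis by metis
qed

lemma nilpotent_sylow_KP:
  assumes "nilpotent_group G" "finite (carrier G)" shows "sylow_KP_group t G"
  unfolding sylow_KP_group_iff
  using assms nilpotent_subgroup_KP_chain[OF assms] by (auto simp: nilpotent_group_def sylow_subgroup_def)

section \<open>The class as a formation\<close>

lemma sylow_KP_iso:
  assumes "sylow_KP_group t G" "group K" "G \<cong> K" shows "sylow_KP_group t K"
proof -
  obtain f where f: "f \<in> iso G K" using assms(3) by (auto simp: is_iso_def)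
  have "finite_epi G K f" using f assms(1,2) by (intro finite_epi_iso(1)) (auto simp: sylow_KP_group_def)
  then show ?thesis using assms(1) by (rule finite_epi.sylow_KP_image)
qed

lemma in_sylow_KP_class_iff: "in_class G (sylow_KP_class t) \<longleftrightarrow> sylow_KP_group t G"
proof
  assume "in_class G (sylow_KP_class t)"
  then obtain K :: "nat monoid" where K: "group G" "sylow_KP_group t K" "G \<cong> K"
    by (auto simp: in_class_def sylow_KP_class_def)
  have "K \<cong> G" using K(1,3) by (rule group.iso_sym)
  then show "sylow_KP_group t G" by (rule sylow_KP_iso[OF K(2,1)])
next
  assume G: "sylow_KP_group t G"
  then have grp: "group G" "finite (carrier G)" by (simp_all add: sylow_KP_group_def)
  obtain K :: "nat monoid" where K: "group K" "G \<cong> K" using finite_group_nat_copy[OF grp] by blast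
  have "sylow_KP_group t K" using G K by (rule sylow_KP_iso)
  then show "in_class G (sylow_KP_class t)"
    using grp K unfolding in_class_def sylow_KP_class_def by blast
qed

lemma sylow_KP_quotient:
  assumes "sylow_KP_group t G" "N \<lhd> G" shows "sylow_KP_group t (G Mod N)"
proof -
  have "finite (carrier G)" using assms(1) by (simp add: sylow_KP_group_def)
  then show ?thesis
    using finite_epi_quotient(1)[OF assms(2)] assms(1) finite_epi.sylow_KP_image by blast
qed

lemma sylow_KP_hereditary_saturated_formation:
  "hereditary_saturated_formation (sylow_KP_class t)"
  unfolding hereditary_saturated_formation_def formation_def group_class_def hereditary_def saturated_def
    in_sylow_KP_class_iff
proof (intro conjI ballI allI impI)
  fix G :: "nat monoid" assume "G \<in> sylow_KP_class t"
  then have G: "sylow_KP_group t G" by (simp add: sylow_KP_class_def)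
  then show "group G" "finite (carrier G)" by (simp_all add: sylow_KP_group_def)
  show "K \<in> sylow_KP_class t" if "group K" "G \<cong> K" for K :: "nat monoid"
    using sylow_KP_iso[OF G that] by (simp add: sylow_KP_class_def)
  show "sylow_KP_group t (G Mod N)" if "N \<lhd> G" for N using G that by (rule sylow_KP_quotient)
  show "sylow_KP_group t (G\<lparr>carrier := U\<rparr>)" if "subgroup U G" for U using G that by (rule sylow_KP_subgroup)
next
  fix G :: "nat monoid" and N1 N2
  assume "group G" "finite (carrier G)" "N1 \<lhd> G" "N2 \<lhd> G"
    "sylow_KP_group t (G Mod N1)" "sylow_KP_group t (G Mod N2)"
  then show "sylow_KP_group t (G Mod (N1 \<inter> N2))" by (intro sylow_KP_quotient_inter[of G N1 N2 t])
next
  fix G :: "nat monoid"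
  assume "group G" "finite (carrier G)" "sylow_KP_group t (G Mod frattini G)"
  then show "sylow_KP_group t G" by (rule sylow_KP_saturated)
qed

theorem theorem3p1:
  fixes t :: nat and G :: "('a, 'b) monoid_scheme"
  assumes "t \<ge> 1" and "group G" and "finite (carrier G)"
  shows
    "((nilpotent_group G \<longrightarrow> sylow_KP_group t G) \<and> (sylow_KP_group t G \<longrightarrow> ore_dispersive G)) \<and>
     (\<forall>N. sylow_KP_group t G \<longrightarrow> N \<lhd> G \<longrightarrow> sylow_KP_group t (G Mod N)) \<and>
     (\<forall>N\<^sub>1 N\<^sub>2. N\<^sub>1 \<lhd> G \<longrightarrow> N\<^sub>2 \<lhd> G \<longrightarrow>
        sylow_KP_group t (G Mod N\<^sub>1) \<longrightarrow> sylow_KP_group t (G Mod N\<^sub>2) \<longrightarrow>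
        sylow_KP_group t (G Mod (N\<^sub>1 \<inter> N\<^sub>2))) \<and>
     ((\<forall>(A :: ('c, 'd) monoid_scheme) (B :: ('e, 'f) monoid_scheme).
        sylow_KP_group t A \<longrightarrow> sylow_KP_group t B \<longrightarrow> sylow_KP_group t (A \<times>\<times> B)) \<and>
      (\<forall>(I :: 'i set) (K :: 'i \<Rightarrow> ('c, 'd) monoid_scheme). finite I \<longrightarrow>
        (\<forall>i\<in>I. sylow_KP_group t (K i)) \<longrightarrow> sylow_KP_group t (product_group I K))) \<and>
     (\<forall>U. sylow_KP_group t G \<longrightarrow> subgroup U G \<longrightarrow> sylow_KP_group t (G\<lparr>carrier := U\<rparr>)) \<and>
     (sylow_KP_group t (G Mod frattini G) \<longrightarrow> sylow_KP_group t G) \<and>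
     hereditary_saturated_formation (sylow_KP_class t)"
proof (intro conjI allI impI)
  show "sylow_KP_group t G" if "nilpotent_group G" using that assms(3) by (rule nilpotent_sylow_KP)
  show "ore_dispersive G" if "sylow_KP_group t G" using that by (rule sylow_KP_ore_dispersive)
  show "sylow_KP_group t (G Mod N)" if "sylow_KP_group t G" "N \<lhd> G" for N
    using that by (rule sylow_KP_quotient)
  show "sylow_KP_group t (G Mod (N\<^sub>1 \<inter> N\<^sub>2))"
    if "N\<^sub>1 \<lhd> G" "N\<^sub>2 \<lhd> G" "sylow_KP_group t (G Mod N\<^sub>1)" "sylow_KP_group t (G Mod N\<^sub>2)" for N\<^sub>1 N\<^sub>2
    using assms(3) that by (rule sylow_KP_quotient_inter)
  show "sylow_KP_group t (A \<times>\<times> B)" if "sylow_KP_group t A" "sylow_KP_group t B"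
    for A :: "('c, 'd) monoid_scheme" and B :: "('e, 'f) monoid_scheme"
    using that by (rule sylow_KP_DirProd)
  show "sylow_KP_group t (product_group I K)" if "finite I" "\<forall>i\<in>I. sylow_KP_group t (K i)"
    for I :: "'i set" and K :: "'i \<Rightarrow> ('c, 'd) monoid_scheme"
    using that by (intro sylow_KP_product_group) simp_all
  show "sylow_KP_group t (G\<lparr>carrier := U\<rparr>)" if "sylow_KP_group t G" "subgroup U G" for U
    using that by (rule sylow_KP_subgroup)
  show "sylow_KP_group t G" if "sylow_KP_group t (G Mod frattini G)"
    using assms(2,3) that by (rule sylow_KP_saturated)
  show "hereditary_saturated_formation (sylow_KP_class t)"
    by (rule sylow_KP_hereditary_saturated_formation)
qed

end
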